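(* Let $(a_n)_{n\ge1}$, $(b_n)_{n\ge1}$ be sequences of positive integers and $\theta=\sum_{n=1}^{\infty}\frac{a_n}{b_n}$. Assume: (1) $b_1<b_2<\cdots$ and $b_n\mid b_{n+1}$ for all $n$; (2) there is $\epsilon>0$ such that $\frac{a_{n+1}b_n^{2+\epsilon}}{b_{n+1}}<\frac12$ for all sufficiently large $n$. Then $\theta$ is a transcendental number. *)

theory Defs
  imports Complex_Main "HOL-Computational_Algebra.Polynomial"
begin

end

theory Submission
  imports Defs "HOL-Library.Function_Algebras" "HOL-Library.Poly_Mapping" "Jordan_Normal_Form.Determinant"
begin

text \<open>
  If \<open>s n\<close> is the sum of the first \<open>n\<close> terms, then \<open>s n * b n\<close> is an integer, because the
  denominators form a divisor chain. Since they also at least double, the growth condition bounds the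
  remainder: \<open>0 < \<theta> - s n < b n powr - (2 + \<epsilon>)\<close>. By Roth's theorem an algebraic
  \<open>\<theta>\<close> admits such approximations only with bounded reduced denominators, whereas the \<open>s n\<close>
  are strictly increasing and converge.

  For Roth's theorem, Siegel's lemma yields an integer polynomial in \<open>M\<close> variables whose index
  (the least weighted order of its Taylor coefficients) at \<open>(\<alpha>, \<dots>, \<alpha>)\<close> is almost \<open>M / 2\<close>. Very good
  approximations with rapidly growing denominators force its Taylor coefficients of small weight at
  the approximation point to vanish, since they are rationals that are too small. This contradicts Roth's
  lemma, which bounds the index at a rational point in terms of the height; it is proved by induction
  on the number of variables with generalized Wronskians.
\<close>

text \<open>Why 2 is the threshold: choose degrees \<open>r h\<close> for which all
  \<open>q h ^ r h\<close> are close to one size exp D. A nonzero Taylor coefficient at the rational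
  point is then at least about exp (- M * D), whereas vanishing to index about M / 2 at (\<alpha>,
  ..., \<alpha>) makes it at most about exp (- (2 + \<epsilon>) * D * M / 2). Only a gap of order
  \<epsilon> * M * D is left to absorb heights, rounding of degrees, the deficit from M / 2, and the
  index that Roth's lemma leaves at the rational point; the small constants are shares of this gap.
  Equalising the \<open>q h ^ r h\<close> while \<open>q h\<close> grows rapidly makes the degrees
  fall rapidly, which is what Roth's lemma requires. The number \<open>M\<close> of variables stays
  fixed and absent variables have degree 0, so the induction in Roth's lemma never changes the ring.
  Coefficients are real, with integrality as a predicate, because both the expansion at \<alpha> and
  the factors of a Wronskian leave the integers.\<close>

hide_const (open) Module.smult

section \<open>Polynomials in several variables as finitely supported maps, and substitution\<close>

type_synonym mpol = "(nat \<Rightarrow> nat) \<Rightarrow>\<^sub>0 real"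

abbreviation lookup :: "('a \<Rightarrow>\<^sub>0 'b::zero) \<Rightarrow> 'a \<Rightarrow> 'b" where
  "lookup \<equiv> Poly_Mapping.lookup"

abbreviation mterm :: "'a \<Rightarrow> 'b \<Rightarrow> 'a \<Rightarrow>\<^sub>0 'b::zero" where
  "mterm \<equiv> Poly_Mapping.single"

abbreviation keys :: "('a \<Rightarrow>\<^sub>0 'b::zero) \<Rightarrow> 'a set" where
  "keys \<equiv> Poly_Mapping.keys"

lemma poly_mapping_sum_single:
  "(\<Sum>K\<in>keys P. mterm K (lookup P K)) = P"
  by (rule poly_mapping_eqI)
    (auto simp: lookup_sum lookup_single when_def in_keys_iff)

lemma lookup_mult_sum:
  fixes P Q :: "'a::monoid_add \<Rightarrow>\<^sub>0 'b::semiring_0"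
  shows "lookup (P * Q) L = (\<Sum>J\<in>keys P. \<Sum>K\<in>keys Q. if J + K = L then lookup P J * lookup Q K else 0)"
proof -
  have "P * Q = (\<Sum>J\<in>keys P. mterm J (lookup P J)) * (\<Sum>K\<in>keys Q. mterm K (lookup Q K))"
    by (simp add: poly_mapping_sum_single)
  also have "\<dots> = (\<Sum>J\<in>keys P. \<Sum>K\<in>keys Q. mterm (J + K) (lookup P J * lookup Q K))"
    by (simp add: sum_product mult_single)
  finally show ?thesis by (simp add: lookup_sum lookup_single when_def)
qed

lemma mpol_induct [case_names zero add]:
  assumes "Q 0" "\<And>K c P. Q P \<Longrightarrow> Q (mterm K c + P)"
  shows "Q (P :: 'a \<Rightarrow>\<^sub>0 'b::comm_monoid_add)"
proof -
  have "Q (\<Sum>K\<in>A. mterm K (lookup P K))" if "finite A" for A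
    using that by induction (auto intro: assms)
  from this[of "keys P"] show ?thesis by (simp add: poly_mapping_sum_single)
qed

text \<open>The map \<open>c\<close> embeds coefficients in the target ring. Three instances occur:
  evaluation at a real point (identity), restriction to a polynomial curve (\<open>[:a:]\<close>)
  and translation (\<open>mconst\<close>). Variables with index at least \<open>M\<close> are
  replaced by 1.\<close>

definition msub :: "(real \<Rightarrow> 'b::comm_ring_1) \<Rightarrow> nat \<Rightarrow> (nat \<Rightarrow> 'b) \<Rightarrow> mpol \<Rightarrow> 'b" where
  "msub c M \<sigma> P = (\<Sum>K\<in>keys P. c (lookup P K) * (\<Prod>h<M. \<sigma> h ^ K h))"

lemma msub_cong: "(\<And>h. h < M \<Longrightarrow> \<sigma> h = \<tau> h) \<Longrightarrow> msub c M \<sigma> P = msub c M \<tau> P"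
  by (simp add: msub_def)

locale coeff_hom = comm_ring_hom c for c :: "real \<Rightarrow> 'b::comm_ring_1"
begin

lemma msub_superset:
  assumes "finite A" "keys P \<subseteq> A"
  shows "msub c M \<sigma> P = (\<Sum>K\<in>A. c (lookup P K) * (\<Prod>h<M. \<sigma> h ^ K h))"
  unfolding msub_def using assms
  by (intro sum.mono_neutral_left) (auto simp: in_keys_iff)

lemma msub_single [simp]: "msub c M \<sigma> (mterm K a) = c a * (\<Prod>h<M. \<sigma> h ^ K h)"
  by (subst msub_superset[of "{K}"]) auto

lemma msub_add: "msub c M \<sigma> (P + Q) = msub c M \<sigma> P + msub c M \<sigma> Q"
proof -
  have *: "finite (keys P \<union> keys Q)" by simp
  show ?thesis
    by (subst (1 2 3) msub_superset[OF *])
      (auto simp: lookup_add hom_add algebra_simps sum.distrib dest: subsetD[OF keys_add])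
qed

lemma msub_zero [simp]: "msub c M \<sigma> 0 = 0"
  by (simp add: msub_def)

lemma msub_mult: "msub c M \<sigma> (P * Q) = msub c M \<sigma> P * msub c M \<sigma> Q"
proof (induction P rule: mpol_induct)
  case (add K a P)
  have "msub c M \<sigma> (mterm K a * Q) = msub c M \<sigma> (mterm K a) * msub c M \<sigma> Q"
  proof (induction Q rule: mpol_induct)
    case (add L b Q)
    have "msub c M \<sigma> (mterm K a * mterm L b) = msub c M \<sigma> (mterm K a) * msub c M \<sigma> (mterm L b)"
      by (simp add: mult_single hom_mult power_add prod.distrib mult_ac)
    with add show ?case by (simp only: distrib_left msub_add)
  qed simp
  with add show ?case by (simp only: distrib_right msub_add)
qed simp

lemma msub_one [simp]: "msub c M \<sigma> 1 = 1"
  using msub_single[of M \<sigma> 0 1] by simp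

lemma comm_ring_hom_msub: "comm_ring_hom (msub c M \<sigma>)"
  by unfold_locales (simp_all add: msub_add msub_mult)

end

lemma hom_msub:
  assumes "comm_ring_hom f"
  shows "f (msub c M \<sigma> P) = msub (\<lambda>a. f (c a)) M (\<lambda>h. f (\<sigma> h)) P"
proof -
  interpret comm_ring_hom f by fact
  show ?thesis by (simp add: msub_def hom_sum hom_mult hom_prod hom_power)
qed

section \<open>Constants, variables and Taylor expansion\<close>

definition mconst :: "real \<Rightarrow> mpol" where "mconst a = mterm 0 a"

definition unit_exp :: "nat \<Rightarrow> nat \<Rightarrow> nat" where "unit_exp h = (\<lambda>i. if i = h then 1 else 0)"

definition mvar :: "nat \<Rightarrow> mpol" where "mvar h = mterm (unit_exp h) 1"

interpretation mconst: coeff_hom mconst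
  by unfold_locales (simp_all add: mconst_def single_add mult_single)

lemma coeff_hom_ident: "coeff_hom (\<lambda>a. a)"
  by unfold_locales simp_all

lemma coeff_hom_const_poly: "coeff_hom (\<lambda>a. [:a:])"
  by unfold_locales (simp_all add: one_pCons)

text \<open>The coefficient at \<open>J\<close> of the translated polynomial is the divided
  derivative of order \<open>J\<close> at \<open>x\<close>, so vanishing conditions at
  \<open>x\<close> are read off with \<open>lookup\<close>.\<close>

definition shift :: "nat \<Rightarrow> (nat \<Rightarrow> real) \<Rightarrow> mpol \<Rightarrow> mpol" where
  "shift M x = msub mconst M (\<lambda>h. mvar h + mconst (x h))"

interpretation shift: comm_ring_hom "shift M x"
  unfolding shift_def by (rule mconst.comm_ring_hom_msub)

lemma (in coeff_hom) msub_mconst [simp]: "msub c M \<sigma> (mconst a) = c a"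
  by (simp add: mconst_def)

lemma (in coeff_hom) msub_mvar: "h < M \<Longrightarrow> msub c M \<sigma> (mvar h) = \<sigma> h"
proof -
  assume h: "h < M"
  have "(\<Prod>i<M. \<sigma> i ^ unit_exp h i) = (\<Prod>i<M. if i = h then \<sigma> i else 1)"
    by (rule prod.cong) (auto simp: unit_exp_def)
  with h show ?thesis by (simp add: mvar_def)
qed

lemma (in coeff_hom) msub_shift:
  "msub c M \<sigma> (shift M x P) = msub c M (\<lambda>h. \<sigma> h + c (x h)) P"
proof -
  have "msub c M \<sigma> (shift M x P) = msub c M (\<lambda>h. msub c M \<sigma> (mvar h + mconst (x h))) P"
    unfolding shift_def by (subst hom_msub[OF comm_ring_hom_msub]) simp
  also have "\<dots> = msub c M (\<lambda>h. \<sigma> h + c (x h)) P"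
    by (rule msub_cong) (simp_all add: msub_add msub_mvar)
  finally show ?thesis .
qed

lemma keys_mult_le:
  fixes P Q :: mpol
  assumes "keys P \<subseteq> {..r}" "keys Q \<subseteq> {..s}"
  shows "keys (P * Q) \<subseteq> {..r + s}"
proof
  fix K assume "K \<in> keys (P * Q)"
  then obtain I J where "I \<in> keys P" "J \<in> keys Q" "K = I + J"
    using keys_mult[of P Q] by blast
  with assms show "K \<in> {..r + s}" by (auto intro!: add_mono)
qed

text \<open>When no variable is shared, an exponent of the product splits in only one way, so terms
  never merge. This later exhibits slices of a product as multiples of its factors.\<close>

lemma lookup_mult_disjoint:
  fixes A B :: mpol
  assumes "keys A \<subseteq> {..r}" "keys B \<subseteq> {..s}" and rs: "\<And>h. r h = 0 \<or> s h = 0"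
    and "I \<le> r" "J \<le> s"
  shows "lookup (A * B) (I + J) = lookup A I * lookup B J"
proof -
  have eq: "K + L = I + J \<longleftrightarrow> K = I \<and> L = J" if "K \<in> keys A" "L \<in> keys B" for K L
  proof
    assume e: "K + L = I + J"
    have le: "K \<le> r" "L \<le> s" using that assms by auto
    have "K h = I h \<and> L h = J h" for h
      using fun_cong[OF e, of h] rs[of h] le_funD[OF le(1), of h] le_funD[OF le(2), of h]
        le_funD[OF \<open>I \<le> r\<close>, of h] le_funD[OF \<open>J \<le> s\<close>, of h] by auto
    thus "K = I \<and> L = J" by auto
  qed auto
  have "lookup (A * B) (I + J) =
      (\<Sum>K\<in>keys A. \<Sum>L\<in>keys B. if K = I then if L = J then lookup A K * lookup B L else 0 else 0)"
    unfolding lookup_mult_sum by (intro sum.cong refl) (auto simp: eq)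
  also have "\<dots> = (\<Sum>K\<in>keys A. if K = I then \<Sum>L\<in>keys B. if L = J then lookup A K * lookup B L else 0 else 0)"
    by (intro sum.cong refl) auto
  also have "\<dots> = lookup A I * lookup B J"
    by (auto simp: in_keys_iff)
  finally show ?thesis .
qed

lemma lookup_linear_power:
  "lookup ((mvar m + mconst c) ^ n) L =
     (if \<forall>h. h \<noteq> m \<longrightarrow> L h = 0 then real (n choose L m) * c ^ (n - L m) else 0)"
proof -
  have v: "mvar m ^ k = mterm (\<lambda>i. if i = m then k else 0) 1" for k
  proof (induction k)
    case 0
    have "(\<lambda>i. if i = m then 0 else 0) = (0::nat \<Rightarrow> nat)" by auto
    then show ?case by simp
  next
    case (Suc k)
    have "unit_exp m + (\<lambda>i. if i = m then k else 0) = (\<lambda>i. if i = m then Suc k else 0)"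
      by (auto simp: unit_exp_def)
    with Suc show ?case by (simp add: mvar_def mult_single)
  qed
  have "of_nat (n choose k) * mvar m ^ k * mconst c ^ (n - k) =
      mterm (\<lambda>i. if i = m then k else 0) (real (n choose k) * c ^ (n - k))" for k
  proof -
    have e: "of_nat (n choose k) = mconst (real (n choose k))" "mconst c ^ (n - k) = mconst (c ^ (n - k))"
      by (rule mconst.hom_of_nat[symmetric], rule mconst.hom_power[symmetric])
    show ?thesis unfolding e v by (simp add: mconst_def mult_single del: single_of_nat)
  qed
  then have "lookup ((mvar m + mconst c) ^ n) L =
     (\<Sum>k\<le>n. if (\<lambda>i. if i = m then k else 0) = L then real (n choose k) * c ^ (n - k) else 0)"
    by (simp add: binomial_ring lookup_sum lookup_single when_def)
  also have "\<dots> = (\<Sum>k\<le>n. if k = L m then (if \<forall>h. h \<noteq> m \<longrightarrow> L h = 0 then real (n choose k) * c ^ (n - k) else 0) else 0)"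
  proof (rule sum.cong[OF refl])
    fix k
    have "(\<lambda>i. if i = m then k else 0) = L \<longleftrightarrow> k = L m \<and> (\<forall>h. h \<noteq> m \<longrightarrow> L h = 0)"
      by (auto simp: fun_eq_iff)
    then show "(if (\<lambda>i. if i = m then k else 0) = L then real (n choose k) * c ^ (n - k) else 0)
      = (if k = L m then (if \<forall>h. h \<noteq> m \<longrightarrow> L h = 0 then real (n choose k) * c ^ (n - k) else 0) else 0)"
      by auto
  qed
  finally show ?thesis by (simp add: binomial_eq_0)
qed

definition cutoff :: "nat \<Rightarrow> (nat \<Rightarrow> nat) \<Rightarrow> nat \<Rightarrow> nat" where
  "cutoff m K = (\<lambda>h. if h < m then K h else 0)"

lemma lookup_prod_linear_power:
  "lookup (\<Prod>h<m. (mvar h + mconst (x h)) ^ K h) L =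
     (if \<forall>h\<ge>m. L h = 0 then \<Prod>h<m. real (K h choose L h) * x h ^ (K h - L h) else 0)"
proof (induction m arbitrary: L)
  case 0
  have "(\<forall>h. L h = 0) \<longleftrightarrow> L = 0" by (auto simp: fun_eq_iff)
  then show ?case by (auto simp: lookup_one when_def)
next
  case (Suc m)
  define A where "A = (\<Prod>h<m. (mvar h + mconst (x h)) ^ K h)"
  define B where "B = (mvar m + mconst (x m)) ^ K m"
  define s where "s = (\<lambda>h. if h = m then K m else 0)"
  have A: "keys A \<subseteq> {..cutoff m K}"
  proof
    fix I assume "I \<in> keys A"
    then have n0: "lookup A I \<noteq> 0" by (simp add: in_keys_iff)
    have "I h \<le> cutoff m K h" for h
      using n0 unfolding A_def Suc
      by (cases "h < m") (force simp: cutoff_def binomial_eq_0_iff split: if_splits)+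
    then show "I \<in> {..cutoff m K}" by (simp add: le_fun_def)
  qed
  have B: "keys B \<subseteq> {..s}"
    by (force simp: B_def in_keys_iff lookup_linear_power s_def le_fun_def binomial_eq_0_iff split: if_splits)
  have AB: "(\<Prod>h<Suc m. (mvar h + mconst (x h)) ^ K h) = A * B"
    by (simp add: A_def B_def)
  show ?case
  proof (cases "L \<le> cutoff (Suc m) K")
    case True
    have z: "L h = 0" if "h \<ge> Suc m" for h
      using le_funD[OF True, of h] that by (simp add: cutoff_def)
    define L2 where "L2 = (\<lambda>h. if h = m then L m else 0)"
    have L: "L = cutoff m L + L2"
      using z by (auto simp: cutoff_def L2_def fun_eq_iff not_less Suc_le_eq)
    have Lh: "L h \<le> K h" if "h \<le> m" for h
      using le_funD[OF True, of h] that by (simp add: cutoff_def)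
    have "lookup (A * B) L = lookup A (cutoff m L) * lookup B L2"
      by (subst L, rule lookup_mult_disjoint[OF A B])
        (use Lh in \<open>auto simp: cutoff_def s_def L2_def le_fun_def\<close>)
    also have "lookup A (cutoff m L) = (\<Prod>h<m. real (K h choose L h) * x h ^ (K h - L h))"
      unfolding A_def Suc by (auto simp: cutoff_def intro!: prod.cong)
    also have "lookup B L2 = real (K m choose L m) * x m ^ (K m - L m)"
      unfolding B_def lookup_linear_power by (simp add: L2_def)
    finally show ?thesis using z unfolding AB by simp
  next
    case False
    have "keys (A * B) \<subseteq> {..cutoff m K + s}"
      by (rule keys_mult_le[OF A B])
    also have "cutoff m K + s = cutoff (Suc m) K"
      by (auto simp: cutoff_def s_def fun_eq_iff less_Suc_eq)
    finally have "lookup (A * B) L = 0" using False by (auto simp: in_keys_iff)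
    moreover have "(\<Prod>h<Suc m. real (K h choose L h) * x h ^ (K h - L h)) = 0" if "\<forall>h\<ge>Suc m. L h = 0"
    proof -
      from False obtain h where "L h > cutoff (Suc m) K h" by (auto simp: le_fun_def not_le)
      with that have "h < Suc m" "L h > K h"
        by (auto simp: cutoff_def split: if_splits)
      then show ?thesis by (intro prod_zero) (auto intro!: bexI[of _ h] simp: binomial_eq_0)
    qed
    ultimately show ?thesis unfolding AB by simp
  qed
qed

lemma lookup_mconst_mult: "lookup (mconst a * Q) L = a * lookup Q L"
  by (simp add: mconst_def mult_map_scale_conv_mult[symmetric] Poly_Mapping.map.rep_eq when_def)

lemma lookup_shift:
  "lookup (shift M x P) L = (if \<forall>h\<ge>M. L h = 0
     then \<Sum>K\<in>keys P. lookup P K * (\<Prod>h<M. real (K h choose L h) * x h ^ (K h - L h)) else 0)"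
proof -
  show ?thesis
  proof (cases "\<forall>h\<ge>M. L h = 0")
    case True
    then show ?thesis
      by (simp add: shift_def msub_def lookup_sum lookup_mconst_mult lookup_prod_linear_power)
  next
    case False
    then show ?thesis
      by (simp only: shift_def msub_def lookup_sum lookup_mconst_mult lookup_prod_linear_power if_not_P) simp
  qed
qed


lemma keys_shift_le:
  assumes "keys P \<subseteq> {..r}"
  shows "keys (shift M x P) \<subseteq> {..r}"
proof
  fix L assume "L \<in> keys (shift M x P)"
  then have L: "lookup (shift M x P) L \<noteq> 0" by (simp add: in_keys_iff)
  then have out: "\<forall>h\<ge>M. L h = 0" by (auto simp: lookup_shift split: if_splits)
  with L have "(\<Sum>K\<in>keys P. lookup P K * (\<Prod>h<M. real (K h choose L h) * x h ^ (K h - L h))) \<noteq> 0"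
    by (simp add: lookup_shift)
  then obtain K where K: "K \<in> keys P" "(\<Prod>h<M. real (K h choose L h) * x h ^ (K h - L h)) \<noteq> 0"
    by (auto elim!: sum.not_neutral_contains_not_neutral)
  have "L h \<le> r h" for h
  proof (cases "h < M")
    case True
    with K(2) have "K h choose L h \<noteq> 0" by auto
    then have "L h \<le> K h" by (simp add: binomial_eq_0_iff not_less)
    also have "K h \<le> r h" using K(1) assms by (auto simp: le_fun_def)
    finally show ?thesis .
  qed (use out in simp)
  then show "L \<in> {..r}" by (simp add: le_fun_def)
qed

section \<open>Divided (Hasse) derivatives\<close>

definition mbinom :: "nat \<Rightarrow> (nat \<Rightarrow> nat) \<Rightarrow> (nat \<Rightarrow> nat) \<Rightarrow> nat" where
  "mbinom M K I = (\<Prod>h<M. K h choose I h)"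

text \<open>Truncated subtraction of exponents is harmless because the binomial coefficient vanishes there.\<close>
definition hasse :: "nat \<Rightarrow> (nat \<Rightarrow> nat) \<Rightarrow> mpol \<Rightarrow> mpol" where
  "hasse M I P = (\<Sum>K\<in>keys P. mterm (K - I) (real (mbinom M K I) * lookup P K))"

lemma hasse_superset:
  assumes "finite A" "keys P \<subseteq> A"
  shows "hasse M I P = (\<Sum>K\<in>A. mterm (K - I) (real (mbinom M K I) * lookup P K))"
  unfolding hasse_def using assms
  by (intro sum.mono_neutral_left) (auto simp: in_keys_iff)

lemma hasse_zero [simp]: "hasse M I 0 = 0"
  by (simp add: hasse_def)

lemma hasse_add: "hasse M I (P + Q) = hasse M I P + hasse M I Q"
proof -
  have *: "finite (keys P \<union> keys Q)" by simp
  show ?thesis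
    by (subst (1 2 3) hasse_superset[OF *])
      (auto simp: lookup_add algebra_simps single_add sum.distrib dest: subsetD[OF keys_add])
qed

lemma hasse_sum: "hasse M I (sum f A) = (\<Sum>x\<in>A. hasse M I (f x))"
  by (induction A rule: infinite_finite_induct) (simp_all add: hasse_add)

lemma hasse_mterm: "hasse M I (mterm K a) = mterm (K - I) (real (mbinom M K I) * a)"
  by (subst hasse_superset[of "{K}"]) auto

lemma shift_mterm:
  "lookup (shift M x (mterm K a)) L = (if \<forall>h\<ge>M. L h = 0
     then a * (\<Prod>h<M. real (K h choose L h) * x h ^ (K h - L h)) else 0)"
  by (cases "a = 0") (auto simp: lookup_shift)

lemma choose_mult_choose:
  "(k choose i) * (k - i choose j) = (i + j choose i) * (k choose (i + j))"
proof (cases "i + j \<le> k")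
  case True
  then show ?thesis using choose_mult[of i "i + j" k] by (simp add: mult.commute)
next
  case False
  then show ?thesis by (cases "i \<le> k") (simp_all add: binomial_eq_0)
qed

text \<open>Divided derivatives compose up to a binomial factor. Differentiating thus moves Taylor
  coefficients without mixing them, at every centre \<open>x\<close> simultaneously.\<close>

lemma lookup_shift_hasse:
  assumes "\<And>h. h \<ge> M \<Longrightarrow> I h = 0"
  shows "lookup (shift M x (hasse M I P)) J = real (mbinom M (I + J) I) * lookup (shift M x P) (I + J)"
proof (induction P rule: mpol_induct)
  case (add K a P)
  have "lookup (shift M x (hasse M I (mterm K a))) J
    = real (mbinom M (I + J) I) * lookup (shift M x (mterm K a)) (I + J)"
  proof (cases "\<forall>h\<ge>M. J h = 0")
    case True
    have "real (mbinom M K I) * (\<Prod>h<M. real (K h - I h choose J h) * x h ^ (K h - I h - J h))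
      = (\<Prod>h<M. real ((K h choose I h) * (K h - I h choose J h)) * x h ^ (K h - I h - J h))"
      by (simp add: mbinom_def prod.distrib[symmetric] mult_ac)
    also have "\<dots> = (\<Prod>h<M. real ((I h + J h choose I h) * (K h choose (I h + J h))) * x h ^ (K h - (I h + J h)))"
      by (simp only: choose_mult_choose diff_diff_left)
    also have "\<dots> = real (mbinom M (I + J) I) * (\<Prod>h<M. real (K h choose (I h + J h)) * x h ^ (K h - (I h + J h)))"
      by (simp add: mbinom_def prod.distrib[symmetric] mult_ac)
    finally show ?thesis using True assms
      by (simp add: hasse_mterm shift_mterm mult_ac)
  next
    case False
    with assms show ?thesis by (auto simp: hasse_mterm shift_mterm)
  qed
  with add show ?case by (simp only: hasse_add shift.hom_add lookup_add distrib_left)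
qed simp

text \<open>Leibniz's rule collapses to a single term: in each variable, one of the factors is
  neither present nor differentiated.\<close>

lemma hasse_mult_disjoint:
  fixes A B :: mpol
  assumes "keys A \<subseteq> {..r}" "keys B \<subseteq> {..s}"
    and rs: "\<And>h. (r h = 0 \<and> I h = 0) \<or> (s h = 0 \<and> J h = 0)"
  shows "hasse M (I + J) (A * B) = hasse M I A * hasse M J B"
proof -
  have mm: "mterm (K + L - (I + J)) (real (mbinom M (K + L) (I + J)) * (lookup A K * lookup B L))
      = mterm (K - I) (real (mbinom M K I) * lookup A K) * mterm (L - J) (real (mbinom M L J) * lookup B L)"
    if "K \<in> keys A" "L \<in> keys B" for K L
  proof -
    have "K \<le> r" "L \<le> s" using assms that by auto
    then have KL: "(K h = 0 \<and> I h = 0) \<or> (L h = 0 \<and> J h = 0)" for h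
      using rs[of h] by (metis le_fun_def le_zero_eq)
    have 1: "K + L - (I + J) = (K - I) + (L - J)"
    proof
      fix h show "(K + L - (I + J)) h = ((K - I) + (L - J)) h" using KL[of h] by auto
    qed
    have "(K h + L h choose (I h + J h)) = (K h choose I h) * (L h choose J h)" for h
      using KL[of h] by auto
    then have 2: "mbinom M (K + L) (I + J) = mbinom M K I * mbinom M L J"
      by (simp add: mbinom_def prod.distrib)
    show ?thesis unfolding 1 2 mult_single by (simp add: mult_ac)
  qed
  have "A * B = (\<Sum>K\<in>keys A. \<Sum>L\<in>keys B. mterm (K + L) (lookup A K * lookup B L))"
    by (subst poly_mapping_sum_single[of A, symmetric], subst poly_mapping_sum_single[of B, symmetric])
      (simp add: sum_product mult_single)
  then have "hasse M (I + J) (A * B) = (\<Sum>K\<in>keys A. \<Sum>L\<in>keys B.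
      mterm (K + L - (I + J)) (real (mbinom M (K + L) (I + J)) * (lookup A K * lookup B L)))"
    by (simp add: hasse_sum hasse_mterm)
  also have "\<dots> = (\<Sum>K\<in>keys A. \<Sum>L\<in>keys B. mterm (K - I) (real (mbinom M K I) * lookup A K) * mterm (L - J) (real (mbinom M L J) * lookup B L))"
    by (intro sum.cong refl mm)
  also have "\<dots> = hasse M I A * hasse M J B"
    by (simp add: hasse_def sum_product)
  finally show ?thesis .
qed

lemma keys_hasse_le:
  assumes "keys P \<subseteq> {..r}"
  shows "keys (hasse M I P) \<subseteq> {..r}"
proof
  fix L assume "L \<in> keys (hasse M I P)"
  then have "lookup (hasse M I P) L \<noteq> 0" by (simp add: in_keys_iff)
  then have "(\<Sum>K\<in>keys P. lookup (mterm (K - I) (real (mbinom M K I) * lookup P K)) L) \<noteq> 0"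
    by (simp add: hasse_def lookup_sum)
  then obtain K where "K \<in> keys P" "L = K - I"
    by (auto simp: lookup_single when_def elim!: sum.not_neutral_contains_not_neutral split: if_splits)
  moreover from this have "K \<le> r" using assms by auto
  ultimately show "L \<in> {..r}" by (auto simp: le_fun_def) (meson diff_le_self le_trans)
qed

section \<open>Integrality and size of coefficients\<close>

definition int_coeffs :: "mpol \<Rightarrow> bool" where
  "int_coeffs P \<longleftrightarrow> (\<forall>J. lookup P J \<in> \<int>)"

lemma int_coeffs_zero [simp]: "int_coeffs 0"
  by (simp add: int_coeffs_def)

lemma int_coeffs_mterm: "a \<in> \<int> \<Longrightarrow> int_coeffs (mterm K a)"
  by (simp add: int_coeffs_def lookup_single when_def)

lemma int_coeffs_one [simp]: "int_coeffs 1"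
  using int_coeffs_mterm[of 1 0] by simp

lemma int_coeffs_uminus: "int_coeffs P \<Longrightarrow> int_coeffs (- P)"
  by (simp add: int_coeffs_def)

lemma int_coeffs_sum: "(\<And>x. x \<in> A \<Longrightarrow> int_coeffs (f x)) \<Longrightarrow> int_coeffs (sum f A)"
  by (auto simp: int_coeffs_def lookup_sum intro!: Ints_sum)

lemma int_coeffs_mult: "int_coeffs P \<Longrightarrow> int_coeffs Q \<Longrightarrow> int_coeffs (P * Q)"
  by (auto simp: int_coeffs_def lookup_mult_sum intro!: Ints_sum)

lemma int_coeffs_prod: "(\<And>x. x \<in> A \<Longrightarrow> int_coeffs (f x)) \<Longrightarrow> int_coeffs (prod f A)"
  by (induction A rule: infinite_finite_induct) (auto intro: int_coeffs_mult)

lemma int_coeffs_hasse: "int_coeffs P \<Longrightarrow> int_coeffs (hasse M I P)"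
  unfolding hasse_def by (intro int_coeffs_sum int_coeffs_mterm) (simp add: int_coeffs_def)

text \<open>The sum norm is submultiplicative, which bounds products and determinants without
  counting their monomials.\<close>

definition len :: "mpol \<Rightarrow> real" where "len P = (\<Sum>J\<in>keys P. \<bar>lookup P J\<bar>)"

lemma len_superset:
  assumes "finite A" "keys P \<subseteq> A"
  shows "len P = (\<Sum>J\<in>A. \<bar>lookup P J\<bar>)"
  unfolding len_def using assms
  by (intro sum.mono_neutral_left) (auto simp: in_keys_iff)

lemma len_nonneg [simp]: "len P \<ge> 0"
  by (simp add: len_def sum_nonneg)

lemma len_zero [simp]: "len 0 = 0"
  by (simp add: len_def)

lemma len_uminus [simp]: "len (- P) = len P"
proof -
  have "keys (- P) = keys P" by (auto simp: in_keys_iff)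
  then show ?thesis by (simp add: len_def)
qed

lemma len_mterm: "len (mterm K a) = \<bar>a\<bar>"
  by (subst len_superset[of "{K}"]) auto

lemma len_one [simp]: "len 1 = 1"
  using len_mterm[of 0 1] by simp

lemma abs_lookup_le_len: "\<bar>lookup P J\<bar> \<le> len P"
proof (cases "J \<in> keys P")
  case True
  then show ?thesis unfolding len_def by (intro member_le_sum) auto
next
  case False
  then show ?thesis by (simp add: in_keys_iff)
qed

lemma len_add: "len (P + Q) \<le> len P + len Q"
proof -
  have *: "finite (keys P \<union> keys Q)" by simp
  show ?thesis
    by (subst (1 2 3) len_superset[OF *])
      (auto simp: lookup_add sum.distrib[symmetric] intro: sum_mono dest: subsetD[OF keys_add])
qed

lemma len_sum: "len (sum f A) \<le> (\<Sum>x\<in>A. len (f x))"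
  by (induction A rule: infinite_finite_induct) (auto intro: order_trans[OF len_add])

lemma len_mult: "len (P * Q) \<le> len P * len Q"
proof -
  have "len (P * Q) = len (\<Sum>K\<in>keys P. \<Sum>L\<in>keys Q. mterm (K + L) (lookup P K * lookup Q L))"
    by (subst poly_mapping_sum_single[of P, symmetric], subst poly_mapping_sum_single[of Q, symmetric])
      (simp add: sum_product mult_single)
  also have "\<dots> \<le> (\<Sum>K\<in>keys P. \<Sum>L\<in>keys Q. len (mterm (K + L) (lookup P K * lookup Q L)))"
    by (intro order_trans[OF len_sum] sum_mono) simp
  also have "\<dots> = len P * len Q"
    by (simp only: len_mterm abs_mult) (simp only: len_def sum_product)
  finally show ?thesis .
qed

lemma len_prod: "len (prod f A) \<le> (\<Prod>x\<in>A. len (f x))"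
  by (induction A rule: infinite_finite_induct)
    (auto intro: order_trans[OF len_mult mult_left_mono])

lemma mbinom_le:
  assumes "K \<le> r"
  shows "mbinom M K I \<le> 2 ^ (\<Sum>h<M. r h)"
proof -
  have "mbinom M K I \<le> (\<Prod>h<M. 2 ^ r h)"
    unfolding mbinom_def
  proof (rule prod_mono, intro conjI)
    fix h
    have "K h choose I h \<le> 2 ^ K h" by (rule binomial_le_pow2)
    also have "\<dots> \<le> 2 ^ r h" using assms by (intro power_increasing) (auto simp: le_fun_def)
    finally show "K h choose I h \<le> 2 ^ r h" .
  qed simp
  then show ?thesis by (simp add: power_sum)
qed

text \<open>Division by factorials pays off here: derivatives of any order keep integer coefficients
  and cost at most a factor 2 per unit of degree.\<close>

lemma len_hasse:
  assumes "keys P \<subseteq> {..r}"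
  shows "len (hasse M I P) \<le> 2 ^ (\<Sum>h<M. r h) * len P"
proof -
  have "len (hasse M I P) \<le> (\<Sum>K\<in>keys P. len (mterm (K - I) (real (mbinom M K I) * lookup P K)))"
    unfolding hasse_def by (rule len_sum)
  also have "\<dots> = (\<Sum>K\<in>keys P. real (mbinom M K I) * \<bar>lookup P K\<bar>)"
    by (simp add: len_mterm abs_mult)
  also have "\<dots> \<le> (\<Sum>K\<in>keys P. 2 ^ (\<Sum>h<M. r h) * \<bar>lookup P K\<bar>)"
  proof (intro sum_mono mult_right_mono)
    fix K assume "K \<in> keys P"
    then have "K \<le> r" using assms by auto
    from mbinom_le[OF this, of M I] have "real (mbinom M K I) \<le> real (2 ^ (\<Sum>h<M. r h))"
      by (simp only: of_nat_le_iff)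
    then show "real (mbinom M K I) \<le> 2 ^ (\<Sum>h<M. r h)" by simp
  qed simp
  also have "\<dots> = 2 ^ (\<Sum>h<M. r h) * len P" by (simp add: len_def sum_distrib_left)
  finally show ?thesis .
qed

text \<open>The order on functions is pointwise, so \<open>{..r}\<close> is the box of exponents
  bounded by the degrees \<open>r\<close>. Since \<open>r\<close> vanishes from \<open>M\<close> on,
  it is a finite product of intervals.\<close>

lemma bij_betw_atMost_PiE:
  fixes r :: "nat \<Rightarrow> nat"
  assumes "\<And>h. h \<ge> M \<Longrightarrow> r h = 0"
  shows "bij_betw (\<lambda>J. restrict J {..<M}) {..r} (PiE {..<M} (\<lambda>h. {..r h}))"
proof (rule bij_betwI[where g = "\<lambda>g h. if h < M then g h else 0"])
  show "(\<lambda>J. restrict J {..<M}) \<in> {..r} \<rightarrow> (PiE {..<M} (\<lambda>h. {..r h}))"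
    by (auto simp: le_fun_def)
  show "(\<lambda>g h. if h < M then g h else 0) \<in> (PiE {..<M} (\<lambda>h. {..r h})) \<rightarrow> {..r}"
    by (auto simp: le_fun_def PiE_def Pi_def)
  show "(\<lambda>h. if h < M then restrict J {..<M} h else 0) = J" if "J \<in> {..r}" for J
  proof
    fix h show "(if h < M then restrict J {..<M} h else 0) = J h"
      using that assms[of h] by (cases "h < M") (auto simp: le_fun_def, metis le_zero_eq not_less)
  qed
  show "restrict (\<lambda>h. if h < M then g h else 0) {..<M} = g" if "g \<in> PiE {..<M} (\<lambda>h. {..r h})" for g
    using that by (auto simp: fun_eq_iff PiE_def extensional_def)
qed

lemma finite_atMost_fun:
  fixes r :: "nat \<Rightarrow> nat"
  assumes "\<And>h. h \<ge> M \<Longrightarrow> r h = 0"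
  shows "finite {..r}"
  using bij_betw_finite[OF bij_betw_atMost_PiE[of M r]] assms by (simp add: finite_PiE)

lemma sum_prod_atMost_fun:
  fixes r :: "nat \<Rightarrow> nat" and f :: "nat \<Rightarrow> nat \<Rightarrow> 'a::comm_semiring_1"
  assumes "\<And>h. h \<ge> M \<Longrightarrow> r h = 0"
  shows "(\<Sum>J\<in>{..r}. \<Prod>h<M. f h (J h)) = (\<Prod>h<M. \<Sum>i\<le>r h. f h i)"
proof -
  have "(\<Prod>h<M. \<Sum>i\<le>r h. f h i) = (\<Sum>g\<in>PiE {..<M} (\<lambda>h. {..r h}). \<Prod>h<M. f h (g h))"
    by (rule prod_sum_PiE) auto
  also have "\<dots> = (\<Sum>J\<in>{..r}. \<Prod>h<M. f h (restrict J {..<M} h))"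
    by (rule sum.reindex_bij_betw[OF bij_betw_atMost_PiE[of M r], symmetric]) (rule assms)
  finally show ?thesis by simp
qed

lemma card_atMost_fun:
  fixes r :: "nat \<Rightarrow> nat"
  assumes "\<And>h. h \<ge> M \<Longrightarrow> r h = 0"
  shows "card {..r} = (\<Prod>h<M. r h + 1)"
  using sum_prod_atMost_fun[of M r "\<lambda>_ _. 1::nat"] assms by simp

lemma card_atMost_fun_le:
  fixes r :: "nat \<Rightarrow> nat"
  assumes "\<And>h. h \<ge> M \<Longrightarrow> r h = 0"
  shows "card {..r} \<le> 2 ^ (\<Sum>h<M. r h)"
proof -
  have "(\<Prod>h<M. r h + 1) \<le> (\<Prod>h<M. 2 ^ r h)"
    by (intro prod_mono conjI) (auto simp: Suc_le_eq)
  then show ?thesis using card_atMost_fun[of M r] assms by (simp add: power_sum)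
qed

lemma len_le_card:
  fixes r :: "nat \<Rightarrow> nat"
  assumes "\<And>h. h \<ge> M \<Longrightarrow> r h = 0" "keys P \<subseteq> {..r}" "\<And>J. \<bar>lookup P J\<bar> \<le> H"
  shows "len P \<le> 2 ^ (\<Sum>h<M. r h) * H"
proof -
  have fin: "finite {..r}" using assms(1) by (rule finite_atMost_fun)
  have H: "H \<ge> 0" using assms(3)[of 0] by linarith
  have "len P = (\<Sum>J\<in>{..r}. \<bar>lookup P J\<bar>)" by (rule len_superset[OF fin assms(2)])
  also have "\<dots> \<le> real (card {..r}) * H" using assms(3) by (intro sum_bounded_above) auto
  also have "real (card {..r}) \<le> real (2 ^ (\<Sum>h<M. r h))"
    using card_atMost_fun_le[of M r] assms(1) by (simp only: of_nat_le_iff)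
  finally show ?thesis using H by (simp add: mult_right_mono)
qed

section \<open>Wronskians\<close>

lemma pderiv_sum: "pderiv (\<Sum>x\<in>A. f x) = (\<Sum>x\<in>A. pderiv (f x))"
  by (induction A rule: infinite_finite_induct) (simp_all add: pderiv_add)

lemma power_dvd_pderiv:
  fixes p :: "real poly"
  assumes "[:-t, 1:] ^ Suc n dvd p"
  shows "[:-t, 1:] ^ n dvd pderiv p"
proof -
  from assms obtain q where q: "p = [:-t, 1:] ^ Suc n * q" by (elim dvdE)
  have le: "[:-t, 1:] ^ n dvd [:-t, 1:] ^ Suc n"
    by (rule le_imp_power_dvd) simp
  show ?thesis unfolding q lemma_order_pderiv1
    by (rule dvd_add[OF dvd_mult2[OF le] dvd_smult[OF dvd_triv_right]])
qed

text \<open>The hypothesis says that \<open>F / h\<close> has derivative zero.\<close>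
lemma pderiv_quotient_zero:
  fixes F h :: "real poly"
  assumes h: "h \<noteq> 0" and eq: "pderiv F * h = F * pderiv h"
  shows "\<exists>c. F = smult c h"
proof -
  have "finite {t. poly h t = 0}" using h by (rule poly_roots_finite)
  then obtain t where t: "poly h t \<noteq> 0"
    using ex_new_if_finite[OF infinite_UNIV_char_0] by blast
  \<comment> \<open>\<open>G\<close> satisfies the same equation and vanishes at \<open>t\<close>,
    where \<open>h\<close> does not. If \<open>G\<close> were nonzero, its order at \<open>t\<close>
    would be at most that of its derivative, which is one less.\<close>
  define G where "G = F - smult (poly F t / poly h t) h"
  have Gt: "poly G t = 0" using t by (simp add: G_def)
  have e: "pderiv G * h = G * pderiv h"
    using eq by (simp add: G_def pderiv_diff pderiv_smult algebra_simps)
  have "G = 0"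
  proof (rule ccontr)
    assume G: "G \<noteq> 0"
    have dG: "pderiv G \<noteq> 0"
    proof
      assume "pderiv G = 0"
      then obtain a where "G = [:a:]" using pderiv_iszero by blast
      with Gt G show False by simp
    qed
    have "[:-t, 1:] ^ order t G dvd pderiv G * h"
      unfolding e by (intro dvd_mult2 order_1)
    then have "order t G \<le> order t (pderiv G * h)"
      using dG h order_divides[of t "order t G" "pderiv G * h"] by (metis mult_eq_0_iff)
    also have "\<dots> = order t (pderiv G)"
      using dG h t by (simp add: order_mult order_0I)
    finally show False using order_pderiv[OF G Gt] by simp
  qed
  then show ?thesis by (auto simp: G_def)
qed

text \<open>These are the zeros of the Wronskian of \<open>f 0, \<dots>, f (k - 1)\<close>. The induction step divides by the
  last polynomial and differentiates.\<close>
lemma finite_wronskian_zeros: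
  fixes f :: "nat \<Rightarrow> real poly"
  assumes "\<And>c. (\<Sum>j<k. smult (c j) (f j)) = 0 \<Longrightarrow> \<forall>j<k. c j = 0"
  shows "finite {t. \<exists>c. (\<exists>j<k. c j \<noteq> 0) \<and> [:-t, 1:] ^ k dvd (\<Sum>j<k. smult (c j) (f j))}"
  using assms
proof (induction k arbitrary: f)
  case 0
  then show ?case by simp
next
  case (Suc k)
  have fk: "f k \<noteq> 0"
  proof
    assume "f k = 0"
    then have "(\<Sum>j<Suc k. smult (if j = k then 1 else 0) (f j)) = 0" by simp
    from Suc.prems[OF this] show False by auto
  qed
  \<comment> \<open>The numerator of the derivative of \<open>f j / f k\<close>. It is 0 for j = k,
    so the last summand drops out of every combination, and a zero of order \<open>Suc k\<close> of
    a combination of the \<open>f j\<close> becomes one of order at least \<open>k\<close>.\<close>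
  define g where "g j = pderiv (f j) * f k - f j * pderiv (f k)" for j
  have g: "(\<Sum>j<k. smult (c j) (g j)) = pderiv (\<Sum>j<k. smult (c j) (f j)) * f k
      - (\<Sum>j<k. smult (c j) (f j)) * pderiv (f k)" for c
    by (simp add: g_def pderiv_sum pderiv_smult smult_diff_right sum_subtractf sum_distrib_right)
  have "\<forall>j<k. c j = 0" if "(\<Sum>j<k. smult (c j) (g j)) = 0" for c
  proof -
    from that g[of c] pderiv_quotient_zero[OF fk] obtain b
      where b: "(\<Sum>j<k. smult (c j) (f j)) = smult b (f k)" by auto
    have "(\<Sum>j<Suc k. smult (if j = k then - b else c j) (f j)) = 0"
      using b by simp
    from Suc.prems[OF this] have b: "\<forall>j<Suc k. (if j = k then - b else c j) = 0" .
    show ?thesis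
    proof (intro allI impI)
      fix j assume "j < k"
      with b[rule_format, of j] show "c j = 0" by simp
    qed
  qed
  then have fin: "finite ({t. \<exists>c. (\<exists>j<k. c j \<noteq> 0) \<and> [:-t, 1:] ^ k dvd (\<Sum>j<k. smult (c j) (g j))} \<union> {t. poly (f k) t = 0})"
    using Suc.IH[of g] poly_roots_finite[OF fk] by blast
  show ?case
  proof (rule finite_subset[OF _ fin], rule subsetI, rule ccontr)
    fix t assume "t \<in> {t. \<exists>c. (\<exists>j<Suc k. c j \<noteq> 0) \<and> [:-t, 1:] ^ Suc k dvd (\<Sum>j<Suc k. smult (c j) (f j))}"
    then obtain c where c: "\<exists>j<Suc k. c j \<noteq> 0" and d: "[:-t, 1:] ^ Suc k dvd (\<Sum>j<Suc k. smult (c j) (f j))"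
      by blast
    assume "t \<notin> {t. \<exists>c. (\<exists>j<k. c j \<noteq> 0) \<and> [:-t, 1:] ^ k dvd (\<Sum>j<k. smult (c j) (g j))} \<union> {t. poly (f k) t = 0}"
    then have t: "poly (f k) t \<noteq> 0" and t2: "[:-t, 1:] ^ k dvd (\<Sum>j<k. smult (c j) (g j)) \<Longrightarrow> \<forall>j<k. c j = 0"
      by blast+
    define H where "H = (\<Sum>j<Suc k. smult (c j) (f j))"
    have "(\<Sum>j<k. smult (c j) (g j)) = pderiv H * f k - H * pderiv (f k)"
      unfolding g H_def by (simp add: pderiv_add pderiv_smult algebra_simps)
    moreover have "[:-t, 1:] ^ k dvd pderiv H" using d unfolding H_def by (rule power_dvd_pderiv)
    moreover have "[:-t, 1:] ^ k dvd H"
      using d unfolding H_def by (rule power_le_dvd) simp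
    ultimately have "[:-t, 1:] ^ k dvd (\<Sum>j<k. smult (c j) (g j))" by simp
    from t2[OF this] have c0: "\<forall>j<k. c j = 0" .
    with c have ck: "c k \<noteq> 0" using less_Suc_eq by auto
    have H: "H = smult (c k) (f k)" using c0 by (simp add: H_def)
    have "[:-t, 1:] dvd H" using d unfolding H_def power_Suc by (rule dvd_mult_left)
    then have "poly H t = 0" by (simp add: poly_eq_0_iff_dvd)
    with H ck t show False by simp
  qed
qed

text \<open>The induction appends a row by Laplace expansion along the new row.\<close>
lemma exists_det_nonzero_rows:
  fixes v :: "'i \<Rightarrow> nat \<Rightarrow> 'a::comm_ring_1"
  assumes "\<And>c. (\<forall>i\<in>S. (\<Sum>j<k. c j * v i j) = 0) \<Longrightarrow> \<forall>j<k. c j = 0"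
  shows "\<exists>f. (\<forall>a<k. f a \<in> S) \<and> det (mat k k (\<lambda>(a, j). v (f a) j)) \<noteq> 0"
  using assms
proof (induction k)
  case 0
  then show ?case by simp
next
  case (Suc k)
  have "\<forall>j<k. c j = 0" if "\<forall>i\<in>S. (\<Sum>j<k. c j * v i j) = 0" for c
    using Suc.prems[of "\<lambda>j. if j < k then c j else 0"] that by (auto simp: less_Suc_eq)
  then obtain f where f: "\<forall>a<k. f a \<in> S" "det (mat k k (\<lambda>(a, j). v (f a) j)) \<noteq> 0"
    using Suc.IH by blast
  define A where "A i = mat (Suc k) (Suc k) (\<lambda>(a, j). v (if a = k then i else f a) j)" for i
  have del: "mat_delete (A i) k j = mat k k (\<lambda>(a, l). v (f a) (if l < j then l else Suc l))" if "j < Suc k" for i j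
    using that by (intro eq_matI) (auto simp: A_def mat_delete_def)
  \<comment> \<open>These cofactors do not depend on the new row, so the determinant is a linear
    form in \<open>v i\<close>. Its coefficient at \<open>k\<close> is the previous nonzero
    determinant, hence some \<open>i\<close> in \<open>S\<close> makes it nonzero.\<close>
  define c where "c j = (-1) ^ (k + j) * det (mat k k (\<lambda>(a, l). v (f a) (if l < j then l else Suc l)))" for j
  have det: "det (A i) = (\<Sum>j<Suc k. c j * v i j)" for i
  proof -
    have "det (A i) = (\<Sum>j<Suc k. A i $$ (k, j) * cofactor (A i) k j)"
      by (rule laplace_expansion_row) (auto simp: A_def)
    also have "\<dots> = (\<Sum>j<Suc k. c j * v i j)"
    proof (rule sum.cong[OF refl])
      fix j assume "j \<in> {..<Suc k}"
      then have j: "j < Suc k" by simp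
      then have "A i $$ (k, j) = v i j" by (simp add: A_def)
      moreover have "cofactor (A i) k j = c j" unfolding cofactor_def del[OF j] c_def ..
      ultimately show "A i $$ (k, j) * cofactor (A i) k j = c j * v i j" by (simp only: mult.commute)
    qed
    finally show ?thesis .
  qed
  have "c k \<noteq> 0"
  proof -
    have "mat k k (\<lambda>(a, l). v (f a) (if l < k then l else Suc l)) = mat k k (\<lambda>(a, j). v (f a) j)"
      by (intro eq_matI) auto
    moreover have "(-1) ^ (k + k) = (1::'a)" by (rule neg_one_even_power) simp
    ultimately show ?thesis using f(2) unfolding c_def by simp
  qed
  then obtain i where i: "i \<in> S" "det (A i) \<noteq> 0"
    unfolding det using Suc.prems[of c] by blast
  show ?case
  proof (intro exI conjI)
    show "\<forall>a<Suc k. (if a = k then i else f a) \<in> S" using f(1) i(1) by (auto simp: less_Suc_eq)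
    show "det (mat (Suc k) (Suc k) (\<lambda>(a, j). v (if a = k then i else f a) j)) \<noteq> 0"
      using i(2) by (simp add: A_def)
  qed
qed

text \<open>After recentring at the point of the curve with parameter \<open>t\<close>, each
  coordinate is divisible by X - t, and only monomials of degree at least \<open>k\<close>
  remain.\<close>

lemma power_dvd_along_curve:
  assumes "\<And>J. (\<Sum>h<M. J h) < k \<Longrightarrow> lookup (shift M (\<lambda>h. poly (\<sigma> h) t) F) J = 0"
  shows "[:-t, 1:] ^ k dvd msub (\<lambda>a. [:a:]) M \<sigma> F"
proof -
  define G where "G = shift M (\<lambda>h. poly (\<sigma> h) t) F"
  have "msub (\<lambda>a. [:a:]) M \<sigma> F = msub (\<lambda>a. [:a:]) M (\<lambda>h. \<sigma> h - [:poly (\<sigma> h) t:]) G"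
    unfolding G_def coeff_hom.msub_shift[OF coeff_hom_const_poly] by simp
  also have "[:-t, 1:] ^ k dvd \<dots>"
    unfolding msub_def
  proof (intro dvd_sum dvd_mult)
    fix K assume "K \<in> keys G"
    then have "lookup G K \<noteq> 0" by (simp add: in_keys_iff)
    then have le: "k \<le> (\<Sum>h<M. K h)" using assms unfolding G_def by (metis not_le)
    have "[:-t, 1:] ^ k dvd [:-t, 1:] ^ (\<Sum>h<M. K h)" by (rule le_imp_power_dvd[OF le])
    also have "\<dots> = (\<Prod>h<M. [:-t, 1:] ^ K h)" by (rule power_sum)
    also have "\<dots> dvd (\<Prod>h<M. (\<sigma> h - [:poly (\<sigma> h) t:]) ^ K h)"
      by (intro prod_dvd_prod dvd_power_same) (simp add: poly_eq_0_iff_dvd[symmetric])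
    finally show "[:-t, 1:] ^ k dvd (\<Prod>h<M. (\<sigma> h - [:poly (\<sigma> h) t:]) ^ K h)" .
  qed
  finally show ?thesis .
qed

lemma digits_inject:
  fixes N :: nat
  assumes "\<And>h. h < M \<Longrightarrow> J h < N" "\<And>h. h < M \<Longrightarrow> K h < N"
    and "(\<Sum>h<M. J h * N ^ h) = (\<Sum>h<M. K h * N ^ h)"
  shows "\<forall>h<M. J h = K h"
  using assms
proof (induction M)
  case (Suc M)
  have less: "(\<Sum>h<m. L h * N ^ h) < N ^ m" if "\<And>h. h < m \<Longrightarrow> L h < N" for L m
    using that
  proof (induction m)
    case (Suc m)
    have "(\<Sum>h<Suc m. L h * N ^ h) < N ^ m + L m * N ^ m" using Suc by simp
    also have "\<dots> = (L m + 1) * N ^ m" by simp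
    also have "\<dots> \<le> N * N ^ m" using Suc.prems[of m] by (intro mult_right_mono) auto
    finally show ?case by simp
  qed simp
  have l: "(\<Sum>h<M. J h * N ^ h) < N ^ M" "(\<Sum>h<M. K h * N ^ h) < N ^ M"
    using Suc.prems by (intro less; simp)+
  have dv: "(a + q * p) div p = q" if "a < p" for a q p :: nat
    using that by simp
  have "J M = ((\<Sum>h<M. J h * N ^ h) + J M * N ^ M) div N ^ M"
    using dv[OF l(1)] by simp
  also have "\<dots> = ((\<Sum>h<M. K h * N ^ h) + K M * N ^ M) div N ^ M"
    using Suc.prems(3) by simp
  also have "\<dots> = K M" by (rule dv[OF l(2)])
  finally have "J M = K M" .
  with Suc show ?case by (auto simp: less_Suc_eq)
qed simp

definition kronecker :: "nat \<Rightarrow> nat \<Rightarrow> mpol \<Rightarrow> real poly" where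
  "kronecker M N = msub (\<lambda>a. [:a:]) M (\<lambda>h. monom 1 (N ^ h))"

text \<open>The substitution turns an exponent into the number with base-\<open>N\<close> digits
  \<open>K h\<close>. With all degrees below \<open>N\<close> this is injective, so distinct
  monomials stay distinct and nothing cancels.\<close>

lemma kronecker_eq_0:
  assumes F: "keys F \<subseteq> {..r}" and r: "\<And>h. h \<ge> M \<Longrightarrow> r h = 0" "\<And>h. r h < N"
    and z: "kronecker M N F = 0"
  shows "F = 0"
proof (rule poly_mapping_eqI)
  fix J
  show "lookup F J = lookup 0 J"
  proof (cases "J \<in> keys F")
    case True
    define enc where "enc K = (\<Sum>h<M. K h * N ^ h)" for K :: "nat \<Rightarrow> nat"
    have inj: "K = J" if "K \<in> keys F" "enc K = enc J" for K
    proof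
      fix h
      have "K \<le> r" "J \<le> r" using F that True by auto
      then have le: "K h \<le> r h" "J h \<le> r h" for h by (auto simp: le_fun_def)
      then have "\<forall>h<M. K h = J h" using r(2) that(2) unfolding enc_def
        by (intro digits_inject[of M K N J]) (auto intro: le_less_trans)
      then show "K h = J h" using le[of h] r(1)[of h] by (cases "h < M") auto
    qed
    have "monom 1 (N ^ h) ^ i = monom (1::real) (i * N ^ h)" for h i
      by (simp add: monom_power mult.commute)
    moreover have "(\<Prod>h\<in>A. monom (1::real) (e h)) = monom 1 (\<Sum>h\<in>A. e h)" if "finite A" for A and e :: "nat \<Rightarrow> nat"
      using that by induction (simp_all add: mult_monom)
    ultimately have "kronecker M N F = (\<Sum>K\<in>keys F. monom (lookup F K) (enc K))"
      by (simp add: kronecker_def msub_def enc_def smult_monom)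
    then have "0 = coeff (\<Sum>K\<in>keys F. monom (lookup F K) (enc K)) (enc J)" using z by simp
    also have "\<dots> = (\<Sum>K\<in>keys F. if K = J then lookup F K else 0)"
      unfolding coeff_sum by (intro sum.cong) (auto dest: inj)
    also have "\<dots> = lookup F J" using True by simp
    finally show ?thesis by simp
  qed (simp add: in_keys_iff)
qed

text \<open>The Kronecker curve \<open>t \<mapsto> (t ^ N ^ h)\<close> reduces the claim to polynomials in one variable.\<close>
lemma exists_point_generalized_wronskian:
  fixes \<phi> :: "nat \<Rightarrow> mpol"
  assumes \<phi>: "\<And>j. j < k \<Longrightarrow> keys (\<phi> j) \<subseteq> {..r}" and r: "\<And>h. h \<ge> M \<Longrightarrow> r h = 0"
    and indep: "\<And>c. (\<Sum>j<k. mconst (c j) * \<phi> j) = 0 \<Longrightarrow> \<forall>j<k. c j = 0"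
  shows "\<exists>x. \<forall>c. (\<forall>J\<le>r. (\<Sum>h<M. J h) < k \<longrightarrow> (\<Sum>j<k. c j * lookup (shift M x (\<phi> j)) J) = 0) \<longrightarrow> (\<forall>j<k. c j = 0)"
proof -
  define N where "N = Suc (\<Sum>h<M. r h)"
  have N: "r h < N" for h
    by (cases "h < M") (auto simp: N_def less_Suc_eq_le r intro: member_le_sum)
  interpret kr: comm_ring_hom "kronecker M N"
    unfolding kronecker_def by (rule coeff_hom.comm_ring_hom_msub[OF coeff_hom_const_poly])
  have krc: "kronecker M N (\<Sum>j<k. mconst (c j) * \<phi> j) = (\<Sum>j<k. smult (c j) (kronecker M N (\<phi> j)))" for c
  proof -
    have "kronecker M N (mconst a) = [:a:]" for a
      unfolding kronecker_def by (rule coeff_hom.msub_mconst[OF coeff_hom_const_poly])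
    then show ?thesis by (simp add: kr.hom_sum kr.hom_mult)
  qed
  have keys: "keys (\<Sum>j<k. mconst (c j) * \<phi> j) \<subseteq> {..r}" for c
  proof
    fix J assume "J \<in> keys (\<Sum>j<k. mconst (c j) * \<phi> j)"
    then have "(\<Sum>j<k. c j * lookup (\<phi> j) J) \<noteq> 0" by (simp add: in_keys_iff lookup_sum lookup_mconst_mult)
    then obtain j where "j < k" "lookup (\<phi> j) J \<noteq> 0" by (auto elim!: sum.not_neutral_contains_not_neutral)
    then show "J \<in> {..r}" using \<phi>[of j] by (auto simp: in_keys_iff)
  qed
  have "\<forall>j<k. c j = 0" if "(\<Sum>j<k. smult (c j) (kronecker M N (\<phi> j))) = 0" for c
    by (rule indep, rule kronecker_eq_0[OF keys r N]) (use that krc in auto)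
  from finite_wronskian_zeros[OF this]
  obtain t :: real where "t \<notin> {t. \<exists>c. (\<exists>j<k. c j \<noteq> 0) \<and>
      [:-t, 1:] ^ k dvd (\<Sum>j<k. smult (c j) (kronecker M N (\<phi> j)))}"
    by (rule ex_new_if_finite[OF infinite_UNIV_char_0, THEN exE])
  then have t: "\<forall>j<k. c j = 0" if "[:-t, 1:] ^ k dvd (\<Sum>j<k. smult (c j) (kronecker M N (\<phi> j)))" for c
    using that by blast
  \<comment> \<open>A combination whose Taylor coefficients of degree below \<open>k\<close> all
    vanish at this point vanishes to order \<open>k\<close> along the curve, which the choice of
    \<open>t\<close> excludes.\<close>
  define x where "x h = poly (monom 1 (N ^ h)) t" for h
  have "\<forall>j<k. c j = 0"
    if c: "\<forall>J\<le>r. (\<Sum>h<M. J h) < k \<longrightarrow> (\<Sum>j<k. c j * lookup (shift M x (\<phi> j)) J) = 0" for c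
  proof (rule t)
    have "lookup (shift M x (\<Sum>j<k. mconst (c j) * \<phi> j)) J = 0" if "(\<Sum>h<M. J h) < k" for J
    proof (cases "J \<le> r")
      case True
      have "shift M x (mconst a) = mconst a" for a
        unfolding shift_def by (rule mconst.msub_mconst)
      then show ?thesis using c True that
        by (simp add: shift.hom_sum shift.hom_mult lookup_sum lookup_mconst_mult)
    next
      case False
      then show ?thesis using keys_shift_le[OF keys[of c], of M x] by (auto simp: in_keys_iff)
    qed
    then have "[:-t, 1:] ^ k dvd kronecker M N (\<Sum>j<k. mconst (c j) * \<phi> j)"
      unfolding kronecker_def x_def by (rule power_dvd_along_curve)
    then show "[:-t, 1:] ^ k dvd (\<Sum>j<k. smult (c j) (kronecker M N (\<phi> j)))"
      by (simp only: krc)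
  qed
  then show ?thesis by blast
qed

lemma lookup_shift_zero: "lookup (shift M x P) 0 = msub (\<lambda>a. a) M x P"
  by (simp add: lookup_shift msub_def)

lemma msub_hasse:
  assumes "\<And>h. h \<ge> M \<Longrightarrow> I h = 0"
  shows "msub (\<lambda>a. a) M x (hasse M I P) = lookup (shift M x P) I"
  using lookup_shift_hasse[of M I x P 0] assms
  by (simp add: lookup_shift_zero mbinom_def)

text \<open>Evaluation at \<open>x\<close> is a ring homomorphism and commutes with the determinant,
  so one point with a nonzero determinant of Taylor coefficients is enough.\<close>

lemma det_hasse_nonzero:
  assumes "\<And>a b. a < k \<Longrightarrow> b < k \<Longrightarrow> \<forall>h\<ge>M. I a b h = 0"
    and "det (mat k k (\<lambda>(a, b). lookup (shift M x (\<phi> a b)) (I a b))) \<noteq> 0"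
  shows "det (mat k k (\<lambda>(a, b). hasse M (I a b) (\<phi> a b))) \<noteq> 0"
proof
  interpret ev: comm_ring_hom "msub (\<lambda>a. a) M x"
    by (rule coeff_hom.comm_ring_hom_msub[OF coeff_hom_ident])
  assume "det (mat k k (\<lambda>(a, b). hasse M (I a b) (\<phi> a b))) = 0"
  then have "det (map_mat (msub (\<lambda>a. a) M x) (mat k k (\<lambda>(a, b). hasse M (I a b) (\<phi> a b)))) = 0"
    by (simp only: ev.hom_det ev.hom_zero)
  also have "map_mat (msub (\<lambda>a. a) M x) (mat k k (\<lambda>(a, b). hasse M (I a b) (\<phi> a b)))
    = mat k k (\<lambda>(a, b). lookup (shift M x (\<phi> a b)) (I a b))"
    using assms(1) by (intro eq_matI) (auto simp: msub_hasse)
  finally show False using assms(2) by simp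
qed

text \<open>In several variables the orders of differentiation cannot be prescribed; only their
  total is controlled. At a suitable point the rows of Taylor coefficients of order below
  \<open>k\<close> have full rank, and \<open>k\<close> of them with nonzero determinant are
  selected.\<close>

lemma exists_generalized_wronskian:
  fixes \<phi> :: "nat \<Rightarrow> mpol"
  assumes \<phi>: "\<And>j. j < k \<Longrightarrow> keys (\<phi> j) \<subseteq> {..r}" and r: "\<And>h. h \<ge> M \<Longrightarrow> r h = 0"
    and indep: "\<And>c. (\<Sum>j<k. mconst (c j) * \<phi> j) = 0 \<Longrightarrow> \<forall>j<k. c j = 0"
  shows "\<exists>I. (\<forall>a<k. I a \<le> r \<and> (\<Sum>h<M. I a h) < k) \<and>
    det (mat k k (\<lambda>(a, j). hasse M (I a) (\<phi> j))) \<noteq> 0"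
proof -
  have "\<exists>x. \<forall>c. (\<forall>J\<le>r. (\<Sum>h<M. J h) < k \<longrightarrow> (\<Sum>j<k. c j * lookup (shift M x (\<phi> j)) J) = 0) \<longrightarrow> (\<forall>j<k. c j = 0)"
    by (rule exists_point_generalized_wronskian[of k \<phi> r M]) (erule \<phi> r indep)+
  then obtain x where
    x: "\<And>c. \<forall>J\<le>r. (\<Sum>h<M. J h) < k \<longrightarrow> (\<Sum>j<k. c j * lookup (shift M x (\<phi> j)) J) = 0 \<Longrightarrow> \<forall>j<k. c j = 0"
    by blast
  define S where "S = {J. J \<le> r \<and> (\<Sum>h<M. J h) < k}"
  have sp: "\<forall>j<k. c j = 0" if "\<forall>J\<in>S. (\<Sum>j<k. c j * lookup (shift M x (\<phi> j)) J) = 0" for c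
    using that by (intro x) (auto simp: S_def)
  have "\<exists>I. (\<forall>a<k. I a \<in> S) \<and> det (mat k k (\<lambda>(a, j). lookup (shift M x (\<phi> j)) (I a))) \<noteq> 0"
    by (rule exists_det_nonzero_rows[where v = "\<lambda>i j. lookup (shift M x (\<phi> j)) i"]) (erule sp)
  then obtain I
    where I: "\<forall>a<k. I a \<in> S" "det (mat k k (\<lambda>(a, j). lookup (shift M x (\<phi> j)) (I a))) \<noteq> 0"
    by blast
  have "I a h = 0" if "a < k" "h \<ge> M" for a h
  proof -
    have "I a \<le> r" using I(1) that(1) by (simp add: S_def)
    from le_funD[OF this, of h] show ?thesis using r[OF that(2)] by simp
  qed
  then have "det (mat k k (\<lambda>(a, j). hasse M (I a) (\<phi> j))) \<noteq> 0"
    using det_hasse_nonzero[where I = "\<lambda>a b. I a" and \<phi> = "\<lambda>a b. \<phi> b", OF _ I(2)] by blast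
  with I(1) show ?thesis unfolding S_def by blast
qed

text \<open>Only the variable \<open>m\<close> occurs, so the orders below \<open>k\<close> are
  exactly \<open>k\<close> in number and all of them are used: no selection is necessary. The
  polynomials index the rows, so that this matrix can be the right factor of a product.\<close>

lemma wronskian_nonzero:
  fixes \<psi> :: "nat \<Rightarrow> mpol"
  assumes \<psi>: "\<And>j. j < k \<Longrightarrow> keys (\<psi> j) \<subseteq> {..r}" and r: "\<And>h. h \<noteq> m \<Longrightarrow> r h = 0" and m: "m < M"
    and indep: "\<And>c. (\<Sum>j<k. mconst (c j) * \<psi> j) = 0 \<Longrightarrow> \<forall>j<k. c j = 0"
  shows "det (mat k k (\<lambda>(j, b). hasse M (\<lambda>h. if h = m then b else 0) (\<psi> j))) \<noteq> 0"
proof -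
  have r': "r h = 0" if "h \<ge> M" for h using r[of h] m that by simp
  have "\<exists>x. \<forall>c. (\<forall>J\<le>r. (\<Sum>h<M. J h) < k \<longrightarrow> (\<Sum>j<k. c j * lookup (shift M x (\<psi> j)) J) = 0) \<longrightarrow> (\<forall>j<k. c j = 0)"
    by (rule exists_point_generalized_wronskian[of k \<psi> r M]) (erule \<psi> r' indep)+
  then obtain x where
    x: "\<And>c. \<forall>J\<le>r. (\<Sum>h<M. J h) < k \<longrightarrow> (\<Sum>j<k. c j * lookup (shift M x (\<psi> j)) J) = 0 \<Longrightarrow> \<forall>j<k. c j = 0"
    by blast
  define e where "e b = (\<lambda>h. if h = m then b else 0::nat)" for b :: nat
  define A where "A = mat k k (\<lambda>(b, j). lookup (shift M x (\<psi> j)) (e b))"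
  have "det A \<noteq> 0"
  proof
    assume "det A = 0"
    moreover have "A \<in> carrier_mat k k" by (simp add: A_def)
    ultimately obtain v where v: "v \<in> carrier_vec k" "v \<noteq> 0\<^sub>v k" "A *\<^sub>v v = 0\<^sub>v k"
      using det_0_iff_vec_prod_zero by blast
    have "\<forall>j<k. v $ j = 0"
    proof (rule x, intro allI impI)
      fix J assume J: "J \<le> r" "(\<Sum>h<M. J h) < k"
      have z: "J h = 0" if "h \<noteq> m" for h using le_funD[OF J(1), of h] r[OF that] by simp
      have "(\<Sum>h<M. J h) = (\<Sum>h<M. if h = m then J m else 0)"
        using z by (intro sum.cong) auto
      also have "\<dots> = J m" using m by simp
      finally have "J m < k" using J(2) by simp
      have eJ: "e (J m) = J" using z by (auto simp: e_def)
      have "(A *\<^sub>v v) $ J m = (\<Sum>j<k. v $ j * lookup (shift M x (\<psi> j)) J)"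
        using v(1) \<open>J m < k\<close> by (simp add: A_def scalar_prod_def eJ atLeast0LessThan mult.commute)
      then show "(\<Sum>j<k. v $ j * lookup (shift M x (\<psi> j)) J) = 0"
        using v(3) \<open>J m < k\<close> by simp
    qed
    then have "v = 0\<^sub>v k" using v(1) by (intro eq_vecI) auto
    with v(2) show False by contradiction
  qed
  moreover have "det A = det (mat k k (\<lambda>(j, b). lookup (shift M x (\<psi> j)) (e b)))"
  proof -
    have "transpose_mat A = mat k k (\<lambda>(j, b). lookup (shift M x (\<psi> j)) (e b))"
      by (intro eq_matI) (auto simp: A_def)
    then show ?thesis using det_transpose[of A k] by (simp add: A_def)
  qed
  ultimately have "det (mat k k (\<lambda>(j, b). hasse M (e b) (\<psi> j))) \<noteq> 0"
    using m det_hasse_nonzero[where I = "\<lambda>a b. e b" and \<phi> = "\<lambda>a b. \<psi> a" and M = M and k = k and x = x]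
    by (simp add: e_def)
  then show ?thesis unfolding e_def .
qed

section \<open>Roth's lemma\<close>

abbreviation real_poly :: "int poly \<Rightarrow> real poly" where "real_poly \<equiv> map_poly real_of_int"

lemma real_poly_mult: "real_poly (p * q) = real_poly p * real_poly q"
  by (intro poly_eqI) (simp add: coeff_map_poly coeff_mult)

text \<open>Gauss's lemma: coprimality makes \<open>[:-a, q:]\<close> primitive, so the power of
  \<open>q\<close> introduced by pseudo-division divides the content of the quotient and can be
  cancelled.\<close>

lemma linear_dvd_int_poly:
  fixes p :: "int poly"
  assumes cop: "coprime a q" and q: "q > 0" and root: "poly (real_poly p) (of_int a / of_int q) = 0"
  shows "[:-a, q:] dvd p"
proof -
  define g where "g = [:-a, q:]"
  have g: "g \<noteq> 0" "degree g = 1" "coeff g (degree g) = q" using q by (simp_all add: g_def)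
  obtain s r where sr: "pseudo_divmod p g = (s, r)" by fastforce
  define n where "n = Suc (degree p) - degree g"
  have eq: "smult (q ^ n) p = g * s + r" and r: "r = 0 \<or> degree r < degree g"
    using pseudo_divmod[OF g(1) sr] g by (simp_all add: n_def)
  from r g(2) obtain c where c: "r = [:c:]" by (metis degree_eq_zeroE less_one degree_0)
  have "real_poly (smult (q ^ n) p) = real_poly g * real_poly s + real_poly r"
    unfolding eq by (intro poly_eqI) (simp add: coeff_map_poly real_poly_mult[symmetric])
  then have "poly (real_poly (smult (q ^ n) p)) (of_int a / of_int q)
      = poly (real_poly g) (of_int a / of_int q) * poly (real_poly s) (of_int a / of_int q) + of_int c"
    by (simp add: c map_poly_pCons)
  moreover have "poly (real_poly g) (of_int a / of_int q) = 0"
    using q by (simp add: g_def map_poly_pCons)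
  moreover have "real_poly (smult (q ^ n) p) = smult (of_int (q ^ n)) (real_poly p)"
    by (intro poly_eqI) (simp add: coeff_map_poly)
  ultimately have "c = 0" using root by simp
  then have eq: "smult (q ^ n) p = g * s" using eq c by simp
  have "content g dvd coeff g 0" "content g dvd coeff g 1" by (rule content_dvd_coeff)+
  then have "content g dvd a" "content g dvd q" by (simp_all add: g_def)
  with cop have "is_unit (content g)" by (rule coprime_common_divisor)
  then have "content g = 1" by (simp only: is_unit_content_iff)
  then have "normalize (q ^ n) * content p = content s"
    using arg_cong[OF eq, of content] by (simp only: content_mult content_smult mult_1_left)
  then have "normalize (q ^ n) dvd content s" by (metis dvd_triv_left)
  then have "q ^ n dvd content s" by (simp only: normalize_dvd_iff)
  then have "[:q ^ n:] dvd s" by (simp only: const_poly_dvd_iff_dvd_content)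
  then obtain s' where s': "s = smult (q ^ n) s'"
    by (auto elim!: dvdE)
  have "smult (q ^ n) p = smult (q ^ n) (g * s')" using eq s' by simp
  moreover have "q ^ n \<noteq> 0" using q by simp
  ultimately have "p = g * s'" by (simp only: smult_cancel simp_thms)
  then show ?thesis unfolding g_def by (rule dvdI)
qed

text \<open>Each linear factor over the reals is a factor \<open>[:-a, q:]\<close> over the integers
  and contributes one \<open>q\<close> to the leading coefficient. High order at a rational point
  thus forces large height.\<close>

lemma power_dvd_lead_coeff:
  fixes p :: "int poly"
  assumes cop: "coprime a q" and q: "q > 0"
    and "[:- (of_int a / of_int q), 1:] ^ e dvd real_poly p"
  shows "q ^ e dvd lead_coeff p"
  using assms(3)
proof (induction e arbitrary: p)
  case (Suc e)
  let ?x = "of_int a / of_int q :: real"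
  have "[:- ?x, 1:] dvd real_poly p" using Suc.prems unfolding power_Suc by (rule dvd_mult_left)
  then have "[:-a, q:] dvd p" using cop q by (intro linear_dvd_int_poly) (simp_all add: poly_eq_0_iff_dvd)
  then obtain s where s: "p = [:-a, q:] * s" by (elim dvdE)
  have "real_poly [:-a, q:] = smult (of_int q) [:- ?x, 1:]"
    using q by (simp add: map_poly_pCons)
  then have "real_poly p = [:- ?x, 1:] * smult (of_int q) (real_poly s)"
    unfolding s real_poly_mult by (simp only: mult_smult_left mult_smult_right)
  with Suc.prems have "[:- ?x, 1:] ^ e dvd smult (of_int q) (real_poly s)"
    unfolding power_Suc by (simp only: dvd_mult_cancel_left) simp
  then have "[:- ?x, 1:] ^ e dvd real_poly s" using q by (simp add: dvd_smult_iff)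
  then have "q ^ e dvd lead_coeff s" by (rule Suc.IH)
  moreover have "lead_coeff p = q * lead_coeff s" unfolding s lead_coeff_mult using q by simp
  ultimately show ?case by simp
qed simp

text \<open>Roth's lemma for a single variable: if \<open>e\<close> is the order of the zero at
  \<open>x m\<close>, then q ^ e divides the leading coefficient, which is at most
  \<open>B\<close>.\<close>

lemma one_variable_index:
  assumes P: "int_coeffs P" "P \<noteq> 0" "keys P \<subseteq> {..s}" "\<And>J. \<bar>lookup P J\<bar> \<le> B"
    and s: "\<And>h. h \<noteq> m \<Longrightarrow> s h = 0" and m: "m < M"
    and cop: "coprime a q" and q: "q > 0" and x: "x m = of_int a / of_int q"
  shows "\<exists>J\<le>s. lookup (shift M x P) J \<noteq> 0 \<and> of_int q ^ J m \<le> B"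
proof -
  define p where "p = (\<Sum>K\<in>keys P. monom \<lfloor>lookup P K\<rfloor> (K m))"
  define \<sigma> where "\<sigma> h = (if h = m then [:0, 1:] else [:x h:])" for h
  have z: "K h = 0" if "K \<in> keys P" "h \<noteq> m" for K h
  proof -
    have "K \<le> s" using that(1) P(3) by auto
    from le_funD[OF this, of h] s[OF that(2)] show ?thesis by simp
  qed
  have int: "of_int \<lfloor>lookup P K\<rfloor> = lookup P K" for K
    using P(1) unfolding int_coeffs_def by (metis Ints_cases floor_of_int)
  have coeff_p: "coeff p i = \<lfloor>lookup P (\<lambda>h. if h = m then i else 0)\<rfloor>" for i
  proof -
    have "K m = i \<longleftrightarrow> K = (\<lambda>h. if h = m then i else 0)" if "K \<in> keys P" for K
      using z[OF that] by auto
    then have "coeff p i = (\<Sum>K\<in>keys P. if K = (\<lambda>h. if h = m then i else 0) then \<lfloor>lookup P K\<rfloor> else 0)"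
      unfolding p_def coeff_sum by (intro sum.cong) auto
    then show ?thesis by (simp add: in_keys_iff)
  qed
  have f: "msub (\<lambda>a. [:a:]) M \<sigma> P = real_poly p"
  proof -
    have "(\<Prod>h<M. \<sigma> h ^ K h) = monom 1 (K m)" if "K \<in> keys P" for K
    proof -
      have "(\<Prod>h<M. \<sigma> h ^ K h) = (\<Prod>h<M. if h = m then monom 1 (K m) else 1)"
        using z[OF that] by (intro prod.cong) (auto simp: \<sigma>_def monom_altdef)
      with m show ?thesis by simp
    qed
    then have "msub (\<lambda>a. [:a:]) M \<sigma> P = (\<Sum>K\<in>keys P. monom (lookup P K) (K m))"
      unfolding msub_def by (intro sum.cong) (simp_all add: smult_monom)
    also have "\<dots> = real_poly p"
      by (intro poly_eqI) (simp add: coeff_map_poly p_def coeff_sum int if_distrib[of real_of_int] cong: if_cong)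
    finally show ?thesis .
  qed
  have p0: "p \<noteq> 0"
  proof
    assume "p = 0"
    have "keys P \<noteq> {}" using P(2) poly_mapping_sum_single[of P] by auto
    then obtain K where K: "K \<in> keys P" by blast
    then have "(\<lambda>h. if h = m then K m else 0) = K" using z by auto
    with coeff_p[of "K m"] \<open>p = 0\<close> have "\<lfloor>lookup P K\<rfloor> = 0" by simp
    with int[of K] K show False by (simp add: in_keys_iff)
  qed
  then have f0: "real_poly p \<noteq> 0" by (simp add: map_poly_eq_0_iff)
  define e where "e = order (x m) (real_poly p)"
  have "q ^ e dvd lead_coeff p"
    using cop q order_1[of "x m" "real_poly p"] unfolding e_def x by (rule power_dvd_lead_coeff)
  then have "\<bar>q ^ e\<bar> \<le> \<bar>lead_coeff p\<bar>" using p0 by (intro dvd_imp_le_int) auto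
  then have "q ^ e \<le> \<bar>lead_coeff p\<bar>" by linarith
  then have "of_int (q ^ e) \<le> real_of_int \<bar>lead_coeff p\<bar>" by (simp only: of_int_le_iff)
  also have "\<dots> \<le> B" unfolding of_int_abs coeff_p int by (rule P(4))
  finally have qB: "of_int q ^ e \<le> B" by simp
  \<comment> \<open>Along the line \<sigma> only coordinate \<open>m\<close> moves. If all Taylor
    coefficients of degree at most \<open>e\<close> vanished, the restriction to this line would
    have a zero of order \<open>Suc e\<close>.\<close>
  have "\<exists>J. (\<Sum>h<M. J h) < Suc e \<and> lookup (shift M x P) J \<noteq> 0"
  proof (rule ccontr)
    assume "\<not> ?thesis"
    moreover have "(\<lambda>h. poly (\<sigma> h) (x m)) = x" by (auto simp: \<sigma>_def)
    ultimately have "[:- x m, 1:] ^ Suc e dvd msub (\<lambda>a. [:a:]) M \<sigma> P"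
      by (intro power_dvd_along_curve) auto
    with f0 show False unfolding f e_def using order_2 by blast
  qed
  then obtain J where J: "(\<Sum>h<M. J h) < Suc e" "lookup (shift M x P) J \<noteq> 0"
    by blast
  have "J m \<le> (\<Sum>h<M. J h)" using m by (intro member_le_sum) auto
  then have "of_int q ^ J m \<le> (of_int q ^ e :: real)" using J(1) q by (intro power_increasing) linarith+
  moreover have "J \<le> s" using J(2) keys_shift_le[OF P(3), of M x] by (auto simp: in_keys_iff)
  ultimately show ?thesis using J(2) qB by (meson order_trans)
qed

section \<open>Sums of products with separated variables\<close>

definition decomposition :: "(nat \<Rightarrow> nat) \<Rightarrow> (nat \<Rightarrow> nat) \<Rightarrow> mpol \<Rightarrow> nat set \<Rightarrow> (nat \<Rightarrow> mpol) \<Rightarrow> (nat \<Rightarrow> mpol) \<Rightarrow> bool" where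
  "decomposition r s P S \<phi> \<psi> \<longleftrightarrow> finite S \<and> P = (\<Sum>j\<in>S. \<phi> j * \<psi> j) \<and>
     (\<forall>j\<in>S. keys (\<phi> j) \<subseteq> {..r} \<and> keys (\<psi> j) \<subseteq> {..s})"

lemma decomposition_commute: "decomposition r s P S \<phi> \<psi> \<longleftrightarrow> decomposition s r P S \<psi> \<phi>"
proof -
  have "(\<Sum>j\<in>S. \<phi> j * \<psi> j) = (\<Sum>j\<in>S. \<psi> j * \<phi> j)" by (rule sum.cong) (auto intro: mult.commute)
  then show ?thesis unfolding decomposition_def by metis
qed

text \<open>Solving the relation for \<open>\<phi> i\<close> distributes the summand
  \<open>\<phi> i * \<psi> i\<close> over the others. The box \<open>s\<close> survives because only
  multiples of \<open>\<psi> i\<close> are subtracted.\<close>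

lemma decomposition_shrink:
  assumes dec: "decomposition r s P S \<phi> \<psi>" and dep: "(\<Sum>j\<in>S. mconst (c j) * \<phi> j) = 0"
    and i: "i \<in> S" "c i \<noteq> 0"
  shows "decomposition r s P (S - {i}) \<phi> (\<lambda>j. \<psi> j - mconst (c j / c i) * \<psi> i)"
proof -
  from dec have fin: "finite S" and P: "P = (\<Sum>j\<in>S. \<phi> j * \<psi> j)"
    and keys: "\<And>j. j \<in> S \<Longrightarrow> keys (\<phi> j) \<subseteq> {..r}" "\<And>j. j \<in> S \<Longrightarrow> keys (\<psi> j) \<subseteq> {..s}"
    by (auto simp: decomposition_def)
  have "mconst (1 / c i) * (\<Sum>j\<in>S. mconst (c j) * \<phi> j) = (\<Sum>j\<in>S. mconst (c j / c i) * \<phi> j)"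
    unfolding sum_distrib_left mult.assoc[symmetric] mconst.hom_mult[symmetric] by simp
  also have "\<dots> = mconst 1 * \<phi> i + (\<Sum>j\<in>S - {i}. mconst (c j / c i) * \<phi> j)"
    using fin i by (simp only: sum.remove divide_self[OF i(2)])
  finally have "\<phi> i + (\<Sum>j\<in>S - {i}. mconst (c j / c i) * \<phi> j) = 0"
    by (simp only: dep mult_zero_right mconst.hom_one mult_1_left)
  then have \<phi>i: "(\<Sum>j\<in>S - {i}. mconst (c j / c i) * \<phi> j) = - \<phi> i"
    by (rule minus_unique[symmetric])
  have "(\<Sum>j\<in>S - {i}. \<phi> j * (\<psi> j - mconst (c j / c i) * \<psi> i))
      = (\<Sum>j\<in>S - {i}. \<phi> j * \<psi> j) - (\<Sum>j\<in>S - {i}. mconst (c j / c i) * \<phi> j) * \<psi> i"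
    unfolding right_diff_distrib sum_subtractf sum_distrib_right by (simp only: mult_ac)
  also have "\<dots> = (\<Sum>j\<in>S - {i}. \<phi> j * \<psi> j) + \<phi> i * \<psi> i" unfolding \<phi>i by simp
  also have "\<dots> = P" unfolding P sum.remove[OF fin i(1)] by (rule add.commute)
  finally have "P = (\<Sum>j\<in>S - {i}. \<phi> j * (\<psi> j - mconst (c j / c i) * \<psi> i))" ..
  moreover have "keys (\<psi> j - mconst (c j / c i) * \<psi> i) \<subseteq> {..s}" if "j \<in> S" for j
  proof
    fix J assume "J \<in> keys (\<psi> j - mconst (c j / c i) * \<psi> i)"
    then have "J \<in> keys (\<psi> j) \<or> J \<in> keys (\<psi> i)"
      by (auto simp: in_keys_iff lookup_minus lookup_mconst_mult)
    then show "J \<in> {..s}" using keys(2)[OF that] keys(2)[OF i(1)] by auto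
  qed
  ultimately show ?thesis using fin keys unfolding decomposition_def by blast
qed

text \<open>With the fewest possible summands, a linear relation on either side would permit one
  summand fewer. Independence on both sides is needed, one for each factor of the Wronskian.\<close>

lemma exists_minimal_decomposition:
  assumes "decomposition r s P S0 \<phi>0 \<psi>0"
  shows "\<exists>k \<phi> \<psi>. k \<le> card S0 \<and> decomposition r s P {..<k} \<phi> \<psi> \<and>
    (\<forall>c. (\<Sum>j<k. mconst (c j) * \<phi> j) = 0 \<longrightarrow> (\<forall>j<k. c j = 0)) \<and>
    (\<forall>c. (\<Sum>j<k. mconst (c j) * \<psi> j) = 0 \<longrightarrow> (\<forall>j<k. c j = 0))"
proof -
  define Q where "Q k \<longleftrightarrow> (\<exists>S \<phi> \<psi>. card S = k \<and> decomposition r s P S \<phi> \<psi>)" for k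
  define k where "k = (LEAST k. Q k)"
  have Q0: "Q (card S0)" using assms by (auto simp: Q_def)
  then have "Q k" unfolding k_def by (rule LeastI)
  then obtain S \<phi>' \<psi>' where S: "card S = k" "decomposition r s P S \<phi>' \<psi>'" by (auto simp: Q_def)
  have "finite S" using S(2) by (simp add: decomposition_def)
  \<comment> \<open>Arbitrary finite index sets allow summands to be removed without renumbering;
    the numbering that matrices need is fixed only here.\<close>
  then obtain f where f: "bij_betw f {..<k} S" using S(1) ex_bij_betw_nat_finite[of S] by (auto simp: atLeast0LessThan)
  define \<phi> where "\<phi> = \<phi>' \<circ> f"
  define \<psi> where "\<psi> = \<psi>' \<circ> f"
  have "(\<Sum>j<k. \<phi> j * \<psi> j) = (\<Sum>j\<in>S. \<phi>' j * \<psi>' j)"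
    using sum.reindex_bij_betw[OF f, of "\<lambda>j. \<phi>' j * \<psi>' j"] by (simp only: \<phi>_def \<psi>_def o_apply)
  moreover have "f j \<in> S" if "j < k" for j using bij_betwE[OF f] that by simp
  ultimately have dec: "decomposition r s P {..<k} \<phi> \<psi>"
    using S(2) unfolding decomposition_def by (simp add: \<phi>_def \<psi>_def)
  have min: "\<not> decomposition r s P ({..<k} - {i}) \<phi> \<psi>" if "i < k" for i \<phi> \<psi>
  proof
    assume "decomposition r s P ({..<k} - {i}) \<phi> \<psi>"
    then have "Q (card ({..<k} - {i}))" unfolding Q_def by blast
    moreover have "card ({..<k} - {i}) < k" using that by simp
    ultimately show False unfolding k_def using not_less_Least by blast
  qed
  have "c j = 0" if c: "(\<Sum>j<k. mconst (c j) * \<phi> j) = 0" "j < k" for c j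
  proof (rule ccontr)
    assume "c j \<noteq> 0"
    from decomposition_shrink[OF dec c(1) _ this] c(2)
    have "decomposition r s P ({..<k} - {j}) \<phi> (\<lambda>i. \<psi> i - mconst (c i / c j) * \<psi> j)"
      by (simp only: lessThan_iff)
    with min[OF c(2)] show False by (rule notE)
  qed
  moreover have "c j = 0" if c: "(\<Sum>j<k. mconst (c j) * \<psi> j) = 0" "j < k" for c j
  proof (rule ccontr)
    assume "c j \<noteq> 0"
    from decomposition_shrink[OF dec[unfolded decomposition_commute[of r s]] c(1) _ this] c(2)
    have "decomposition s r P ({..<k} - {j}) \<psi> (\<lambda>i. \<phi> i - mconst (c i / c j) * \<phi> j)"
      by (simp only: lessThan_iff)
    then have "decomposition r s P ({..<k} - {j}) (\<lambda>i. \<phi> i - mconst (c i / c j) * \<phi> j) \<psi>"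
      by (simp only: decomposition_commute[of s r])
    with min[OF c(2)] show False by (rule notE)
  qed
  moreover have "k \<le> card S0" unfolding k_def by (rule Least_le) (rule Q0)
  ultimately show ?thesis using dec by (intro exI[of _ k] exI[of _ \<phi>] exI[of _ \<psi>]) simp
qed

text \<open>Collecting by powers of variable \<open>m\<close> gives \<open>r m + 1\<close> summands.
  This starting point caps the size of the minimal decomposition.\<close>

lemma decomposition_last_variable:
  assumes P: "keys P \<subseteq> {..r}" and r: "\<And>h. h \<ge> Suc m \<Longrightarrow> r h = 0"
  shows "\<exists>\<phi> \<psi>. decomposition (cutoff m r) (\<lambda>h. if h = m then r m else 0) P {..r m} \<phi> \<psi>"
proof -
  define e where "e j = (\<lambda>h. if h = m then j else 0::nat)" for j :: nat
  define \<phi> where "\<phi> j = (\<Sum>K\<in>{K\<in>keys P. K m = j}. mterm (cutoff m K) (lookup P K))" for j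
  define \<psi> where "\<psi> j = (mterm (e j) 1 :: mpol)" for j
  have K: "cutoff m K + e (K m) = K" "K m \<le> r m" "cutoff m K \<le> cutoff m r" if "K \<in> keys P" for K
  proof -
    have "K \<le> r" using that P by auto
    then have le: "K h \<le> r h" for h by (simp add: le_fun_def)
    show "cutoff m K + e (K m) = K"
    proof
      fix h show "(cutoff m K + e (K m)) h = K h"
        using le[of h] r[of h] by (cases "h < m"; cases "h = m") (auto simp: cutoff_def e_def)
    qed
    show "K m \<le> r m" by (rule le)
    show "cutoff m K \<le> cutoff m r" using le by (simp add: cutoff_def le_fun_def)
  qed
  have "(\<Sum>j\<le>r m. \<phi> j * \<psi> j) = (\<Sum>j\<le>r m. \<Sum>K\<in>{K\<in>keys P. K m = j}. mterm K (lookup P K))"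
  proof (rule sum.cong[OF refl])
    fix j
    show "\<phi> j * \<psi> j = (\<Sum>K\<in>{K\<in>keys P. K m = j}. mterm K (lookup P K))"
      unfolding \<phi>_def \<psi>_def sum_distrib_right
      by (rule sum.cong) (use K(1) in \<open>auto simp: mult_single\<close>)
  qed
  also have "\<dots> = (\<Sum>K\<in>keys P. mterm K (lookup P K))"
    by (rule sum.group) (use K in auto)
  finally have "P = (\<Sum>j\<le>r m. \<phi> j * \<psi> j)" by (simp add: poly_mapping_sum_single)
  moreover have "keys (\<phi> j) \<subseteq> {..cutoff m r}" for j
  proof
    fix J assume "J \<in> keys (\<phi> j)"
    then have "(\<Sum>K\<in>{K\<in>keys P. K m = j}. lookup (mterm (cutoff m K) (lookup P K)) J) \<noteq> 0"
      by (simp add: \<phi>_def in_keys_iff lookup_sum)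
    then obtain K where "K \<in> keys P" "J = cutoff m K"
      by (auto simp: lookup_single when_def elim!: sum.not_neutral_contains_not_neutral split: if_splits)
    then show "J \<in> {..cutoff m r}" using K(3) by simp
  qed
  moreover have "keys (\<psi> j) \<subseteq> {..(\<lambda>h. if h = m then r m else 0)}" if "j \<le> r m" for j
    using that by (auto simp: \<psi>_def e_def le_fun_def)
  ultimately have "decomposition (cutoff m r) (\<lambda>h. if h = m then r m else 0) P {..r m} \<phi> \<psi>"
    unfolding decomposition_def by auto
  then show ?thesis by blast
qed

section \<open>Exponents and size of determinants\<close>

lemma prod_keys_weight:
  fixes w :: "(nat \<Rightarrow> nat) \<Rightarrow> real" and f :: "'a \<Rightarrow> mpol"
  assumes w: "\<And>I J. w (I + J) = w I + w J" "w 0 = 0"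
    and t: "\<And>x J. x \<in> A \<Longrightarrow> J \<in> keys (f x) \<Longrightarrow> t x \<le> w J"
    and J: "J \<in> keys (\<Prod>x\<in>A. f x)" and A: "finite A"
  shows "(\<Sum>x\<in>A. t x) \<le> w J"
  using A t J
proof (induction A arbitrary: J)
  case empty
  then have "J = 0" by (simp only: prod.empty keys_one singleton_iff)
  then show ?case by (simp only: sum.empty w(2) order_refl)
next
  case (insert x A)
  then have "J \<in> keys (f x * (\<Prod>x\<in>A. f x))" by simp
  then obtain K L where KL: "K \<in> keys (f x)" "L \<in> keys (\<Prod>x\<in>A. f x)" "J = K + L"
    using keys_mult[of "f x" "\<Prod>x\<in>A. f x"] by blast
  have "(\<Sum>x\<in>A. t x) \<le> w L" using insert.prems(1) KL(2) by (intro insert.IH) auto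
  moreover have "t x \<le> w K" using insert.prems(1) KL(1) by blast
  ultimately show ?case unfolding KL(3) w(1) using insert.hyps by simp
qed

text \<open>Every term of the Leibniz formula takes one entry from each column, so lower bounds
  depending on the column alone add up. The additive weight may be negative; both degree bounds and
  index bounds are instances.\<close>

lemma keys_det_weight:
  fixes w :: "(nat \<Rightarrow> nat) \<Rightarrow> real" and E :: "nat \<Rightarrow> nat \<Rightarrow> mpol"
  assumes w: "\<And>I J. w (I + J) = w I + w J" "w 0 = 0"
    and t: "\<And>a b J. a < k \<Longrightarrow> b < k \<Longrightarrow> J \<in> keys (E a b) \<Longrightarrow> t b \<le> w J"
    and J: "J \<in> keys (det (mat k k (\<lambda>(a, b). E a b)))"
  shows "(\<Sum>b<k. t b) \<le> w J"
proof -
  have "lookup (det (mat k k (\<lambda>(a, b). E a b))) J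
      = (\<Sum>p\<in>{p. p permutes {0..<k}}. lookup (signof p * (\<Prod>i = 0..<k. E i (p i))) J)"
    by (subst det_def'[of _ k]) (auto simp: lookup_sum intro!: sum.cong arg_cong2[where f = lookup] prod.cong dest: permutes_in_image)
  moreover have "lookup (det (mat k k (\<lambda>(a, b). E a b))) J \<noteq> 0" using J by (simp add: in_keys_iff)
  ultimately obtain p where p: "p permutes {0..<k}" "lookup (signof p * (\<Prod>i = 0..<k. E i (p i))) J \<noteq> 0"
    by (metis (mono_tags, lifting) mem_Collect_eq sum.not_neutral_contains_not_neutral)
  then have "J \<in> keys (\<Prod>i = 0..<k. E i (p i))"
    by (auto simp: in_keys_iff sign_def split: if_splits)
  moreover have "p i < k" if "i < k" for i
    using permutes_in_image[OF p(1), of i] that by simp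
  ultimately have "(\<Sum>i = 0..<k. t (p i)) \<le> w J"
    by (intro prod_keys_weight[where f = "\<lambda>i. E i (p i)" and w = w]) (auto simp: w t)
  also have "(\<Sum>i = 0..<k. t (p i)) = (\<Sum>i<k. t i)"
    using sum.permute[OF p(1), of t] by (simp add: atLeast0LessThan o_def)
  finally show ?thesis .
qed

lemma keys_det_le:
  fixes E :: "nat \<Rightarrow> nat \<Rightarrow> mpol"
  assumes "\<And>a b. a < k \<Longrightarrow> b < k \<Longrightarrow> keys (E a b) \<subseteq> {..r}"
  shows "keys (det (mat k k (\<lambda>(a, b). E a b))) \<subseteq> {..(\<lambda>h. k * r h)}"
proof
  fix J assume J: "J \<in> keys (det (mat k k (\<lambda>(a, b). E a b)))"
  have "J h \<le> k * r h" for h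
  proof -
    \<comment> \<open>An upper bound on degrees is a lower bound for the additive weight - J
      h.\<close>
    have "(\<Sum>b<k. - real (r h)) \<le> - real (J h)"
    proof (rule keys_det_weight[OF _ _ _ J])
      fix a b J assume "a < k" "b < k" "J \<in> keys (E a b)"
      then have "J \<le> r" using assms[of a b] by auto
      then show "- real (r h) \<le> - real (J h)" by (simp add: le_fun_def)
    qed auto
    then have "real (J h) \<le> real (k * r h)" by simp
    then show ?thesis by (simp only: of_nat_le_iff)
  qed
  then show "J \<in> {..(\<lambda>h. k * r h)}" by (simp add: le_fun_def)
qed

lemma int_coeffs_det:
  fixes E :: "nat \<Rightarrow> nat \<Rightarrow> mpol"
  assumes "\<And>a b. a < k \<Longrightarrow> b < k \<Longrightarrow> int_coeffs (E a b)"
  shows "int_coeffs (det (mat k k (\<lambda>(a, b). E a b)))"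
proof (subst det_def'[of _ k])
  show "int_coeffs (\<Sum>p\<in>{p. p permutes {0..<k}}. signof p * (\<Prod>i = 0..<k. mat k k (\<lambda>(a, b). E a b) $$ (i, p i)))"
  proof (intro int_coeffs_sum int_coeffs_mult int_coeffs_prod)
    fix p i assume "p \<in> {p. p permutes {0..<k}}" "i \<in> {0..<k}"
    then have "i < k" "p i < k" using permutes_in_image[of p "{0..<k}" i] by auto
    then show "int_coeffs (mat k k (\<lambda>(a, b). E a b) $$ (i, p i))" by (simp add: assms)
  qed (simp add: sign_def int_coeffs_uminus)
qed simp

lemma len_det:
  fixes E :: "nat \<Rightarrow> nat \<Rightarrow> mpol"
  assumes B: "\<And>a b. a < k \<Longrightarrow> b < k \<Longrightarrow> len (E a b) \<le> B"
  shows "len (det (mat k k (\<lambda>(a, b). E a b))) \<le> fact k * B ^ k"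
proof -
  have "len (det (mat k k (\<lambda>(a, b). E a b)))
     \<le> (\<Sum>p\<in>{p. p permutes {0..<k}}. len (signof p * (\<Prod>i = 0..<k. mat k k (\<lambda>(a, b). E a b) $$ (i, p i))))"
    by (subst det_def'[of _ k]) (auto intro: len_sum)
  also have "\<dots> \<le> (\<Sum>p\<in>{p. p permutes {0..<k}}. B ^ k)"
  proof (rule sum_mono)
    fix p assume "p \<in> {p. p permutes {0..<k}}"
    then have p: "p i < k" if "i < k" for i using permutes_in_image[of p "{0..<k}" i] that by auto
    have "len (signof p * (\<Prod>i = 0..<k. mat k k (\<lambda>(a, b). E a b) $$ (i, p i)))
      = len (\<Prod>i = 0..<k. mat k k (\<lambda>(a, b). E a b) $$ (i, p i))"
      by (simp add: sign_def)
    also have "\<dots> \<le> (\<Prod>i = 0..<k. len (mat k k (\<lambda>(a, b). E a b) $$ (i, p i)))" by (rule len_prod)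
    also have "\<dots> \<le> (\<Prod>i = 0..<k. B)" using p by (intro prod_mono) (auto intro: B)
    finally show "len (signof p * (\<Prod>i = 0..<k. mat k k (\<lambda>(a, b). E a b) $$ (i, p i))) \<le> B ^ k" by simp
  qed
  also have "\<dots> = fact k * B ^ k" by (simp add: card_permutations[of "{0..<k}" k])
  finally show ?thesis .
qed

text \<open>About the first \<eta> * r / 4 terms are at least \<eta> / 4 each, and because k \<le> r
  + 1 these are at least a share \<eta> / 8 of all \<open>k\<close> terms. This product is why the
  index enters Roth's lemma squared.\<close>

lemma sum_truncated_linear_lower_bound:
  fixes \<eta> :: real
  assumes \<eta>: "0 < \<eta>" "\<eta> \<le> 1" and r: "r \<ge> 1" and k: "k \<le> r + 1"
  shows "real k * \<eta>\<^sup>2 / 32 \<le> (\<Sum>b<k. max 0 (\<eta> / 2 - real b / real r))"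
proof -
  define n where "n = min k (nat \<lfloor>\<eta> * real r / 4\<rfloor> + 1)"
  have fl: "real (nat \<lfloor>\<eta> * real r / 4\<rfloor>) = of_int \<lfloor>\<eta> * real r / 4\<rfloor>" using \<eta> by simp
  have nn: "real n \<ge> real k * \<eta> / 8"
  proof (cases "k \<le> nat \<lfloor>\<eta> * real r / 4\<rfloor> + 1")
    case True
    have "real k * \<eta> \<le> real k * 1" using \<eta> by (intro mult_left_mono) auto
    moreover have "0 \<le> real k" by simp
    ultimately have "real k * \<eta> / 8 \<le> real k" by linarith
    with True show ?thesis by (simp add: n_def min_def)
  next
    case False
    then have "real n = of_int \<lfloor>\<eta> * real r / 4\<rfloor> + 1" using fl by (simp add: n_def min_def)
    then have n: "\<eta> * real r / 4 \<le> real n" by linarith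
    have "real k \<le> 2 * real r" using k r by linarith
    then have "\<eta> * real k \<le> \<eta> * (2 * real r)" using \<eta> by (intro mult_left_mono) auto
    then have "real k * \<eta> / 8 \<le> \<eta> * real r / 4" by (simp add: mult.commute)
    also note n
    finally show ?thesis .
  qed
  have "real k * \<eta>\<^sup>2 / 32 = (real k * \<eta> / 8) * (\<eta> / 4)" by (simp add: power2_eq_square)
  also have "\<dots> \<le> real n * (\<eta> / 4)" using nn \<eta> by (intro mult_right_mono) auto
  also have "\<dots> = (\<Sum>b<n. \<eta> / 4)" by simp
  also have "\<dots> \<le> (\<Sum>b<n. max 0 (\<eta> / 2 - real b / real r))"
  proof (rule sum_mono)
    fix b assume "b \<in> {..<n}"
    then have "b \<le> nat \<lfloor>\<eta> * real r / 4\<rfloor>" by (auto simp: n_def)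
    then have "real b \<le> \<eta> * real r / 4" using fl by linarith
    then have "real b / real r \<le> \<eta> / 4" using r by (simp add: field_simps)
    then show "\<eta> / 4 \<le> max 0 (\<eta> / 2 - real b / real r)" by linarith
  qed
  also have "\<dots> \<le> (\<Sum>b<k. max 0 (\<eta> / 2 - real b / real r))"
    by (rule sum_mono2) (auto simp: n_def)
  finally show ?thesis .
qed

text \<open>A variable with \<open>r h = 0\<close> contributes 0, since division by zero yields 0;
  absent variables are thereby ignored.\<close>

definition wt :: "nat \<Rightarrow> (nat \<Rightarrow> nat) \<Rightarrow> (nat \<Rightarrow> nat) \<Rightarrow> real" where
  "wt M r J = (\<Sum>h<M. real (J h) / real (r h))"

lemma wt_add: "wt M r (I + J) = wt M r I + wt M r J"
  by (simp add: wt_def add_divide_distrib sum.distrib)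

lemma wt_zero [simp]: "wt M r 0 = 0"
  by (simp add: wt_def)

lemma wt_nonneg: "wt M r J \<ge> 0"
  by (simp add: wt_def sum_nonneg)

text \<open>\<open>D\<close> plays the role of the common size of \<open>r h * ln (q h)\<close>; the variables \<open>h \<ge> m\<close> do not occur.\<close>
definition roth_params :: "real \<Rightarrow> real \<Rightarrow> nat \<Rightarrow> (nat \<Rightarrow> nat) \<Rightarrow> (nat \<Rightarrow> int) \<Rightarrow> (nat \<Rightarrow> int) \<Rightarrow> bool" where
  "roth_params \<omega> D m r a q \<longleftrightarrow> D > 0 \<and> (\<forall>h\<ge>m. r h = 0) \<and>
     (\<forall>h<m. 1 \<le> r h \<and> real (r h) \<le> \<omega> * D \<and> coprime (a h) (q h) \<and> 0 < q h \<and> D \<le> real (r h) * ln (of_int (q h))) \<and>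
     (\<forall>i<m. \<forall>h<i. real (r i) \<le> \<omega> * real (r h))"


lemma roth_params_mono:
  assumes "roth_params \<omega> D m r a q" "\<omega> \<le> \<omega>'"
  shows "roth_params \<omega>' D m r a q"
proof -
  have le: "y \<le> \<omega> * x \<Longrightarrow> y \<le> \<omega>' * x" if "x \<ge> 0" for x y
    using mult_right_mono[OF assms(2) that] by linarith
  have "D \<ge> 0" using assms(1) by (simp add: roth_params_def)
  then show ?thesis using assms(1) le unfolding roth_params_def by simp
qed

text \<open>A determinant of size \<open>k\<close> multiplies degrees by up to \<open>k\<close>. The
  conditions are homogeneous in the degrees and \<open>D\<close>, apart from the bound
  \<open>1 \<le> r h\<close>, which k \<ge> 1 preserves; so scaling both leaves \<omega>
  unchanged.\<close>

lemma roth_params_cutoff_scale: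
  assumes par: "roth_params \<omega> D (Suc m) r a q" and k: "k \<ge> 1"
  shows "roth_params \<omega> (real k * D) m (\<lambda>h. k * cutoff m r h) a q"
  unfolding roth_params_def
proof (intro conjI allI impI)
  have k': "real k > 0" using k by simp
  show "real k * D > 0" using par k' by (simp add: roth_params_def)
  show "k * cutoff m r h = 0" if "h \<ge> m" for h using that by (simp add: cutoff_def)
  fix h assume h: "h < m"
  then have p: "1 \<le> r h" "real (r h) \<le> \<omega> * D" "coprime (a h) (q h)" "0 < q h" "D \<le> real (r h) * ln (of_int (q h))"
    using par by (auto simp: roth_params_def)
  show "1 \<le> k * cutoff m r h" using p(1) k h by (simp add: cutoff_def Suc_le_eq)
  have "real k * real (r h) \<le> real k * (\<omega> * D)" using p(2) k' by (intro mult_left_mono) auto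
  then show "real (k * cutoff m r h) \<le> \<omega> * (real k * D)" using h by (simp add: cutoff_def mult_ac)
  show "coprime (a h) (q h)" "0 < q h" by (fact p)+
  have "real k * D \<le> real k * (real (r h) * ln (of_int (q h)))" using p(5) k' by (intro mult_left_mono) auto
  then show "real k * D \<le> real (k * cutoff m r h) * ln (of_int (q h))" using h by (simp add: cutoff_def mult_ac)
next
  fix i h assume ih: "i < m" "h < i"
  then have "real (r i) \<le> \<omega> * real (r h)" using par by (auto simp: roth_params_def)
  then have "real k * real (r i) \<le> real k * (\<omega> * real (r h))" by (intro mult_left_mono) auto
  then show "real (k * cutoff m r i) \<le> \<omega> * real (k * cutoff m r h)"
    using ih by (simp add: cutoff_def mult_ac)
qed

text \<open>Origin of \<open>2 * M + 2\<close>: per row, the binomials of the derivatives and the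
  number of coefficients cost \<open>M * T\<close> each in the exponent, the height of
  \<open>P\<close> costs \<open>T\<close>, and the bound k ^ k for the factorial costs another
  \<open>T\<close>.\<close>

lemma len_det_hasse:
  assumes P: "keys P \<subseteq> {..r}" "\<And>J. \<bar>lookup P J\<bar> \<le> exp T" and r: "\<And>h. h \<ge> M \<Longrightarrow> r h = 0"
    and T: "\<And>h. h < M \<Longrightarrow> real (r h) \<le> T" and k: "real k \<le> exp T"
  shows "len (det (mat k k (\<lambda>(a, b). hasse M (I a b) P))) \<le> exp (real k * (real (2 * M + 2) * T))"
proof -
  define s where "s = (\<Sum>h<M. r h)"
  have s: "real s \<le> real M * T"
    unfolding s_def of_nat_sum using sum_bounded_above[of "{..<M}" "\<lambda>h. real (r h)" T] T by simp
  have two: "(2::real) ^ s \<le> exp (real M * T)"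
  proof -
    have "(2::real) \<le> exp 1" using exp_ge_add_one_self[of 1] by simp
    then have "(2::real) ^ s \<le> exp 1 ^ s" by (intro power_mono) auto
    also have "\<dots> = exp (real s)" by (simp add: exp_of_nat_mult[symmetric])
    also have "\<dots> \<le> exp (real M * T)" using s by simp
    finally show ?thesis .
  qed
  have "len P \<le> 2 ^ s * exp T" unfolding s_def using r P by (rule len_le_card)
  also have "\<dots> \<le> exp (real M * T) * exp T" using two by (intro mult_right_mono) auto
  finally have lenP: "len P \<le> exp (real M * T) * exp T" .
  have "len (hasse M (I a b) P) \<le> exp (real (2 * M + 1) * T)" for a b
  proof -
    have "len (hasse M (I a b) P) \<le> 2 ^ s * len P" unfolding s_def using P(1) by (rule len_hasse)
    also have "\<dots> \<le> exp (real M * T) * (exp (real M * T) * exp T)"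
      using two lenP by (intro mult_mono) auto
    also have "\<dots> = exp (real (2 * M + 1) * T)" by (simp add: exp_add[symmetric] algebra_simps)
    finally show ?thesis .
  qed
  then have "len (det (mat k k (\<lambda>(a, b). hasse M (I a b) P))) \<le> fact k * exp (real (2 * M + 1) * T) ^ k"
    by (rule len_det)
  also have "(fact k :: real) \<le> real k ^ k" using fact_le_power[of k, where 'a = real] by simp
  also have "real k ^ k \<le> exp T ^ k" using k by (intro power_mono) auto
  also have "exp T ^ k * exp (real (2 * M + 1) * T) ^ k = exp (real k * (real (2 * M + 2) * T))"
    by (simp add: exp_of_nat_mult[symmetric] exp_add[symmetric] algebra_simps)
  finally show ?thesis by simp
qed

lemma hasse_sum_mult_disjoint:
  assumes dec: "decomposition r s P {..<k} \<phi> \<psi>"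
    and rs: "\<And>h. (r h = 0 \<and> I h = 0) \<or> (s h = 0 \<and> J h = 0)"
  shows "hasse M (I + J) P = (\<Sum>j<k. hasse M I (\<phi> j) * hasse M J (\<psi> j))"
proof -
  have "P = (\<Sum>j<k. \<phi> j * \<psi> j)" using dec by (simp add: decomposition_def)
  then have "hasse M (I + J) P = (\<Sum>j<k. hasse M (I + J) (\<phi> j * \<psi> j))" by (simp only: hasse_sum)
  also have "\<dots> = (\<Sum>j<k. hasse M I (\<phi> j) * hasse M J (\<psi> j))"
    using dec rs by (intro sum.cong refl hasse_mult_disjoint[of _ r _ s]) (auto simp: decomposition_def)
  finally show ?thesis .
qed

text \<open>Up to a binomial factor, the coefficient at \<open>J\<close> of the derivative is that
  of \<open>P\<close> at \<open>I + J\<close>; so differentiation lowers the index by at most the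
  weight of \<open>I\<close>. Once that weight exceeds \<eta>, only nonnegativity is left.\<close>

lemma wt_hasse_lower_bound:
  assumes J: "J \<in> keys (shift M x (hasse M I P))" and I: "\<And>h. h \<ge> M \<Longrightarrow> I h = 0"
    and big: "\<And>J. lookup (shift M x P) J \<noteq> 0 \<Longrightarrow> \<eta> < wt M r J"
  shows "max 0 (\<eta> - wt M r I) \<le> wt M r J"
proof -
  have "lookup (shift M x P) (I + J) \<noteq> 0"
    using J lookup_shift_hasse[of M I x P J] I by (auto simp: in_keys_iff)
  from big[OF this] show ?thesis using wt_nonneg[of M r J] by (simp add: wt_add)
qed


text \<open>Splitting off the last variable by a decomposition with the fewest summands, the Wronskian
  \<open>W\<close> of \<open>P\<close> factors as \<open>U * V\<close>. Up to constants, \<open>U\<close> and \<open>V\<close> are slices of \<open>W\<close>, so they inherit its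
  integrality and height, and their indices are small. But the index of \<open>W\<close> is at least about
  \<open>k * \<eta>\<^sup>2 / 32\<close> when that of \<open>P\<close> exceeds \<open>\<eta>\<close>.\<close>
lemma roth_lemma_step:
  assumes m: "m < M" and \<eta>: "0 < \<eta>" "\<eta> \<le> 1"
    and IH: "\<And>r D P. roth_params \<omega>' D m r a q \<Longrightarrow> int_coeffs P \<Longrightarrow> P \<noteq> 0 \<Longrightarrow> keys P \<subseteq> {..r} \<Longrightarrow>
        (\<And>J. \<bar>lookup P J\<bar> \<le> exp (\<omega>' * D)) \<Longrightarrow>
        \<exists>J. lookup (shift M (\<lambda>h. of_int (a h) / of_int (q h)) P) J \<noteq> 0 \<and> wt M r J \<le> \<eta>\<^sup>2 / 128"
    and \<omega>: "0 < \<omega>" "real (2 * M + 2) * \<omega> \<le> \<omega>'" "real (2 * M + 2) * \<omega> \<le> \<eta>\<^sup>2 / 128" "\<omega> \<le> \<eta> / 2"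
    and par: "roth_params \<omega> D (Suc m) r a q"
    and P: "int_coeffs P" "P \<noteq> 0" "keys P \<subseteq> {..r}" "\<And>J. \<bar>lookup P J\<bar> \<le> exp (\<omega> * D)"
  shows "\<exists>J. lookup (shift M (\<lambda>h. of_int (a h) / of_int (q h)) P) J \<noteq> 0 \<and> wt M r J \<le> \<eta>"
proof (rule ccontr)
  define x :: "nat \<Rightarrow> real" where "x h = of_int (a h) / of_int (q h)" for h
  assume "\<not> ?thesis"
  then have big: "\<eta> < wt M r J" if "lookup (shift M x P) J \<noteq> 0" for J
    using that unfolding x_def by (meson not_le)
  have r0: "r h = 0" if "h \<ge> Suc m" for h using par that by (simp add: roth_params_def)
  have r0': "r h = 0" if "h \<ge> M" for h using r0[of h] that m by simp
  have rm: "r m \<ge> 1" "real (r m) \<le> \<omega> * D" "coprime (a m) (q m)" "q m > 0" "D \<le> real (r m) * ln (of_int (q m))"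
    using par by (auto simp: roth_params_def)
  have D: "D > 0" using par by (simp add: roth_params_def)
  define cm where "cm = cutoff m r"
  define em where "em = (\<lambda>h. if h = m then r m else 0)"
  have cm_em: "cm h = 0 \<or> em h = 0" for h by (simp add: cm_def em_def cutoff_def)
  obtain \<phi>0 \<psi>0 where "decomposition cm em P {..r m} \<phi>0 \<psi>0"
    using decomposition_last_variable[OF P(3) r0] unfolding cm_def em_def by blast
  from exists_minimal_decomposition[OF this] obtain k \<phi> \<psi> where
    k: "k \<le> r m + 1" and dec: "decomposition cm em P {..<k} \<phi> \<psi>"
    and indep\<phi>: "\<And>c. (\<Sum>j<k. mconst (c j) * \<phi> j) = 0 \<Longrightarrow> \<forall>j<k. c j = 0"
    and indep\<psi>: "\<And>c. (\<Sum>j<k. mconst (c j) * \<psi> j) = 0 \<Longrightarrow> \<forall>j<k. c j = 0"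
    by (auto simp only: card_atMost Suc_eq_plus1)
  have k1: "k \<ge> 1"
  proof (rule ccontr)
    assume "\<not> k \<ge> 1"
    then have "k = 0" by simp
    with dec P(2) show False by (simp add: decomposition_def)
  qed
  have k\<phi>: "keys (\<phi> j) \<subseteq> {..cm}" and k\<psi>: "keys (\<psi> j) \<subseteq> {..em}" if "j < k" for j
    using dec that by (auto simp only: decomposition_def lessThan_iff)
  have cm0: "cm h = 0" if "h \<ge> M" for h using r0'[OF that] by (simp add: cm_def cutoff_def)
  have em0: "em h = 0" if "h \<noteq> m" for h using that by (simp add: em_def)
  have "\<exists>I. (\<forall>a<k. I a \<le> cm \<and> (\<Sum>h<M. I a h) < k) \<and> det (mat k k (\<lambda>(a, j). hasse M (I a) (\<phi> j))) \<noteq> 0"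
    by (rule exists_generalized_wronskian) (erule k\<phi> cm0 indep\<phi>)+
  then obtain I where I: "\<And>a. a < k \<Longrightarrow> I a \<le> cm" "\<And>a. a < k \<Longrightarrow> (\<Sum>h<M. I a h) < k"
    and Un0: "det (mat k k (\<lambda>(a, j). hasse M (I a) (\<phi> j))) \<noteq> 0" by blast
  define e where "e b = (\<lambda>h. if h = m then b else 0::nat)" for b :: nat
  define U where "U = det (mat k k (\<lambda>(a, j). hasse M (I a) (\<phi> j)))"
  define V where "V = det (mat k k (\<lambda>(j, b). hasse M (e b) (\<psi> j)))"
  define W where "W = det (mat k k (\<lambda>(a, b). hasse M (I a + e b) P))"
  have U0: "U \<noteq> 0" using Un0 by (simp only: U_def not_False_eq_True)
  have V0: "V \<noteq> 0" unfolding V_def e_def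
    by (rule wronskian_nonzero) (erule k\<psi> em0 indep\<psi> | rule m)+
  have Ia: "I a h \<le> cm h" if "a < k" for a h using I(1)[OF that] by (rule le_funD)
  \<comment> \<open>Entry (a, b) of the matrix product sums the derivatives of order
    \<open>I a\<close> of \<open>\<phi> j\<close> times those of order \<open>e b\<close> of
    \<open>\<psi> j\<close>. As the two families share no variable, this is the derivative of
    \<open>P\<close> of order \<open>I a + e b\<close>.\<close>
  have WUV: "W = U * V"
  proof -
    have "U * V = det (mat k k (\<lambda>(a, j). hasse M (I a) (\<phi> j)) * mat k k (\<lambda>(j, b). hasse M (e b) (\<psi> j)))"
      unfolding U_def V_def by (rule det_mult[symmetric, of _ k]) auto
    also have "mat k k (\<lambda>(a, j). hasse M (I a) (\<phi> j)) * mat k k (\<lambda>(j, b). hasse M (e b) (\<psi> j))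
        = mat k k (\<lambda>(a, b). hasse M (I a + e b) P)"
    proof (rule eq_matI)
      fix a b assume "a < dim_row (mat k k (\<lambda>(a, b). hasse M (I a + e b) P))"
        "b < dim_col (mat k k (\<lambda>(a, b). hasse M (I a + e b) P))"
      then have ab: "a < k" "b < k" by simp_all
      have rs: "(cm h = 0 \<and> I a h = 0) \<or> (em h = 0 \<and> e b h = 0)" for h
        using Ia[OF ab(1), of h] by (cases "h = m") (auto simp: cm_def em_def e_def cutoff_def)
      show "(mat k k (\<lambda>(a, j). hasse M (I a) (\<phi> j)) * mat k k (\<lambda>(j, b). hasse M (e b) (\<psi> j))) $$ (a, b)
         = mat k k (\<lambda>(a, b). hasse M (I a + e b) P) $$ (a, b)"
        using ab hasse_sum_mult_disjoint[OF dec rs, of M]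
        by (simp add: scalar_prod_def atLeast0LessThan)
    qed auto
    finally show ?thesis unfolding W_def by (rule sym)
  qed
  have kU: "keys U \<subseteq> {..(\<lambda>h. k * cm h)}" unfolding U_def
    by (rule keys_det_le) (rule keys_hasse_le, erule k\<phi>)
  have kV: "keys V \<subseteq> {..(\<lambda>h. k * em h)}" unfolding V_def
    by (rule keys_det_le) (rule keys_hasse_le, erule k\<psi>)
  have disj: "k * cm h = 0 \<or> k * em h = 0" for h using cm_em[of h] by auto
  have lookup_W: "lookup W (I' + J') = lookup U I' * lookup V J'" if "I' \<le> (\<lambda>h. k * cm h)" "J' \<le> (\<lambda>h. k * em h)" for I' J'
    unfolding WUV using kU kV disj that by (rule lookup_mult_disjoint)
  define H where "H = exp (real k * (real (2 * M + 2) * (\<omega> * D)))"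
  have "len W \<le> H"
    unfolding W_def H_def
  proof (rule len_det_hasse[OF P(3) P(4) r0'])
    fix h assume "h < M"
    show "real (r h) \<le> \<omega> * D"
    proof (cases "h < Suc m")
      case True
      then show ?thesis using par by (simp add: roth_params_def)
    next
      case False
      then show ?thesis using r0[of h] \<omega>(1) D by simp
    qed
  next
    have "real k \<le> 1 + real (r m)" using k by simp
    also have "\<dots> \<le> exp (real (r m))" by (rule exp_ge_add_one_self)
    also have "\<dots> \<le> exp (\<omega> * D)" using rm(2) by simp
    finally show "real k \<le> exp (\<omega> * D)" .
  qed
  then have W_le: "\<bar>lookup W J\<bar> \<le> H" for J using abs_lookup_le_len[of W J] by linarith
  have "int_coeffs W" unfolding W_def by (rule int_coeffs_det) (rule int_coeffs_hasse, rule P(1))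
  then have W_int: "lookup W J \<in> \<int>" for J by (simp add: int_coeffs_def)
  have nonzero_key: "\<exists>K. lookup Q K \<noteq> 0" if "Q \<noteq> 0" for Q :: mpol
    using that by (metis lookup_zero poly_mapping_eqI)
  \<comment> \<open>The decomposition is over the reals, so \<open>U\<close> and \<open>V\<close>
    need not be integral. Scaling each by a nonzero coefficient of the other makes it integral, with
    the height of \<open>W\<close>, and does not affect which Taylor coefficients vanish.\<close>
  obtain I0 where I0: "lookup U I0 \<noteq> 0" using nonzero_key[OF U0] by blast
  obtain J0 where J0: "lookup V J0 \<noteq> 0" using nonzero_key[OF V0] by blast
  have I0': "I0 \<le> (\<lambda>h. k * cm h)" using I0 kU by (auto simp: in_keys_iff)
  have J0': "J0 \<le> (\<lambda>h. k * em h)" using J0 kV by (auto simp: in_keys_iff)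
  have shift_mconst: "lookup (shift M x (mconst c * Q)) J = c * lookup (shift M x Q) J" for c Q J
  proof -
    have "shift M x (mconst c) = mconst c" unfolding shift_def by (rule mconst.msub_mconst)
    then show ?thesis by (simp only: shift.hom_mult lookup_mconst_mult)
  qed
  have sliceU: "lookup (mconst (lookup V J0) * U) J \<in> \<int> \<and> \<bar>lookup (mconst (lookup V J0) * U) J\<bar> \<le> H" for J
  proof (cases "J \<le> (\<lambda>h. k * cm h)")
    case True
    have "lookup (mconst (lookup V J0) * U) J = lookup W (J + J0)"
      unfolding lookup_W[OF True J0'] lookup_mconst_mult by (rule mult.commute)
    then show ?thesis using W_le W_int by simp
  next
    case False
    then have "lookup U J = 0" using kU by (auto simp: in_keys_iff)
    then show ?thesis by (simp add: lookup_mconst_mult H_def)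
  qed
  have sliceV: "lookup (mconst (lookup U I0) * V) J \<in> \<int> \<and> \<bar>lookup (mconst (lookup U I0) * V) J\<bar> \<le> H" for J
  proof (cases "J \<le> (\<lambda>h. k * em h)")
    case True
    have "lookup (mconst (lookup U I0) * V) J = lookup W (I0 + J)"
      unfolding lookup_W[OF I0' True] lookup_mconst_mult ..
    then show ?thesis using W_le W_int by simp
  next
    case False
    then have "lookup V J = 0" using kV by (auto simp: in_keys_iff)
    then show ?thesis by (simp add: lookup_mconst_mult H_def)
  qed
  have kD: "real k * D > 0" using k1 D by simp
  have "\<exists>J. lookup (shift M (\<lambda>h. of_int (a h) / of_int (q h)) (mconst (lookup V J0) * U)) J \<noteq> 0
      \<and> wt M (\<lambda>h. k * cm h) J \<le> \<eta>\<^sup>2 / 128"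
  proof (rule IH)
    have "0 \<le> real M * \<omega>" using \<omega>(1) by simp
    then have "\<omega> \<le> real (2 * M + 2) * \<omega>" using \<omega>(1) by (simp add: algebra_simps)
    then have "\<omega> \<le> \<omega>'" using \<omega>(2) by linarith
    then show "roth_params \<omega>' (real k * D) m (\<lambda>h. k * cm h) a q"
      unfolding cm_def using roth_params_cutoff_scale[OF par k1] roth_params_mono by blast
    show "int_coeffs (mconst (lookup V J0) * U)" using sliceU by (simp add: int_coeffs_def)
    have "lookup (mconst (lookup V J0) * U) I0 \<noteq> 0" using I0 J0 by (simp add: lookup_mconst_mult)
    then show "mconst (lookup V J0) * U \<noteq> 0" by (metis lookup_zero)
    show "keys (mconst (lookup V J0) * U) \<subseteq> {..\<lambda>h. k * cm h}"
    proof
      fix J assume "J \<in> keys (mconst (lookup V J0) * U)"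
      then have "J \<in> keys U" by (auto simp: in_keys_iff lookup_mconst_mult)
      then show "J \<in> {..\<lambda>h. k * cm h}" using kU by blast
    qed
    have "H \<le> exp (\<omega>' * (real k * D))"
    proof -
      have "real (2 * M + 2) * \<omega> * (real k * D) \<le> \<omega>' * (real k * D)"
        using \<omega>(2) kD by (intro mult_right_mono) auto
      then show ?thesis unfolding H_def by (simp add: mult_ac)
    qed
    then show "\<bar>lookup (mconst (lookup V J0) * U) J\<bar> \<le> exp (\<omega>' * (real k * D))" for J
      using sliceU[of J] by linarith
  qed
  then obtain J1 where J1: "lookup (shift M x U) J1 \<noteq> 0" and wt1: "wt M (\<lambda>h. k * cm h) J1 \<le> \<eta>\<^sup>2 / 128"
    unfolding x_def[symmetric] shift_mconst by auto
  have "\<exists>J\<le>(\<lambda>h. k * em h). lookup (shift M x (mconst (lookup U I0) * V)) J \<noteq> 0 \<and> of_int (q m) ^ J m \<le> H"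
  proof (rule one_variable_index)
    show "int_coeffs (mconst (lookup U I0) * V)" using sliceV by (simp add: int_coeffs_def)
    have "lookup (mconst (lookup U I0) * V) J0 \<noteq> 0" using I0 J0 by (simp add: lookup_mconst_mult)
    then show "mconst (lookup U I0) * V \<noteq> 0" by (metis lookup_zero)
    show "keys (mconst (lookup U I0) * V) \<subseteq> {..\<lambda>h. k * em h}"
    proof
      fix J assume "J \<in> keys (mconst (lookup U I0) * V)"
      then have "J \<in> keys V" by (auto simp: in_keys_iff lookup_mconst_mult)
      then show "J \<in> {..\<lambda>h. k * em h}" using kV by blast
    qed
    show "\<bar>lookup (mconst (lookup U I0) * V) J\<bar> \<le> H" for J using sliceV[of J] by blast
    show "k * em h = 0" if "h \<noteq> m" for h using em0[OF that] by simp
    show "x m = of_int (a m) / of_int (q m)" by (rule x_def)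
  qed (fact m rm)+
  then obtain J2 where J2: "J2 \<le> (\<lambda>h. k * em h)" "lookup (shift M x V) J2 \<noteq> 0" "of_int (q m) ^ J2 m \<le> H"
    unfolding shift_mconst by auto
  have J1': "J1 \<le> (\<lambda>h. k * cm h)" using J1 keys_shift_le[OF kU, of M x] by (auto simp: in_keys_iff)
  \<comment> \<open>The induction hypothesis weighs against the degrees k * r h of \<open>U\<close>;
    relative to \<open>r\<close> the weight is \<open>k\<close> times as large.\<close>
  have wt1': "wt M r J1 = real k * wt M (\<lambda>h. k * cm h) J1"
    unfolding wt_def sum_distrib_left
  proof (rule sum.cong[OF refl])
    fix h
    show "real (J1 h) / real (r h) = real k * (real (J1 h) / real (k * cm h))"
      using le_funD[OF J1', of h] k1 by (cases "h < m") (auto simp: cm_def cutoff_def)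
  qed
  have wt2: "wt M r J2 = real (J2 m) / real (r m)"
  proof -
    have "J2 h = 0" if "h \<noteq> m" for h using le_funD[OF J2(1), of h] em0[OF that] by simp
    then have "wt M r J2 = (\<Sum>h<M. if h = m then real (J2 m) / real (r m) else 0)"
      unfolding wt_def by (intro sum.cong) auto
    then show ?thesis using m by simp
  qed
  \<comment> \<open>Taking logarithms in q m ^ J2 m \<le> H bounds \<open>J2 m\<close> against ln (q
    m), and D \<le> r m * ln (q m) turns this into a weight in which \<open>D\<close>
    cancels.\<close>
  have "wt M r J2 \<le> real k * (\<eta>\<^sup>2 / 128)"
  proof -
    have "real (J2 m) * ln (of_int (q m)) = ln (of_int (q m) ^ J2 m)"
      using rm(4) by (simp add: ln_realpow)
    also have "\<dots> \<le> ln H" using rm(4) J2(3) by (subst ln_le_cancel_iff) (auto simp: H_def)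
    also have "\<dots> = (real k * D) * (real (2 * M + 2) * \<omega>)" by (simp add: H_def)
    also have "\<dots> \<le> (real k * D) * (\<eta>\<^sup>2 / 128)" using \<omega>(3) kD by (intro mult_left_mono) auto
    finally have le: "real (J2 m) * ln (of_int (q m)) \<le> (real k * D) * (\<eta>\<^sup>2 / 128)" .
    have "real (J2 m) * D \<le> real (J2 m) * (real (r m) * ln (of_int (q m)))"
      using rm(5) by (intro mult_left_mono) auto
    also have "\<dots> = real (r m) * (real (J2 m) * ln (of_int (q m)))" by (simp only: mult_ac)
    also have "\<dots> \<le> real (r m) * ((real k * D) * (\<eta>\<^sup>2 / 128))" using le by (intro mult_left_mono) auto
    also have "\<dots> = (real (r m) * (real k * (\<eta>\<^sup>2 / 128))) * D" by (simp only: mult_ac)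
    finally have "real (J2 m) \<le> real (r m) * (real k * (\<eta>\<^sup>2 / 128))"
      using D by (simp only: mult_le_cancel_right_pos)
    then show ?thesis unfolding wt2 using rm(1) by (simp add: divide_le_eq mult_ac)
  qed
  moreover have "wt M r J1 \<le> real k * (\<eta>\<^sup>2 / 128)"
    unfolding wt1' using wt1 by (intro mult_left_mono) auto
  \<comment> \<open>The 128 is chosen so that the two factors together stay at half of the lower
    bound k * \<eta>^2 / 32 derived below.\<close>
  ultimately have upper: "wt M r (J1 + J2) \<le> real k * \<eta>\<^sup>2 / 64" unfolding wt_add by linarith
  have "shift M x W = shift M x U * shift M x V" unfolding WUV by (rule shift.hom_mult)
  then have "lookup (shift M x W) (J1 + J2) = lookup (shift M x U) J1 * lookup (shift M x V) J2"
    using lookup_mult_disjoint[OF keys_shift_le[OF kU] keys_shift_le[OF kV] disj J1' J2(1)] by simp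
  then have "lookup (shift M x W) (J1 + J2) \<noteq> 0" using J1 J2(2) by simp
  then have key: "J1 + J2 \<in> keys (shift M x W)" by (simp only: in_keys_iff not_False_eq_True)
  have shift_W: "shift M x W = det (mat k k (\<lambda>(a, b). shift M x (hasse M (I a + e b) P)))"
  proof -
    have "shift M x W = det (map_mat (shift M x) (mat k k (\<lambda>(a, b). hasse M (I a + e b) P)))"
      unfolding W_def by (rule shift.hom_det[symmetric])
    also have "map_mat (shift M x) (mat k k (\<lambda>(a, b). hasse M (I a + e b) P))
        = mat k k (\<lambda>(a, b). shift M x (hasse M (I a + e b) P))"
      by (rule eq_matI) auto
    finally show ?thesis .
  qed
  have "(\<Sum>b<k. max 0 (\<eta> / 2 - real b / real (r m))) \<le> wt M r (J1 + J2)"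
  proof (rule keys_det_weight[OF wt_add wt_zero _ key[unfolded shift_W]])
    fix a b J assume ab: "a < k" "b < k" and J: "J \<in> keys (shift M x (hasse M (I a + e b) P))"
    have "(I a + e b) h = 0" if "h \<ge> M" for h using Ia[OF ab(1), of h] cm0[OF that] m that by (simp add: e_def)
    from wt_hasse_lower_bound[OF J this big]
    have "max 0 (\<eta> - wt M r (I a + e b)) \<le> wt M r J" .
    moreover have "wt M r (e b) = real b / real (r m)"
    proof -
      have "wt M r (e b) = (\<Sum>h<M. if h = m then real b / real (r m) else 0)"
        unfolding wt_def by (intro sum.cong) (auto simp: e_def)
      then show ?thesis using m by simp
    qed
    \<comment> \<open>The total order of \<open>I a\<close> is at most k - 1 \<le> r m, and it falls
      on variables of degree at least r m / \<omega>; its weight is therefore at most \<omega>. Here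
      the rapid decrease of degrees enters.\<close>
    moreover have "wt M r (I a) \<le> \<eta> / 2"
    proof -
      have "real (I a h) / real (r h) \<le> \<omega> / real (r m) * real (I a h)" for h
      proof (cases "h < m")
        case True
        then have "real (r m) \<le> \<omega> * real (r h)" "1 \<le> r h" using par by (auto simp: roth_params_def)
        then have "1 / real (r h) \<le> \<omega> / real (r m)" using rm(1) by (simp add: field_simps)
        from mult_right_mono[OF this, of "real (I a h)"] show ?thesis by simp
      next
        case False
        then have "I a h = 0" using Ia[OF ab(1), of h] by (simp add: cm_def cutoff_def)
        then show ?thesis by simp
      qed
      then have "wt M r (I a) \<le> (\<Sum>h<M. \<omega> / real (r m) * real (I a h))"
        unfolding wt_def by (rule sum_mono)
      also have "\<dots> = \<omega> / real (r m) * real (\<Sum>h<M. I a h)" by (simp only: sum_distrib_left of_nat_sum)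
      also have "\<dots> \<le> \<omega> / real (r m) * real (r m)"
      proof (rule mult_left_mono)
        have "(\<Sum>h<M. I a h) \<le> r m" using I(2)[OF ab(1)] k by linarith
        then show "real (\<Sum>h<M. I a h) \<le> real (r m)" by (rule of_nat_mono)
        show "0 \<le> \<omega> / real (r m)" using \<omega>(1) by simp
      qed
      also have "\<dots> = \<omega>" using rm(1) by simp
      finally show ?thesis using \<omega>(4) by linarith
    qed
    ultimately show "max 0 (\<eta> / 2 - real b / real (r m)) \<le> wt M r J" unfolding wt_add by linarith
  qed
  moreover have "real k * \<eta>\<^sup>2 / 32 \<le> (\<Sum>b<k. max 0 (\<eta> / 2 - real b / real (r m)))"
    using \<eta> rm(1) k by (rule sum_truncated_linear_lower_bound)
  moreover have "real k * \<eta>\<^sup>2 > 0" using k1 \<eta>(1) by simp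
  ultimately show False using upper by linarith
qed


text \<open>The points and degrees are quantified inside, so \<omega> is fixed before any
  approximations are chosen.\<close>

definition roth_bound :: "nat \<Rightarrow> nat \<Rightarrow> real \<Rightarrow> real \<Rightarrow> bool" where
  "roth_bound M m \<eta> \<omega> \<longleftrightarrow> (\<forall>r D a q P. roth_params \<omega> D m r a q \<longrightarrow> int_coeffs P \<longrightarrow> P \<noteq> 0 \<longrightarrow> keys P \<subseteq> {..r} \<longrightarrow>
    (\<forall>J. \<bar>lookup P J\<bar> \<le> exp (\<omega> * D)) \<longrightarrow>
    (\<exists>J. lookup (shift M (\<lambda>h. of_int (a h) / of_int (q h)) P) J \<noteq> 0 \<and> wt M r J \<le> \<eta>))"

text \<open>Induction on the number \<open>m\<close> of variables that occur. Since the lower bound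
  for the Wronskian is quadratic in \<eta>, each new variable uses the previous case with
  \<open>\<eta>\<^sup>2 / 128\<close>, and \<omega> is the minimum of what
  \<open>roth_lemma_step\<close> asks for.\<close>

lemma roth_lemma:
  assumes "m \<le> M" "0 < \<eta>"
  shows "\<exists>\<omega>>0. roth_bound M m \<eta> \<omega>"
  using assms
proof (induction m arbitrary: \<eta>)
  case 0
  \<comment> \<open>All degrees are 0, so \<open>P\<close> is a nonzero constant and the exponent 0
    serves.\<close>
  have "lookup (shift M x P) 0 \<noteq> 0" if par: "roth_params 1 D 0 r a q" and P: "P \<noteq> 0" "keys P \<subseteq> {..r}" for x r D a q P
  proof -
    have "r = 0" using par by (auto simp: roth_params_def)
    have z: "K = 0" if "K \<in> keys P" for K
    proof
      fix h
      have "K \<le> r" using that P(2) by auto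
      from le_funD[OF this, of h] show "K h = 0 h" by (simp add: \<open>r = 0\<close>)
    qed
    have "lookup (shift M x P) 0 = (\<Sum>K\<in>keys P. lookup P K)"
      unfolding lookup_shift by (auto dest!: z intro!: sum.cong)
    moreover have "keys P \<noteq> {}" using P(1) poly_mapping_sum_single[of P] by auto
    then have "keys P = {0}" using z by blast
    ultimately have "lookup (shift M x P) 0 = lookup P 0" "0 \<in> keys P" by simp_all
    then show ?thesis by (simp add: in_keys_iff)
  qed
  then have "lookup (shift M x P) 0 \<noteq> 0 \<and> wt M r 0 \<le> \<eta>"
    if "roth_params 1 D 0 r a q" "P \<noteq> 0" "keys P \<subseteq> {..r}" for x r D a q P
    using that \<open>0 < \<eta>\<close> by simp
  then have "\<exists>J. lookup (shift M x P) J \<noteq> 0 \<and> wt M r J \<le> \<eta>"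
    if "roth_params 1 D 0 r a q" "P \<noteq> 0" "keys P \<subseteq> {..r}" for x r D a q P
    using that by (intro exI)
  then show ?case unfolding roth_bound_def by (intro exI[of _ "1::real"]) simp
next
  case (Suc m)
  define \<eta>' where "\<eta>' = min \<eta> 1"
  have \<eta>': "0 < \<eta>'" "\<eta>' \<le> 1" "\<eta>' \<le> \<eta>" using Suc.prems(2) by (auto simp: \<eta>'_def)
  have "0 < \<eta>'\<^sup>2 / 128" using \<eta>'(1) by simp
  with Suc.IH[of "\<eta>'\<^sup>2 / 128"] Suc.prems(1) obtain \<omega>' where \<omega>': "\<omega>' > 0"
    and rb: "roth_bound M m (\<eta>'\<^sup>2 / 128) \<omega>'"
    by auto
  define \<omega> where "\<omega> = min (min (\<omega>' / real (2 * M + 2)) (\<eta>'\<^sup>2 / 128 / real (2 * M + 2))) (\<eta>' / 2)"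
  have M2: "real (2 * M + 2) > 0" by simp
  have \<omega>: "0 < \<omega>" using \<omega>' \<eta>'(1) by (simp add: \<omega>_def)
  have le: "\<omega> \<le> \<omega>' / real (2 * M + 2)" "\<omega> \<le> \<eta>'\<^sup>2 / 128 / real (2 * M + 2)" and \<omega>2: "\<omega> \<le> \<eta>' / 2"
    by (auto simp only: \<omega>_def)
  then have \<omega>1: "real (2 * M + 2) * \<omega> \<le> \<omega>'" "real (2 * M + 2) * \<omega> \<le> \<eta>'\<^sup>2 / 128"
    using M2 by (simp_all only: pos_le_divide_eq mult.commute)
  have "roth_bound M (Suc m) \<eta> \<omega>"
    unfolding roth_bound_def
  proof (intro allI impI)
    fix r D a q P
    assume par: "roth_params \<omega> D (Suc m) r a q" and P: "int_coeffs P" "P \<noteq> 0" "keys P \<subseteq> {..r}" "\<forall>J. \<bar>lookup P J\<bar> \<le> exp (\<omega> * D)"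
    have "m < M" using Suc.prems(1) by simp
    have "\<exists>J. lookup (shift M (\<lambda>h. of_int (a h) / of_int (q h)) P) J \<noteq> 0 \<and> wt M r J \<le> \<eta>'"
    proof (rule roth_lemma_step[OF \<open>m < M\<close> \<eta>'(1,2) _ \<omega> \<omega>1 \<omega>2 par P(1-3)])
      fix r D P
      assume "roth_params \<omega>' D m r a q" "int_coeffs P" "P \<noteq> 0" "keys P \<subseteq> {..r}"
        "\<And>J. \<bar>lookup P J\<bar> \<le> exp (\<omega>' * D)"
      then show "\<exists>J. lookup (shift M (\<lambda>h. of_int (a h) / of_int (q h)) P) J \<noteq> 0 \<and> wt M r J \<le> \<eta>'\<^sup>2 / 128"
        using rb unfolding roth_bound_def by simp
    next
      show "\<bar>lookup P J\<bar> \<le> exp (\<omega> * D)" for J using P(4) by simp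
    qed
    then obtain J where "lookup (shift M (\<lambda>h. of_int (a h) / of_int (q h)) P) J \<noteq> 0" "wt M r J \<le> \<eta>'"
      by auto
    with \<eta>'(3) show "\<exists>J. lookup (shift M (\<lambda>h. of_int (a h) / of_int (q h)) P) J \<noteq> 0 \<and> wt M r J \<le> \<eta>"
      by (intro exI[of _ J]) simp
  qed
  with \<omega> show ?case by auto
qed

section \<open>The auxiliary polynomial\<close>

text \<open>Pigeonhole on vectors with entries in {0..B}, where B = N * C and N = card X. Each
  equation takes at most B * B + 1 values, fewer than (B + 1) ^ 2, and having twice as many unknowns
  as equations leaves fewer value vectors than the (B + 1) ^ N arguments. The difference of two
  colliding vectors is the solution.\<close>

lemma siegel:
  fixes A :: "'e \<Rightarrow> 'v \<Rightarrow> int"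
  assumes fin: "finite E" "finite X" and X: "X \<noteq> {}" and card: "2 * card E \<le> card X"
    and A: "\<And>e x. e \<in> E \<Longrightarrow> x \<in> X \<Longrightarrow> \<bar>A e x\<bar> \<le> int C" and C: "C \<ge> 1"
  shows "\<exists>c. (\<exists>x\<in>X. c x \<noteq> 0) \<and> (\<forall>x. \<bar>c x\<bar> \<le> int (card X * C)) \<and> (\<forall>e\<in>E. (\<Sum>x\<in>X. A e x * c x) = 0)"
proof -
  define N where "N = card X"
  define B where "B = N * C"
  have N: "N \<ge> 1" using fin X by (simp add: N_def Suc_le_eq card_gt_0_iff)
  have B: "B \<ge> 1" using N C by (simp add: B_def Suc_le_eq)
  define F where "F = PiE X (\<lambda>_. {0..int B})"
  define lo where "lo e = (\<Sum>x\<in>X. min 0 (A e x * int B))" for e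
  define hi where "hi e = (\<Sum>x\<in>X. max 0 (A e x * int B))" for e
  define L where "L g = restrict (\<lambda>e. \<Sum>x\<in>X. A e x * g x) E" for g
  have bd: "min 0 (a * b) \<le> a * y \<and> a * y \<le> max 0 (a * b)" if "0 \<le> y" "y \<le> b" for a b y :: int
  proof (cases "a \<ge> 0")
    case True
    then have "0 \<le> a * y" "a * y \<le> a * b" using that by (auto intro: mult_left_mono)
    then show ?thesis by (simp add: min_def max_def)
  next
    case False
    then have "a * y \<le> 0" "a * b \<le> a * y" using that by (auto intro: mult_left_mono_neg simp: mult_nonpos_nonneg)
    then show ?thesis by (simp add: min_def max_def)
  qed
  have "L g \<in> PiE E (\<lambda>e. {lo e..hi e})" if "g \<in> F" for g
  proof -
    have "0 \<le> g x" "g x \<le> int B" if "x \<in> X" for x using \<open>g \<in> F\<close> that by (auto simp: F_def)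
    then have "lo e \<le> (\<Sum>x\<in>X. A e x * g x) \<and> (\<Sum>x\<in>X. A e x * g x) \<le> hi e" for e
      unfolding lo_def hi_def using bd by (intro conjI sum_mono) blast+
    then show ?thesis by (simp add: L_def)
  qed
  then have sub: "L ` F \<subseteq> PiE E (\<lambda>e. {lo e..hi e})" by blast
  have w: "card {lo e..hi e} \<le> B * B + 1" if "e \<in> E" for e
  proof -
    have "hi e - lo e = (\<Sum>x\<in>X. \<bar>A e x\<bar> * int B)"
      unfolding hi_def lo_def sum_subtractf[symmetric]
    proof (rule sum.cong[OF refl])
      fix x
      have "max 0 y - min 0 y = \<bar>y\<bar>" for y :: int by simp
      then show "max 0 (A e x * int B) - min 0 (A e x * int B) = \<bar>A e x\<bar> * int B" by (simp add: abs_mult)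
    qed
    also have "\<dots> \<le> (\<Sum>x\<in>X. int C * int B)" using A that by (intro sum_mono mult_right_mono) auto
    also have "\<dots> = int (B * B)" by (simp add: B_def N_def)
    finally show ?thesis by (simp add: nat_le_iff)
  qed
  have "card (L ` F) \<le> card (PiE E (\<lambda>e. {lo e..hi e}))"
    using fin by (intro card_mono sub finite_PiE) auto
  also have "\<dots> = (\<Prod>e\<in>E. card {lo e..hi e})" using fin by (rule_tac card_PiE)
  also have "\<dots> \<le> (\<Prod>e\<in>E. B * B + 1)" using w by (intro prod_mono) auto
  also have "\<dots> = (B * B + 1) ^ card E" by simp
  also have "\<dots> < (B + 1) ^ N"
  proof (cases "card E = 0")
    case True
    then show ?thesis using one_less_power[of "B + 1" N] N B by simp
  next
    case False
    have "(B * B + 1) ^ card E < ((B + 1) * (B + 1)) ^ card E"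
      using False B by (intro power_strict_mono) auto
    also have "\<dots> = (B + 1) ^ (2 * card E)" by (simp add: power_mult power2_eq_square)
    also have "\<dots> \<le> (B + 1) ^ N" using card by (intro power_increasing) (auto simp: N_def)
    finally show ?thesis .
  qed
  also have "\<dots> = card F" using fin by (simp add: F_def card_PiE N_def nat_add_distrib)
  finally have "\<not> inj_on L F" by (rule pigeonhole)
  then obtain g1 g2 where g: "g1 \<in> F" "g2 \<in> F" "L g1 = L g2" "g1 \<noteq> g2" by (auto simp: inj_on_def)
  define c where "c x = (if x \<in> X then g1 x - g2 x else 0)" for x
  have "\<exists>x\<in>X. c x \<noteq> 0"
  proof (rule ccontr)
    assume "\<not> ?thesis"
    then have "g1 x = g2 x" if "x \<in> X" for x using that by (auto simp: c_def)
    then have "g1 = g2" using g(1,2) unfolding F_def by (intro PiE_ext) auto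
    with g(4) show False by contradiction
  qed
  moreover have "\<bar>c x\<bar> \<le> int (card X * C)" for x
  proof (cases "x \<in> X")
    case True
    then have "0 \<le> g1 x" "g1 x \<le> int B" "0 \<le> g2 x" "g2 x \<le> int B" using g(1,2) by (auto simp: F_def)
    then show ?thesis using True by (simp add: c_def B_def N_def abs_le_iff)
  qed (simp add: c_def)
  moreover have "(\<Sum>x\<in>X. A e x * c x) = 0" if "e \<in> E" for e
  proof -
    have "(\<Sum>x\<in>X. A e x * g1 x) = (\<Sum>x\<in>X. A e x * g2 x)"
      using fun_cong[OF g(3), of e] that by (simp add: L_def)
    then show ?thesis by (simp add: c_def right_diff_distrib sum_subtractf)
  qed
  ultimately show ?thesis by blast
qed

text \<open>High powers of \<alpha> are folded back by its equation; one factor \<open>lc\<close>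
  per step avoids denominators. The geometric bound on \<open>T\<close> keeps the equations given to
  Siegel's lemma exponential in the degrees.\<close>

lemma algebraic_power_reduction:
  fixes \<alpha> :: real
  assumes "algebraic \<alpha>"
  shows "\<exists>d lc C (T :: nat \<Rightarrow> nat \<Rightarrow> int). d \<ge> 1 \<and> lc \<noteq> 0 \<and> C \<ge> 1 \<and>
    (\<forall>n. of_int lc ^ n * \<alpha> ^ n = (\<Sum>l<d. of_int (T n l) * \<alpha> ^ l)) \<and> (\<forall>n l. \<bar>T n l\<bar> \<le> int C ^ n)"
proof -
  obtain p where p: "\<And>i. coeff p i \<in> \<int>" "p \<noteq> 0" "poly p \<alpha> = 0"
    using assms by (auto simp: algebraic_def)
  define c where "c i = \<lfloor>coeff p i\<rfloor>" for i
  have c: "of_int (c i) = coeff p i" for i using p(1)[of i] unfolding c_def by (metis Ints_cases floor_of_int)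
  have "degree p \<noteq> 0"
  proof
    assume "degree p = 0"
    then obtain a where "p = [:a:]" by (rule degree_eq_zeroE)
    with p show False by simp
  qed
  \<comment> \<open>Within this proof \<open>d\<close> is one less than the degree; the number of
    basis powers is \<open>Suc d\<close>.\<close>
  then obtain d where d: "degree p = Suc d" by (metis not0_implies_Suc)
  define lc where "lc = c (Suc d)"
  have lc: "lc \<noteq> 0" using p(2) c[of "Suc d"] d by (metis lc_def leading_coeff_0_iff of_int_0)
  define C where "C = nat (\<bar>lc\<bar> + (\<Sum>l<Suc d. \<bar>c l\<bar>))"
  have C: "int C = \<bar>lc\<bar> + (\<Sum>l<Suc d. \<bar>c l\<bar>)" unfolding C_def by (simp add: sum_nonneg)
  have "(\<Sum>l<Suc d. \<bar>c l\<bar>) \<ge> 0" by (rule sum_nonneg) simp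
  then have C1: "C \<ge> 1" using lc C by linarith
  \<comment> \<open>One step multiplies by lc * \<alpha>: coefficients move up one place and are
    scaled by \<open>lc\<close>, and the top one, now at \<alpha> ^ Suc d, is eliminated through the
    equation of \<alpha>.\<close>
  define T where "T = rec_nat (\<lambda>l. if l = 0 then 1 else 0 :: int)
      (\<lambda>n t l. if l < Suc d then lc * (if l = 0 then 0 else t (l - 1)) - t d * c l else 0)"
  have T0: "T 0 l = (if l = 0 then 1 else 0)" for l by (simp add: T_def)
  have TS: "T (Suc n) l = (if l < Suc d then lc * (if l = 0 then 0 else T n (l - 1)) - T n d * c l else 0)" for n l
    by (simp add: T_def)
  have rel: "of_int lc * \<alpha> ^ Suc d = - (\<Sum>l<Suc d. of_int (c l) * \<alpha> ^ l)"
  proof -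
    have "0 = (\<Sum>l\<le>Suc d. coeff p l * \<alpha> ^ l)" using p(3) by (simp only: poly_altdef d)
    also have "\<dots> = (\<Sum>l<Suc d. of_int (c l) * \<alpha> ^ l) + of_int lc * \<alpha> ^ Suc d"
      by (simp only: lc_def c lessThan_Suc_atMost[symmetric] sum.lessThan_Suc)
    finally show ?thesis by linarith
  qed
  have "of_int lc ^ n * \<alpha> ^ n = (\<Sum>l<Suc d. of_int (T n l) * \<alpha> ^ l)" for n
  proof (induction n)
    case 0
    have "(\<Sum>l<Suc d. of_int (T 0 l) * \<alpha> ^ l) = (\<Sum>l<Suc d. if l = 0 then 1 else 0)"
      by (rule sum.cong) (auto simp: T0)
    then show ?case by simp
  next
    case (Suc n)
    have "of_int lc ^ Suc n * \<alpha> ^ Suc n = of_int lc * \<alpha> * (of_int lc ^ n * \<alpha> ^ n)" by (simp only: power_Suc mult_ac)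
    also have "\<dots> = of_int lc * \<alpha> * (\<Sum>l<d. of_int (T n l) * \<alpha> ^ l) + of_int (T n d) * (of_int lc * \<alpha> ^ Suc d)"
      unfolding Suc by (simp add: algebra_simps)
    also have "of_int lc * \<alpha> * (\<Sum>l<d. of_int (T n l) * \<alpha> ^ l) = (\<Sum>l<d. of_int lc * of_int (T n l) * \<alpha> ^ Suc l)"
      unfolding sum_distrib_left by (rule sum.cong) (simp_all add: mult_ac)
    also have "\<dots> = (\<Sum>l<Suc d. of_int (lc * (if l = 0 then 0 else T n (l - 1))) * \<alpha> ^ l)"
      unfolding sum.lessThan_Suc_shift by simp
    also have "of_int (T n d) * (of_int lc * \<alpha> ^ Suc d) = - (\<Sum>l<Suc d. of_int (T n d * c l) * \<alpha> ^ l)"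
      unfolding rel by (simp add: sum_distrib_left mult.assoc del: sum.lessThan_Suc)
    also have "(\<Sum>l<Suc d. of_int (lc * (if l = 0 then 0 else T n (l - 1))) * \<alpha> ^ l) + - (\<Sum>l<Suc d. of_int (T n d * c l) * \<alpha> ^ l)
       = (\<Sum>l<Suc d. of_int (T (Suc n) l) * \<alpha> ^ l)"
      unfolding add_uminus_conv_diff sum_subtractf[symmetric] left_diff_distrib[symmetric] of_int_diff[symmetric]
      by (rule sum.cong[OF refl]) (simp only: TS lessThan_iff if_True)
    finally show ?case .
  qed
  moreover have "\<bar>T n l\<bar> \<le> int C ^ n" for n l
  proof (induction n arbitrary: l)
    case 0
    then show ?case by (simp add: T0)
  next
    case (Suc n)
    show ?case
    proof (cases "l < Suc d")
      case True
      have "\<bar>c l\<bar> \<le> (\<Sum>l<Suc d. \<bar>c l\<bar>)" using True by (intro member_le_sum) auto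
      then have cl: "\<bar>lc\<bar> + \<bar>c l\<bar> \<le> int C" using C by linarith
      have "\<bar>if l = 0 then 0 else T n (l - 1)\<bar> \<le> int C ^ n" using Suc by simp
      then have 1: "\<bar>lc * (if l = 0 then 0 else T n (l - 1))\<bar> \<le> \<bar>lc\<bar> * int C ^ n"
        unfolding abs_mult by (rule mult_left_mono) simp
      have 2: "\<bar>T n d * c l\<bar> \<le> int C ^ n * \<bar>c l\<bar>"
        unfolding abs_mult using Suc by (intro mult_right_mono) auto
      have "\<bar>T (Suc n) l\<bar> \<le> \<bar>lc\<bar> * int C ^ n + int C ^ n * \<bar>c l\<bar>"
        using 1 2 True by (simp only: TS if_True)
      also have "\<dots> = (\<bar>lc\<bar> + \<bar>c l\<bar>) * int C ^ n" by (simp add: algebra_simps)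
      also have "\<dots> \<le> int C * int C ^ n" using cl by (intro mult_right_mono) auto
      finally show ?thesis by simp
    next
      case False
      then show ?thesis by (simp add: TS)
    qed
  qed
  ultimately show ?thesis using lc C1
    by (intro exI[of _ "Suc d"] exI[of _ lc] exI[of _ C] exI[of _ T]) simp
qed

lemma exp_le_quadratic:
  fixes y :: real
  assumes "\<bar>y\<bar> \<le> 1"
  shows "exp y \<le> 1 + y + y\<^sup>2"
proof (cases "y \<ge> 0")
  case True
  then show ?thesis using assms by (intro exp_bound) auto
next
  case False
  define z where "z = - y"
  have z: "z > 0" using False by (simp add: z_def)
  have "1 \<le> 1 + z ^ 3" using z by simp
  also have "\<dots> = (1 - z + z\<^sup>2) * (1 + z)" by (simp add: algebra_simps power2_eq_square power3_eq_cube)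
  also have "\<dots> \<le> (1 - z + z\<^sup>2) * exp z"
  proof (rule mult_left_mono)
    show "1 + z \<le> exp z" by (rule exp_ge_add_one_self)
    have "z \<le> 1" using assms by (simp add: z_def)
    then show "0 \<le> 1 - z + z\<^sup>2" using zero_le_power2[of z] by linarith
  qed
  finally have "1 \<le> (1 - z + z\<^sup>2) * exp z" .
  then have "exp (- z) \<le> 1 - z + z\<^sup>2" by (simp add: exp_minus field_simps)
  then show ?thesis by (simp add: z_def)
qed

text \<open>A Chernoff bound: for uniformly random \<open>I \<le> r\<close>, the weight is a sum of \<open>M\<close> independent
  variables with mean \<open>1 / 2\<close>.\<close>
lemma card_small_weight:
  fixes r :: "nat \<Rightarrow> nat" and \<delta> :: real
  assumes r: "\<And>h. h \<ge> M \<Longrightarrow> r h = 0" "\<And>h. h < M \<Longrightarrow> r h \<ge> 1" and \<delta>: "0 < \<delta>" "\<delta> \<le> 1"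
  shows "real (card {I. I \<le> r \<and> wt M r I \<le> real M * (1 / 2 - \<delta>)}) \<le> exp (- (real M * \<delta>\<^sup>2)) * real (card {..r})"
proof -
  define S where "S = {I. I \<le> r \<and> wt M r I \<le> real M * (1 / 2 - \<delta>)}"
  \<comment> \<open>The parameter 2 * \<delta> balances two estimates: on \<open>S\<close> the
    product is at least exp (2 * M * \<delta>^2), while each coordinate has average at most exp
    (\<delta>^2), because the linear terms of the exponentials sum to 0.\<close>
  define g where "g h i = exp (2 * \<delta> * (1 / 2 - real i / real (r h)))" for h i
  have fin: "finite {..r}" using r(1) by (rule finite_atMost_fun)
  have S: "S \<subseteq> {..r}" by (auto simp: S_def)
  have prod_g: "(\<Prod>h<M. g h (I h)) = exp (2 * \<delta> * (real M / 2 - wt M r I))" for I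
    by (simp add: g_def wt_def exp_sum[symmetric] sum_distrib_left[symmetric] sum_subtractf)
  have "real (card S) * exp (2 * \<delta> * (real M * \<delta>)) = (\<Sum>I\<in>S. exp (2 * \<delta> * (real M * \<delta>)))" by simp
  also have "\<dots> \<le> (\<Sum>I\<in>S. \<Prod>h<M. g h (I h))"
  proof (rule sum_mono)
    fix I assume "I \<in> S"
    then have "wt M r I \<le> real M * (1 / 2 - \<delta>)" by (simp add: S_def)
    then have "real M * \<delta> \<le> real M / 2 - wt M r I" by (simp add: algebra_simps)
    then have "2 * \<delta> * (real M * \<delta>) \<le> 2 * \<delta> * (real M / 2 - wt M r I)" using \<delta> by (intro mult_left_mono) auto
    then show "exp (2 * \<delta> * (real M * \<delta>)) \<le> (\<Prod>h<M. g h (I h))" unfolding prod_g by simp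
  qed
  also have "\<dots> \<le> (\<Sum>I\<in>{..r}. \<Prod>h<M. g h (I h))"
    using fin S by (intro sum_mono2) (auto simp: g_def intro!: prod_nonneg)
  also have "\<dots> = (\<Prod>h<M. \<Sum>i\<le>r h. g h i)" using r(1) by (rule sum_prod_atMost_fun)
  also have "\<dots> \<le> (\<Prod>h<M. exp (\<delta>\<^sup>2) * real (r h + 1))"
  proof (intro prod_mono conjI)
    fix h assume "h \<in> {..<M}"
    then have rh: "r h \<ge> 1" using r(2) by simp
    define y where "y i = 2 * \<delta> * (1 / 2 - real i / real (r h))" for i
    have y: "\<bar>y i\<bar> \<le> \<delta>" if "i \<le> r h" for i
    proof -
      have "0 \<le> real i / real (r h)" "real i / real (r h) \<le> 1" using that rh by auto
      then have "\<bar>1 / 2 - real i / real (r h)\<bar> \<le> 1 / 2" by linarith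
      then have "2 * \<delta> * \<bar>1 / 2 - real i / real (r h)\<bar> \<le> 2 * \<delta> * (1 / 2)" using \<delta> by (intro mult_left_mono) auto
      then show ?thesis using \<delta> by (simp add: y_def abs_mult)
    qed
    have "(\<Sum>i\<le>r h. real i) = real (r h) * (real (r h) + 1) / 2"
      using gauss_sum_nat[of "r h"] by (simp add: atMost_atLeast0 double_gauss_sum[symmetric] mult.commute)
    then have "(\<Sum>i\<le>r h. real i / real (r h)) = (real (r h) + 1) / 2"
      using rh by (simp add: sum_divide_distrib[symmetric])
    then have sum_y: "(\<Sum>i\<le>r h. y i) = 0"
      by (simp add: y_def sum_distrib_left[symmetric] sum_subtractf)
    have "(\<Sum>i\<le>r h. g h i) \<le> (\<Sum>i\<le>r h. 1 + y i + \<delta>\<^sup>2)"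
    proof (rule sum_mono)
      fix i assume "i \<in> {..r h}"
      then have yi: "\<bar>y i\<bar> \<le> \<delta>" using y by simp
      have "(y i)\<^sup>2 \<le> \<delta>\<^sup>2" using yi by (rule abs_le_square_iff[THEN iffD1, OF order_trans]) (use \<delta> in simp)
      then show "g h i \<le> 1 + y i + \<delta>\<^sup>2"
        using exp_le_quadratic[of "y i"] yi \<delta> by (simp add: g_def y_def)
    qed
    also have "\<dots> = (1 + \<delta>\<^sup>2) * real (r h + 1)" using sum_y by (simp add: sum.distrib algebra_simps)
    also have "\<dots> \<le> exp (\<delta>\<^sup>2) * real (r h + 1)"
      by (intro mult_right_mono exp_ge_add_one_self) simp
    finally show "(\<Sum>i\<le>r h. g h i) \<le> exp (\<delta>\<^sup>2) * real (r h + 1)" .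
    show "0 \<le> (\<Sum>i\<le>r h. g h i)" by (simp add: g_def sum_nonneg)
  qed
  also have "\<dots> = exp (real M * \<delta>\<^sup>2) * real (card {..r})"
    using card_atMost_fun[of M r] r(1) by (simp add: prod.distrib exp_of_nat_mult)
  finally have "real (card S) * exp (2 * \<delta> * (real M * \<delta>)) \<le> exp (real M * \<delta>\<^sup>2) * real (card {..r})" .
  moreover have "exp (2 * \<delta> * (real M * \<delta>)) = exp (real M * \<delta>\<^sup>2) * exp (real M * \<delta>\<^sup>2)"
    by (simp add: exp_add[symmetric] power2_eq_square)
  ultimately have "exp (real M * \<delta>\<^sup>2) * (real (card S) * exp (real M * \<delta>\<^sup>2)) \<le> exp (real M * \<delta>\<^sup>2) * real (card {..r})"
    by (simp only: mult_ac)
  then have "real (card S) * exp (real M * \<delta>\<^sup>2) \<le> real (card {..r})" by simp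
  then show ?thesis unfolding S_def[symmetric] by (simp add: exp_minus field_simps)
qed

text \<open>Vanishing of one Taylor coefficient at \<alpha> follows from \<open>d\<close> integer
  equations, one per basis power. As \<delta> is fixed, enough variables make the exponents of small
  weight rare enough to outweigh \<open>d\<close>. Neither \<open>M\<close> nor \<open>K\<close>
  depends on the degrees.\<close>

lemma exists_auxiliary_polynomial:
  fixes \<alpha> \<delta> :: real
  assumes \<alpha>: "algebraic \<alpha>" and \<delta>: "0 < \<delta>" "\<delta> \<le> 1"
  shows "\<exists>M K. M \<ge> 1 \<and> K \<ge> 0 \<and> (\<forall>r. (\<forall>h\<ge>M. r h = 0) \<longrightarrow> (\<forall>h<M. r h \<ge> 1) \<longrightarrow>
    (\<exists>P. int_coeffs P \<and> P \<noteq> 0 \<and> keys P \<subseteq> {..r} \<and> (\<forall>J. \<bar>lookup P J\<bar> \<le> exp (K * real (\<Sum>h<M. r h))) \<and>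
      (\<forall>I. wt M r I \<le> real M * (1 / 2 - \<delta>) \<longrightarrow> lookup (shift M (\<lambda>_. \<alpha>) P) I = 0)))"
proof -
  obtain d lc C and T :: "nat \<Rightarrow> nat \<Rightarrow> int" where d: "d \<ge> 1" and lc: "lc \<noteq> 0" and C: "C \<ge> 1"
    and rel: "\<And>n. of_int lc ^ n * \<alpha> ^ n = (\<Sum>l<d. of_int (T n l) * \<alpha> ^ l)" and T: "\<And>n l. \<bar>T n l\<bar> \<le> int C ^ n"
    using algebraic_power_reduction[OF \<alpha>] by auto
  \<comment> \<open>Large enough for exp (- M * \<delta>^2) \<le> 1 / (2 * d), so that the equations
    number at most half of the unknowns.\<close>
  define M where "M = nat \<lceil>ln (2 * real d) / \<delta>\<^sup>2\<rceil> + 1"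
  have M1: "M \<ge> 1" by (simp add: M_def)
  have "ln (2 * real d) / \<delta>\<^sup>2 \<le> real M" unfolding M_def by linarith
  then have "ln (2 * real d) \<le> real M * \<delta>\<^sup>2" using \<delta> by (simp add: pos_divide_le_eq)
  then have "exp (- (real M * \<delta>\<^sup>2)) \<le> exp (- ln (2 * real d))" by simp
  also have "\<dots> = 1 / (2 * real d)" using d by (simp add: exp_minus inverse_eq_divide)
  finally have Md: "exp (- (real M * \<delta>\<^sup>2)) \<le> 1 / (2 * real d)" .
  \<comment> \<open>Cost per unit of degree: 2 for the binomials, the absolute value of
    \<open>lc\<close> for clearing denominators, \<open>C\<close> for reducing powers of \<alpha>.
    The extra 2 in \<open>K\<close> pays for the number of unknowns.\<close>
  define B where "B = 2 * nat \<bar>lc\<bar> * C"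
  have B1: "B \<ge> 1" using lc C by (simp add: B_def)
  define K where "K = ln (2 * real B)"
  have K0: "K \<ge> 0" using B1 by (simp add: K_def)
  have "\<exists>P. int_coeffs P \<and> P \<noteq> 0 \<and> keys P \<subseteq> {..r} \<and> (\<forall>J. \<bar>lookup P J\<bar> \<le> exp (K * real (\<Sum>h<M. r h))) \<and>
      (\<forall>I. wt M r I \<le> real M * (1 / 2 - \<delta>) \<longrightarrow> lookup (shift M (\<lambda>_. \<alpha>) P) I = 0)"
    if r: "\<forall>h\<ge>M. r h = 0" "\<forall>h<M. r h \<ge> 1" for r
  proof -
    define s where "s = (\<Sum>h<M. r h)"
    define S where "S = {I. I \<le> r \<and> wt M r I \<le> real M * (1 / 2 - \<delta>)}"
    define tot where "tot J I = (\<Sum>h<M. J h - I h)" for J I :: "nat \<Rightarrow> nat"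
    \<comment> \<open>For e = (I, l): the contribution of the unknown c J to \<alpha> ^ l in lc ^ s
      times the Taylor coefficient at \<open>I\<close>. Truncation in \<open>tot\<close> does no
      harm, since \<open>mbinom\<close> is 0 unless I h \<le> J h for all h < M.\<close>
    define A where "A e J = int (mbinom M J (fst e)) * lc ^ (s - tot J (fst e)) * T (tot J (fst e)) (snd e)"
      for e :: "(nat \<Rightarrow> nat) \<times> nat" and J
    have fin: "finite {..r}" using r(1) by (intro finite_atMost_fun[of M]) auto
    have S: "S \<subseteq> {..r}" by (auto simp: S_def)
    have finS: "finite S" using S fin by (rule finite_subset)
    have tot: "tot J I \<le> s" if "J \<le> r" for J I
      unfolding tot_def s_def
    proof (rule sum_mono)
      fix h show "J h - I h \<le> r h" using le_funD[OF that, of h] by linarith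
    qed
    have "real (card S) \<le> exp (- (real M * \<delta>\<^sup>2)) * real (card {..r})"
      unfolding S_def using r \<delta> by (intro card_small_weight) auto
    also have "\<dots> \<le> 1 / (2 * real d) * real (card {..r})" using Md by (intro mult_right_mono) auto
    finally have "2 * (real (card S) * real d) \<le> real (card {..r})" using d by (simp add: field_simps)
    then have "real (2 * (card S * d)) \<le> real (card {..r})" by simp
    then have "2 * (card S * d) \<le> card {..r}" by (simp only: of_nat_le_iff)
    then have card: "2 * card (S \<times> {..<d}) \<le> card {..r}" by (simp add: card_cartesian_product)
    have A: "\<bar>A e J\<bar> \<le> int (B ^ s)" if "J \<in> {..r}" for e J
    proof -
      have J: "J \<le> r" using that by simp
      have "mbinom M J (fst e) \<le> 2 ^ s" unfolding s_def using J by (rule mbinom_le)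
      then have "int (mbinom M J (fst e)) \<le> int (2 ^ s)" by (rule of_nat_mono)
      then have 1: "\<bar>int (mbinom M J (fst e))\<bar> \<le> 2 ^ s" by simp
      have "1 \<le> \<bar>lc\<bar>" using lc by simp
      then have 2: "\<bar>lc ^ (s - tot J (fst e))\<bar> \<le> \<bar>lc\<bar> ^ s" unfolding power_abs by (intro power_increasing) auto
      have "\<bar>T (tot J (fst e)) (snd e)\<bar> \<le> int C ^ tot J (fst e)" by (rule T)
      also have "\<dots> \<le> int C ^ s" using C tot[OF J] by (intro power_increasing) auto
      finally have 3: "\<bar>T (tot J (fst e)) (snd e)\<bar> \<le> int C ^ s" .
      have "\<bar>A e J\<bar> \<le> 2 ^ s * \<bar>lc\<bar> ^ s * int C ^ s"
        unfolding A_def abs_mult by (intro mult_mono 1 2 3) auto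
      also have "\<dots> = int (B ^ s)" by (simp add: B_def power_mult_distrib)
      finally show ?thesis .
    qed
    have "\<exists>c. (\<exists>J\<in>{..r}. c J \<noteq> 0) \<and> (\<forall>J. \<bar>c J\<bar> \<le> int (card {..r} * B ^ s)) \<and>
        (\<forall>e\<in>S \<times> {..<d}. (\<Sum>J\<in>{..r}. A e J * c J) = 0)"
    proof (rule siegel)
      show "finite (S \<times> {..<d})" using finS by simp
      show "{..r} \<noteq> {}" by auto
      show "B ^ s \<ge> 1" using B1 by simp
      show "\<bar>A e J\<bar> \<le> int (B ^ s)" if "J \<in> {..r}" for e J using that by (rule A)
    qed (fact fin card)+
    then obtain c where c: "\<exists>J\<in>{..r}. c J \<noteq> 0" "\<And>J. \<bar>c J\<bar> \<le> int (card {..r} * B ^ s)"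
      and c0: "\<And>e. e \<in> S \<times> {..<d} \<Longrightarrow> (\<Sum>J\<in>{..r}. A e J * c J) = 0"
      by blast
    define P where "P = (\<Sum>J\<in>{..r}. mterm J (real_of_int (c J)))"
    have lookup_P: "lookup P J = (if J \<le> r then real_of_int (c J) else 0)" for J
      using fin by (simp add: P_def lookup_sum lookup_single when_def)
    have keys_P: "keys P \<subseteq> {..r}" by (auto simp: in_keys_iff lookup_P split: if_splits)
    have "int_coeffs P" by (simp add: int_coeffs_def lookup_P)
    moreover have "P \<noteq> 0"
    proof
      assume "P = 0"
      obtain J where J: "J \<le> r" "c J \<noteq> 0" using c(1) by auto
      then have "lookup P J \<noteq> 0" by (simp add: lookup_P)
      with \<open>P = 0\<close> show False by simp
    qed
    moreover have "\<bar>lookup P J\<bar> \<le> exp (K * real (\<Sum>h<M. r h))" for J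
    proof -
      have "\<bar>lookup P J\<bar> \<le> real_of_int \<bar>c J\<bar>" by (simp add: lookup_P)
      also have "\<dots> \<le> real_of_int (int (card {..r} * B ^ s))" using c(2) by (simp only: of_int_le_iff)
      also have "\<dots> = real (card {..r}) * real B ^ s" by simp
      also have "\<dots> \<le> 2 ^ s * real B ^ s"
      proof (rule mult_right_mono)
        have "card {..r} \<le> 2 ^ s" unfolding s_def using r(1) by (intro card_atMost_fun_le) auto
        then have "real (card {..r}) \<le> real (2 ^ s)" by (rule of_nat_mono)
        then show "real (card {..r}) \<le> 2 ^ s" by simp
      qed simp
      also have "\<dots> = (2 * real B) ^ s" by (simp add: power_mult_distrib)
      also have "\<dots> = exp (K * real s)"
        using B1 exp_of_nat_mult[of s K] by (simp add: K_def mult.commute)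
      finally show ?thesis unfolding s_def .
    qed
    moreover have "lookup (shift M (\<lambda>_. \<alpha>) P) I = 0" if I: "wt M r I \<le> real M * (1 / 2 - \<delta>)" for I
    proof (cases "I \<le> r")
      case False
      then show ?thesis using keys_shift_le[OF keys_P, of M "\<lambda>_. \<alpha>"] by (auto simp: in_keys_iff)
    next
      case True
      with I have IS: "I \<in> S" by (simp add: S_def)
      have I0: "\<forall>h\<ge>M. I h = 0"
      proof (intro allI impI)
        fix h assume "h \<ge> M"
        with r(1) le_funD[OF True, of h] show "I h = 0" by simp
      qed
      have "(\<Sum>J\<in>keys P. lookup P J * (\<Prod>h<M. real (J h choose I h) * \<alpha> ^ (J h - I h)))
          = (\<Sum>J\<in>{..r}. lookup P J * (\<Prod>h<M. real (J h choose I h) * \<alpha> ^ (J h - I h)))"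
        using fin keys_P by (intro sum.mono_neutral_left) (auto simp: in_keys_iff)
      also have "\<dots> = (\<Sum>J\<in>{..r}. real_of_int (c J) * (real (mbinom M J I) * \<alpha> ^ tot J I))"
        by (rule sum.cong) (simp_all add: lookup_P prod.distrib mbinom_def tot_def power_sum)
      finally have v: "lookup (shift M (\<lambda>_. \<alpha>) P) I = (\<Sum>J\<in>{..r}. real_of_int (c J) * (real (mbinom M J I) * \<alpha> ^ tot J I))"
        using I0 by (simp add: lookup_shift)
      have "of_int lc ^ s * lookup (shift M (\<lambda>_. \<alpha>) P) I = (\<Sum>J\<in>{..r}. \<Sum>l<d. of_int (A (I, l) J * c J) * \<alpha> ^ l)"
        unfolding v sum_distrib_left
      proof (rule sum.cong[OF refl])
        fix J assume "J \<in> {..r}"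
        then have "of_int lc ^ s = of_int lc ^ (s - tot J I) * (of_int lc :: real) ^ tot J I"
          using tot[of J I] by (simp add: power_add[symmetric])
        then have "of_int lc ^ s * (real_of_int (c J) * (real (mbinom M J I) * \<alpha> ^ tot J I))
          = real_of_int (c J) * real (mbinom M J I) * of_int lc ^ (s - tot J I) * (of_int lc ^ tot J I * \<alpha> ^ tot J I)"
          by (simp only: mult_ac)
        also have "\<dots> = (\<Sum>l<d. of_int (A (I, l) J * c J) * \<alpha> ^ l)"
          unfolding rel sum_distrib_left by (rule sum.cong) (simp_all add: A_def mult_ac)
        finally show "of_int lc ^ s * (real_of_int (c J) * (real (mbinom M J I) * \<alpha> ^ tot J I))
          = (\<Sum>l<d. of_int (A (I, l) J * c J) * \<alpha> ^ l)" .
      qed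
      also have "\<dots> = (\<Sum>l<d. \<Sum>J\<in>{..r}. of_int (A (I, l) J * c J) * \<alpha> ^ l)" by (rule sum.swap)
      also have "\<dots> = (\<Sum>l<d. of_int (\<Sum>J\<in>{..r}. A (I, l) J * c J) * \<alpha> ^ l)"
        by (simp only: of_int_sum sum_distrib_right)
      also have "\<dots> = 0" using c0 IS by (intro sum.neutral) auto
      finally show ?thesis using lc by simp
    qed
    ultimately show ?thesis using keys_P by blast
  qed
  with M1 K0 show ?thesis by blast
qed

section \<open>Roth's theorem\<close>

lemma len_power: "len (P ^ n) \<le> len P ^ n"
  by (induction n) (auto intro: order_trans[OF len_mult mult_left_mono])

lemma len_shift:
  assumes "keys P \<subseteq> {..r}"
  shows "len (shift M (\<lambda>_. c) P) \<le> (1 + \<bar>c\<bar>) ^ (\<Sum>h<M. r h) * len P"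
proof -
  have lin: "len (mvar h + mconst c) \<le> 1 + \<bar>c\<bar>" for h
    using len_add[of "mvar h" "mconst c"] by (simp add: mvar_def mconst_def len_mterm)
  have "len (mconst (lookup P K) * (\<Prod>h<M. (mvar h + mconst c) ^ K h)) \<le> (1 + \<bar>c\<bar>) ^ (\<Sum>h<M. r h) * \<bar>lookup P K\<bar>"
    if "K \<in> keys P" for K
  proof -
    have "K \<le> r" using that assms by auto
    then have le: "(\<Sum>h<M. K h) \<le> (\<Sum>h<M. r h)" by (intro sum_mono) (simp add: le_fun_def)
    have "len (\<Prod>h<M. (mvar h + mconst c) ^ K h) \<le> (\<Prod>h<M. len ((mvar h + mconst c) ^ K h))" by (rule len_prod)
    also have "\<dots> \<le> (\<Prod>h<M. (1 + \<bar>c\<bar>) ^ K h)"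
      by (intro prod_mono conjI order_trans[OF len_power] power_mono lin) auto
    also have "\<dots> = (1 + \<bar>c\<bar>) ^ (\<Sum>h<M. K h)" by (rule power_sum[symmetric])
    also have "\<dots> \<le> (1 + \<bar>c\<bar>) ^ (\<Sum>h<M. r h)" using le by (intro power_increasing) auto
    finally have "\<bar>lookup P K\<bar> * len (\<Prod>h<M. (mvar h + mconst c) ^ K h) \<le> \<bar>lookup P K\<bar> * (1 + \<bar>c\<bar>) ^ (\<Sum>h<M. r h)"
      by (rule mult_left_mono) simp
    moreover have "len (mconst (lookup P K) * (\<Prod>h<M. (mvar h + mconst c) ^ K h))
        \<le> \<bar>lookup P K\<bar> * len (\<Prod>h<M. (mvar h + mconst c) ^ K h)"
      using len_mult[of "mconst (lookup P K)"] by (simp add: mconst_def len_mterm)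
    ultimately show ?thesis by (simp only: mult.commute)
  qed
  then have "(\<Sum>K\<in>keys P. len (mconst (lookup P K) * (\<Prod>h<M. (mvar h + mconst c) ^ K h)))
      \<le> (\<Sum>K\<in>keys P. (1 + \<bar>c\<bar>) ^ (\<Sum>h<M. r h) * \<bar>lookup P K\<bar>)" by (rule sum_mono)
  then show ?thesis
    unfolding shift_def msub_def len_def[of P] sum_distrib_left by (rule order_trans[OF len_sum])
qed

text \<open>Liouville's argument: a nonzero rational is at least the reciprocal of its denominator.\<close>
lemma abs_lookup_shift_ge:
  assumes P: "int_coeffs P" "keys P \<subseteq> {..r}" and q: "\<And>h. h < M \<Longrightarrow> q h > 0"
    and nz: "lookup (shift M (\<lambda>h. of_int (a h) / of_int (q h)) P) J \<noteq> 0"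
  shows "1 \<le> \<bar>lookup (shift M (\<lambda>h. of_int (a h) / of_int (q h)) P) J\<bar> * (\<Prod>h<M. of_int (q h) ^ r h)"
proof -
  define v where "v = lookup (shift M (\<lambda>h. of_int (a h) / of_int (q h)) P) J"
  define Q where "Q = (\<Prod>h<M. real_of_int (q h) ^ r h)"
  have Q: "Q > 0" unfolding Q_def using q by (intro prod_pos) auto
  have v: "v = (\<Sum>K\<in>keys P. lookup P K * (\<Prod>h<M. real (K h choose J h) * (of_int (a h) / of_int (q h)) ^ (K h - J h)))"
    using nz unfolding v_def lookup_shift by (simp split: if_splits)
  have "v * Q = (\<Sum>K\<in>keys P. lookup P K * (\<Prod>h<M. real (K h choose J h) * (of_int (a h) / of_int (q h)) ^ (K h - J h) * of_int (q h) ^ r h))"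
    unfolding v Q_def sum_distrib_right by (simp only: prod.distrib mult.assoc)
  also have "\<dots> \<in> \<int>"
  proof (rule Ints_sum, rule Ints_mult, goal_cases)
    case (1 K)
    then show ?case using P(1) by (simp add: int_coeffs_def)
  next
    case (2 K)
    then have K: "K \<in> keys P" .
    show ?case
    proof (rule Ints_prod)
      fix h assume h: "h \<in> {..<M}"
      have "K \<le> r" using K P(2) by auto
      from le_funD[OF this, of h] have e: "r h = (K h - J h) + (r h - (K h - J h))" by simp
      have "q h > 0" using q h by simp
      then have "(of_int (a h) / of_int (q h)) ^ (K h - J h) * of_int (q h) ^ r h
          = of_int (a h) ^ (K h - J h) * (of_int (q h) :: real) ^ (r h - (K h - J h))"
        by (subst e, subst power_add) (simp add: power_divide)
      then have "real (K h choose J h) * (of_int (a h) / of_int (q h)) ^ (K h - J h) * of_int (q h) ^ r h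
          = of_int (int (K h choose J h) * a h ^ (K h - J h) * q h ^ (r h - (K h - J h)))"
        by (simp add: mult.assoc)
      then show "real (K h choose J h) * (of_int (a h) / of_int (q h)) ^ (K h - J h) * of_int (q h) ^ r h \<in> \<int>"
        by (simp only: Ints_of_int)
    qed
  qed
  finally have "v * Q \<in> \<int>" .
  moreover have "v * Q \<noteq> 0" using nz Q unfolding v_def by simp
  ultimately have "1 \<le> \<bar>v * Q\<bar>" by (rule Ints_nonzero_abs_ge1)
  then show ?thesis using Q unfolding v_def Q_def by (simp add: abs_mult)
qed

text \<open>The coefficient is the value at \<open>x\<close> of a derivative of \<open>P\<close>,
  which is expanded about \<alpha>. Only exponents of weight at least \<tau> remain, and since D
  \<le> r h * ln (Q h), closeness of \<open>x h\<close> to \<alpha> turns weight into a factor exp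
  (- \<kappa> * D * \<tau>).\<close>

lemma abs_lookup_shift_le:
  fixes \<alpha> :: real
  assumes P: "keys P \<subseteq> {..r}" and r: "\<And>h. h \<ge> M \<Longrightarrow> r h = 0" and I: "I \<le> r"
    and van: "\<And>J. wt M r J \<le> \<tau> + wt M r I \<Longrightarrow> lookup (shift M (\<lambda>_. \<alpha>) P) J = 0"
    and q: "\<And>h. h < M \<Longrightarrow> 1 \<le> r h \<and> D \<le> real (r h) * ln (Q h) \<and> Q h > 0 \<and> \<bar>x h - \<alpha>\<bar> \<le> exp (- (\<kappa> * ln (Q h)))"
    and \<kappa>: "\<kappa> \<ge> 0" and D: "D \<ge> 0"
  shows "\<bar>lookup (shift M x P) I\<bar> \<le> (1 + \<bar>\<alpha>\<bar>) ^ (\<Sum>h<M. r h) * (2 ^ (\<Sum>h<M. r h) * len P) * exp (- (\<kappa> * D * \<tau>))"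
proof -
  have I0: "I h = 0" if "h \<ge> M" for h using le_funD[OF I, of h] r[OF that] by simp
  define G where "G = shift M (\<lambda>_. \<alpha>) (hasse M I P)"
  have "lookup (shift M x P) I = msub (\<lambda>a. a) M x (hasse M I P)"
    using I0 by (rule msub_hasse[symmetric])
  also have "\<dots> = msub (\<lambda>a. a) M (\<lambda>h. x h - \<alpha>) G"
    unfolding G_def coeff_hom.msub_shift[OF coeff_hom_ident] by simp
  finally have eq: "lookup (shift M x P) I = (\<Sum>L\<in>keys G. lookup G L * (\<Prod>h<M. (x h - \<alpha>) ^ L h))"
    by (simp only: msub_def)
  have "\<bar>\<Prod>h<M. (x h - \<alpha>) ^ L h\<bar> \<le> exp (- (\<kappa> * D * \<tau>))" if L: "L \<in> keys G" for L
  proof -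
    have "lookup G L \<noteq> 0" using L by (simp add: in_keys_iff)
    then have "lookup (shift M (\<lambda>_. \<alpha>) P) (I + L) \<noteq> 0"
      unfolding G_def using lookup_shift_hasse[of M I "\<lambda>_. \<alpha>" P L] I0 by auto
    with van have "\<tau> + wt M r I < wt M r (I + L)" by (meson not_le)
    then have \<tau>: "\<tau> \<le> wt M r L" unfolding wt_add by linarith
    have "\<bar>\<Prod>h<M. (x h - \<alpha>) ^ L h\<bar> = (\<Prod>h<M. \<bar>x h - \<alpha>\<bar> ^ L h)" by (simp add: abs_prod power_abs)
    also have "\<dots> \<le> (\<Prod>h<M. exp (- (\<kappa> * D * (real (L h) / real (r h)))))"
    proof (intro prod_mono conjI)
      fix h assume "h \<in> {..<M}"
      then have h: "1 \<le> r h" "D \<le> real (r h) * ln (Q h)" "\<bar>x h - \<alpha>\<bar> \<le> exp (- (\<kappa> * ln (Q h)))" using q by auto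
      have "\<bar>x h - \<alpha>\<bar> ^ L h \<le> exp (- (\<kappa> * ln (Q h))) ^ L h" using h(3) by (intro power_mono) auto
      also have "\<dots> = exp (- (\<kappa> * (real (L h) * ln (Q h))))" by (simp add: exp_of_nat_mult[symmetric] mult_ac)
      also have "\<dots> \<le> exp (- (\<kappa> * D * (real (L h) / real (r h))))"
      proof -
        have "D / real (r h) \<le> ln (Q h)" using h(1,2) by (simp add: divide_le_eq mult.commute)
        then have "real (L h) * (D / real (r h)) \<le> real (L h) * ln (Q h)" by (rule mult_left_mono) simp
        from mult_left_mono[OF this \<kappa>] show ?thesis by (simp add: mult_ac)
      qed
      finally show "\<bar>x h - \<alpha>\<bar> ^ L h \<le> exp (- (\<kappa> * D * (real (L h) / real (r h))))" .
    qed simp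
    also have "\<dots> = exp (- (\<kappa> * D * wt M r L))"
      by (simp add: exp_sum[symmetric] wt_def sum_negf sum_distrib_left)
    also have "\<dots> \<le> exp (- (\<kappa> * D * \<tau>))" using \<tau> \<kappa> D by (simp add: mult_left_mono)
    finally show ?thesis .
  qed
  then have "\<bar>lookup (shift M x P) I\<bar> \<le> (\<Sum>L\<in>keys G. \<bar>lookup G L\<bar> * exp (- (\<kappa> * D * \<tau>)))"
    unfolding eq by (intro order_trans[OF sum_abs] sum_mono) (simp add: abs_mult mult_left_mono)
  also have "\<dots> = len G * exp (- (\<kappa> * D * \<tau>))" by (simp only: len_def sum_distrib_right)
  also have "len G \<le> (1 + \<bar>\<alpha>\<bar>) ^ (\<Sum>h<M. r h) * len (hasse M I P)"
    unfolding G_def using keys_hasse_le[OF P] by (rule len_shift)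
  also have "(1 + \<bar>\<alpha>\<bar>) ^ (\<Sum>h<M. r h) * len (hasse M I P) \<le> (1 + \<bar>\<alpha>\<bar>) ^ (\<Sum>h<M. r h) * (2 ^ (\<Sum>h<M. r h) * len P)"
    using P by (intro mult_left_mono len_hasse) auto
  finally show ?thesis by (simp add: mult_right_mono)
qed

text \<open>Denominators are chosen greedily, each large compared with the preceding one. Growth by
  2 / w rather than 1 / w compensates for rounding the degrees up later.\<close>

lemma exists_rapid_sequence:
  fixes good :: "int \<Rightarrow> int \<Rightarrow> bool" and w :: real
  assumes w: "0 < w" "w \<le> 1" and good: "\<And>Q0. \<exists>a q. good a q \<and> q > Q0"
  shows "\<exists>(a :: nat \<Rightarrow> int) (q :: nat \<Rightarrow> int). (\<forall>n. good (a n) (q n) \<and> q n > 0 \<and> 2 / w \<le> ln (of_int (q n))) \<and>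
    (\<forall>h i. h < i \<longrightarrow> 2 / w * ln (of_int (q h)) \<le> ln (of_int (q i)))"
proof -
  have step: "\<exists>z. good (fst z) (snd z) \<and> snd z > 0 \<and> L \<le> ln (of_int (snd z))" for L :: real
  proof -
    from good[of "\<lceil>exp L\<rceil>"] obtain a q where aq: "good a q" "q > \<lceil>exp L\<rceil>" by auto
    then have "exp L < of_int q" by linarith
    moreover from this have "0 < (of_int q :: real)" using exp_gt_zero[of L] by linarith
    ultimately have "q > 0" "L \<le> ln (of_int q)" by (simp_all add: ln_ge_iff)
    with aq(1) show ?thesis by (intro exI[of _ "(a, q)"]) simp
  qed
  have "\<exists>f. \<forall>n. (good (fst (f n)) (snd (f n)) \<and> snd (f n) > 0 \<and> 2 / w \<le> ln (of_int (snd (f n)))) \<and>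
      2 / w * ln (of_int (snd (f n))) \<le> ln (of_int (snd (f (Suc n))))"
  proof (rule dependent_nat_choice[where
        P = "\<lambda>_ z. good (fst z) (snd z) \<and> snd z > 0 \<and> 2 / w \<le> ln (of_int (snd z))" and
        Q = "\<lambda>_ z y. 2 / w * ln (of_int (snd z)) \<le> ln (of_int (snd y))"])
    show "\<exists>z. good (fst z) (snd z) \<and> snd z > 0 \<and> 2 / w \<le> ln (of_int (snd z))" by (rule step)
    fix z :: "int \<times> int" and n :: nat
    obtain y where "good (fst y) (snd y) \<and> snd y > 0 \<and> max (2 / w) (2 / w * ln (of_int (snd z))) \<le> ln (of_int (snd y))"
      using step[of "max (2 / w) (2 / w * ln (of_int (snd z)))"] by (rule exE)
    then show "\<exists>y. (good (fst y) (snd y) \<and> snd y > 0 \<and> 2 / w \<le> ln (of_int (snd y))) \<and>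
        2 / w * ln (of_int (snd z)) \<le> ln (of_int (snd y))"
      by (intro exI[of _ y]) simp
  qed
  then obtain f :: "nat \<Rightarrow> int \<times> int" where ff: "\<forall>n. (good (fst (f n)) (snd (f n)) \<and> snd (f n) > 0 \<and>
      2 / w \<le> ln (of_int (snd (f n)))) \<and> 2 / w * ln (of_int (snd (f n))) \<le> ln (of_int (snd (f (Suc n))))"
    by (rule exE)
  have f: "good (fst (f n)) (snd (f n)) \<and> snd (f n) > 0 \<and> 2 / w \<le> ln (of_int (snd (f n)))" for n
    using conjunct1[OF spec[OF ff, of n]] .
  have mul: "2 / w * ln (of_int (snd (f n))) \<le> ln (of_int (snd (f (Suc n))))" for n
    using conjunct2[OF spec[OF ff, of n]] .
  define l where "l n = ln (real_of_int (snd (f n)))" for n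
  have w2: "2 / w \<ge> 1" using w by (simp add: field_simps)
  have lpos: "l n \<ge> 0" for n using f[of n] w2 unfolding l_def by linarith
  have l_Suc: "l n \<le> l (Suc n)" for n
  proof -
    have "1 * l n \<le> 2 / w * l n" using w2 lpos[of n] by (intro mult_right_mono) auto
    also have "\<dots> \<le> l (Suc n)" using mul[of n] by (simp only: l_def)
    finally show ?thesis by simp
  qed
  have "2 / w * l h \<le> l i" if "h < i" for h i
  proof -
    have "2 / w * l h \<le> l (Suc h)" using mul[of h] by (simp only: l_def)
    also have "\<dots> \<le> l i" using l_Suc Suc_leI[OF that] by (rule lift_Suc_mono_le)
    finally show ?thesis .
  qed
  then have "\<forall>h i. h < i \<longrightarrow> 2 / w * ln (of_int (snd (f h))) \<le> ln (of_int (snd (f i)))"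
    unfolding l_def by simp
  with f show ?thesis
    by (rule_tac exI[of _ "\<lambda>n. fst (f n)"], rule_tac exI[of _ "\<lambda>n. snd (f n)"]) simp
qed

theorem roth:
  fixes \<alpha> \<epsilon> :: real
  assumes \<alpha>: "algebraic \<alpha>" and \<epsilon>: "\<epsilon> > 0"
  shows "\<exists>Q0. \<forall>a q. coprime a q \<longrightarrow> q > Q0 \<longrightarrow> of_int q powr (- (2 + \<epsilon>)) \<le> \<bar>of_int a / of_int q - \<alpha>\<bar>"
proof (rule ccontr)
  assume contr: "\<not> ?thesis"
  define good where "good a q \<longleftrightarrow> coprime a q \<and> \<bar>of_int a / of_int q - \<alpha>\<bar> < of_int q powr (- (2 + \<epsilon>))" for a q :: int
  have good: "\<exists>a q. good a q \<and> q > Q0" for Q0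
    using contr unfolding good_def by (meson not_le)
  \<comment> \<open>A smaller exponent only weakens the approximation hypothesis, and e \<le> 1
    allows e * e to be bounded by e.\<close>
  define e where "e = min \<epsilon> 1"
  have e: "0 < e" "e \<le> 1" "e \<le> \<epsilon>" using \<epsilon> by (auto simp: e_def)
  \<comment> \<open>With this deficit, (2 + e) * (1/2 - e/12) \<ge> 1 + e/4. Heights and rounding
    will use at most 1 + e/8 per variable, and the index e/100 left by Roth's lemma costs at most 3
    * e/100 in total, less than the remaining e/8.\<close>
  have "0 < e / 12" "e / 12 \<le> 1" using e by auto
  from exists_auxiliary_polynomial[OF \<alpha> this] obtain M K where M: "M \<ge> 1" and K: "K \<ge> 0"
    and aux: "\<And>r. \<forall>h\<ge>M. r h = 0 \<Longrightarrow> \<forall>h<M. r h \<ge> 1 \<Longrightarrow>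
      \<exists>P. int_coeffs P \<and> P \<noteq> 0 \<and> keys P \<subseteq> {..r} \<and> (\<forall>J. \<bar>lookup P J\<bar> \<le> exp (K * real (\<Sum>h<M. r h))) \<and>
      (\<forall>I. wt M r I \<le> real M * (1 / 2 - e / 12) \<longrightarrow> lookup (shift M (\<lambda>_. \<alpha>) P) I = 0)"
    by auto
  have "0 < e / 100" using e by simp
  from roth_lemma[OF order_refl this] obtain \<omega> where \<omega>: "\<omega> > 0" and rb: "roth_bound M M (e / 100) \<omega>" by blast
  \<comment> \<open>Logarithmic cost per unit of degree in the upper bound: translation by \<alpha>,
    derivatives and number of coefficients (ln 2 each), and the height of \<open>P\<close>.\<close>
  define K2 where "K2 = ln (1 + \<bar>\<alpha>\<bar>) + 2 * ln 2 + K"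
  have K2: "K2 \<ge> 0" using K by (simp add: K2_def)
  have KM: "K * real M + 1 > 0" "8 * (1 + K2) > 0" using K K2 by (simp_all add: add_nonneg_pos)
  \<comment> \<open>One parameter meets three demands: the hypotheses of Roth's lemma (w \<le>
    \<omega>), its height bound for \<open>P\<close> (K * M * w \<le> \<omega>), and the final
    comparison (8 * w * (1 + K2) \<le> e).\<close>
  define w where "w = min (min 1 \<omega>) (min (\<omega> / (K * real M + 1)) (e / (8 * (1 + K2))))"
  have w: "0 < w" using \<omega> e KM by (simp add: w_def)
  have w1: "w \<le> 1" "w \<le> \<omega>" "w \<le> \<omega> / (K * real M + 1)" "w \<le> e / (8 * (1 + K2))"
    by (auto simp only: w_def)
  have wK: "K * real M * w \<le> \<omega>"
  proof -
    have "w * (K * real M + 1) \<le> \<omega>" using w1(3) KM by (simp only: pos_le_divide_eq)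
    then show ?thesis using w by (simp add: algebra_simps)
  qed
  have wK2: "8 * (w * (1 + K2)) \<le> e"
  proof -
    have "w * (8 * (1 + K2)) \<le> e" using w1(4) KM by (simp only: pos_le_divide_eq)
    then show ?thesis by (simp add: algebra_simps)
  qed
  obtain a q :: "nat \<Rightarrow> int" where gd: "\<And>n. good (a n) (q n)" and q0: "\<And>n. q n > 0" and q1: "\<And>n. 2 / w \<le> ln (of_int (q n))"
    and q2: "\<And>h i. h < i \<Longrightarrow> 2 / w * ln (of_int (q h)) \<le> ln (of_int (q i))"
    using exists_rapid_sequence[of w good] w w1(1) good by blast
  define l where "l h = ln (real_of_int (q h))" for h
  have l0: "l h > 0" for h
  proof -
    have "0 < 2 / w" using w by simp
    also have "\<dots> \<le> l h" unfolding l_def by (rule q1)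
    finally show ?thesis .
  qed
  \<comment> \<open>So large that every \<open>l h\<close> is at most w * D: rounding a degree up
    then changes r h * l h by at most the fraction \<open>w\<close> of \<open>D\<close>.\<close>
  define D where "D = 1 + (\<Sum>h<M. l h) / w"
  have D1: "D \<ge> 1" using l0 w by (simp add: D_def sum_nonneg less_imp_le)
  have lD: "l h \<le> w * D" if "h < M" for h
  proof -
    have "l h \<le> (\<Sum>h<M. l h)" using that l0 by (intro member_le_sum) (auto intro: less_imp_le)
    also have "\<dots> \<le> w * D" using w by (simp add: D_def algebra_simps)
    finally show ?thesis .
  qed
  \<comment> \<open>For h < M, the least degree with q h ^ r h \<ge> exp D.\<close>
  define r where "r h = (if h < M then nat \<lceil>D / l h\<rceil> else 0)" for h
  have r0: "r h = 0" if "h \<ge> M" for h using that by (simp add: r_def)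
  have rD: "1 \<le> r h" "D \<le> real (r h) * l h" "real (r h) * l h \<le> (1 + w) * D" "real (r h) \<le> 2 * D / l h" if "h < M" for h
  proof -
    have pos: "0 < D / l h" using D1 l0[of h] by simp
    then have eq: "real (r h) = of_int \<lceil>D / l h\<rceil>" using that by (simp add: r_def)
    then have ge: "D / l h \<le> real (r h)" and le: "real (r h) \<le> D / l h + 1" by linarith+
    from ge pos show "1 \<le> r h" by (simp add: Suc_le_eq)
    show "D \<le> real (r h) * l h" using ge l0[of h] by (simp only: pos_divide_le_eq)
    have "real (r h) * l h \<le> (D / l h + 1) * l h" using le l0[of h] by (intro mult_right_mono) auto
    also have "\<dots> = D + l h" using l0[of h] by (simp add: field_simps)
    also have "\<dots> \<le> (1 + w) * D" using lD[OF that] by (simp add: algebra_simps)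
    finally show le2: "real (r h) * l h \<le> (1 + w) * D" .
    have "(1 + w) * D \<le> 2 * D" using w1(1) D1 by (intro mult_right_mono) auto
    with le2 have "real (r h) * l h \<le> 2 * D" by linarith
    then show "real (r h) \<le> 2 * D / l h" using l0[of h] by (simp only: pos_le_divide_eq)
  qed
  have rw: "real (r h) \<le> w * D" if "h < M" for h
  proof -
    have "2 / w \<le> l h" unfolding l_def by (rule q1)
    then have "2 \<le> l h * w" using w by (simp only: pos_divide_le_eq)
    then have "2 * D \<le> (l h * w) * D" using D1 by (intro mult_right_mono) auto
    then have "2 * D / l h \<le> w * D" using l0[of h] by (simp add: pos_divide_le_eq mult_ac)
    with rD(4)[OF that] show ?thesis by linarith
  qed
  have "roth_params w D M r a q"
    unfolding roth_params_def
  proof (intro conjI allI impI)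
    show "0 < D" using D1 by linarith
    show "coprime (a h) (q h)" for h using gd[of h] by (simp add: good_def)
    show "0 < q h" for h by (rule q0)
    show "D \<le> real (r h) * ln (real_of_int (q h))" if "h < M" for h using rD(2)[OF that] by (simp only: l_def)
    fix i h assume ih: "i < M" "h < i"
    then have "h < M" by simp
    have "2 / w * l h \<le> l i" unfolding l_def using ih(2) by (rule q2)
    then have "2 * l h \<le> w * l i" using w by (simp add: field_simps)
    then have "2 * l h * D \<le> w * l i * D" using D1 by (intro mult_right_mono) auto
    then have "2 * D / l i \<le> w * (D / l h)" using l0[of h] l0[of i] by (simp add: field_simps)
    also have "D / l h \<le> real (r h)" using rD(2)[OF \<open>h < M\<close>] l0[of h] by (simp only: pos_divide_le_eq)
    finally show "real (r i) \<le> w * real (r h)" using rD(4)[OF ih(1)] w by (simp add: mult_left_mono)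
  qed (fact r0 rD rw)+
  then have par: "roth_params \<omega> D M r a q" using w1(2) by (rule roth_params_mono)
  obtain P where P: "int_coeffs P" "P \<noteq> 0" "keys P \<subseteq> {..r}" "\<And>J. \<bar>lookup P J\<bar> \<le> exp (K * real (\<Sum>h<M. r h))"
    and van: "\<And>I. wt M r I \<le> real M * (1 / 2 - e / 12) \<Longrightarrow> lookup (shift M (\<lambda>_. \<alpha>) P) I = 0"
    using aux[of r] r0 rD(1) by blast
  define s where "s = (\<Sum>h<M. r h)"
  have s: "real s \<le> real M * (w * D)"
    unfolding s_def of_nat_sum using sum_bounded_above[of "{..<M}" "\<lambda>h. real (r h)" "w * D"] rw by simp
  have "\<bar>lookup P J\<bar> \<le> exp (\<omega> * D)" for J
  proof -
    have "K * real s \<le> K * (real M * (w * D))" using s K by (rule mult_left_mono)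
    also have "\<dots> = (K * real M * w) * D" by (simp only: mult_ac)
    also have "\<dots> \<le> \<omega> * D" using wK D1 by (intro mult_right_mono) auto
    finally have "exp (K * real s) \<le> exp (\<omega> * D)" by simp
    with P(4)[of J] show ?thesis unfolding s_def by linarith
  qed
  with rb par P(1-3) obtain J where J: "lookup (shift M (\<lambda>h. of_int (a h) / of_int (q h)) P) J \<noteq> 0" "wt M r J \<le> e / 100"
    unfolding roth_bound_def by blast
  define v where "v = lookup (shift M (\<lambda>h. of_int (a h) / of_int (q h)) P) J"
  have Jr: "J \<le> r"
    using J(1) keys_shift_le[OF P(3), of M "\<lambda>h. of_int (a h) / of_int (q h)"] by (auto simp: in_keys_iff)
  have "1 \<le> \<bar>v\<bar> * (\<Prod>h<M. of_int (q h) ^ r h)"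
    unfolding v_def using P(1,3) q0 J(1) by (rule abs_lookup_shift_ge)
  also have "(\<Prod>h<M. real_of_int (q h) ^ r h) \<le> exp (real M * ((1 + w) * D))"
  proof -
    have "real_of_int (q h) ^ r h = exp (real (r h) * l h)" for h
      using q0[of h] by (simp add: l_def exp_of_nat_mult)
    then have "(\<Prod>h<M. real_of_int (q h) ^ r h) = exp (\<Sum>h<M. real (r h) * l h)" by (simp add: exp_sum)
    also have "\<dots> \<le> exp (real M * ((1 + w) * D))"
      using sum_bounded_above[of "{..<M}" "\<lambda>h. real (r h) * l h" "(1 + w) * D"] rD(3) by simp
    finally show ?thesis .
  qed
  finally have lower: "1 \<le> \<bar>v\<bar> * exp (real M * ((1 + w) * D))" by (simp add: mult_left_mono)
  \<comment> \<open>Index at \<alpha> still guaranteed after the derivative of order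
    \<open>J\<close>, whose weight is at most e / 100.\<close>
  define \<tau> where "\<tau> = real M * (1 / 2 - e / 12) - e / 100"
  have upper: "\<bar>v\<bar> \<le> (1 + \<bar>\<alpha>\<bar>) ^ s * (2 ^ s * len P) * exp (- ((2 + e) * D * \<tau>))"
    unfolding v_def s_def
  proof (rule abs_lookup_shift_le[OF P(3) r0 Jr, where Q = "\<lambda>h. of_int (q h)"])
    fix I assume "wt M r I \<le> \<tau> + wt M r J"
    then have "wt M r I \<le> real M * (1 / 2 - e / 12)" using J(2) unfolding \<tau>_def by linarith
    then show "lookup (shift M (\<lambda>_. \<alpha>) P) I = 0" by (rule van)
  next
    fix h assume h: "h < M"
    have "\<bar>of_int (a h) / of_int (q h) - \<alpha>\<bar> \<le> of_int (q h) powr (- (2 + \<epsilon>))"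
      using gd[of h] by (simp add: good_def)
    also have "\<dots> = exp (- ((2 + \<epsilon>) * l h))" using q0[of h] by (simp add: powr_def l_def algebra_simps)
    also have "\<dots> \<le> exp (- ((2 + e) * l h))" using e(3) l0[of h] by (simp add: mult_right_mono)
    finally show "1 \<le> r h \<and> D \<le> real (r h) * ln (of_int (q h)) \<and> 0 < real_of_int (q h) \<and>
        \<bar>of_int (a h) / of_int (q h) - \<alpha>\<bar> \<le> exp (- ((2 + e) * ln (of_int (q h))))"
      using rD(1,2)[OF h] q0[of h] by (simp add: l_def)
  qed (use e D1 in auto)
  have "len P \<le> 2 ^ s * exp (K * real s)" unfolding s_def using r0 P(3,4) by (rule len_le_card)
  then have "(1 + \<bar>\<alpha>\<bar>) ^ s * (2 ^ s * len P) \<le> (1 + \<bar>\<alpha>\<bar>) ^ s * (2 ^ s * (2 ^ s * exp (K * real s)))"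
    by (intro mult_left_mono) auto
  also have "\<dots> = exp (real s * K2)"
  proof -
    have "(1 + \<bar>\<alpha>\<bar>) ^ s = exp (real s * ln (1 + \<bar>\<alpha>\<bar>))" by (simp add: exp_of_nat_mult)
    moreover have "(2::real) ^ s = exp (real s * ln 2)" by (simp add: exp_of_nat_mult)
    ultimately show ?thesis by (simp add: K2_def exp_add[symmetric] algebra_simps)
  qed
  also have "\<dots> \<le> exp (real M * (w * D) * K2)" using s K2 by (simp add: mult_right_mono)
  finally have "(1 + \<bar>\<alpha>\<bar>) ^ s * (2 ^ s * len P) \<le> exp (real M * (w * D) * K2)" .
  then have "(1 + \<bar>\<alpha>\<bar>) ^ s * (2 ^ s * len P) * exp (- ((2 + e) * D * \<tau>))
      \<le> exp (real M * (w * D) * K2) * exp (- ((2 + e) * D * \<tau>))" by (rule mult_right_mono) simp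
  with upper have "\<bar>v\<bar> \<le> exp (real M * (w * D) * K2) * exp (- ((2 + e) * D * \<tau>))" by linarith
  from mult_right_mono[OF this, of "exp (real M * ((1 + w) * D))"]
  have "\<bar>v\<bar> * exp (real M * ((1 + w) * D)) \<le> exp (real M * (w * D) * K2) * exp (- ((2 + e) * D * \<tau>)) * exp (real M * ((1 + w) * D))"
    by simp
  with lower have "1 \<le> exp (real M * (w * D) * K2) * exp (- ((2 + e) * D * \<tau>)) * exp (real M * ((1 + w) * D))" by (rule order_trans)
  also have "\<dots> = exp (D * (real M * (1 + w * (1 + K2)) - (2 + e) * \<tau>))"
    by (simp add: exp_add[symmetric] algebra_simps)
  finally have "0 \<le> D * (real M * (1 + w * (1 + K2)) - (2 + e) * \<tau>)" by simp
  then have "(2 + e) * \<tau> \<le> real M * (1 + w * (1 + K2))" using D1 by (simp add: zero_le_mult_iff)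
  also have "\<dots> \<le> real M * (1 + e / 8)" using wK2 by (intro mult_left_mono) auto
  finally have up: "(2 + e) * \<tau> \<le> real M * (1 + e / 8)" .
  have e2: "e * e \<le> e" using e mult_left_mono[of e 1 e] by simp
  have eq: "(2 + e) * \<tau> = real M * ((2 + e) * (1 / 2 - e / 12)) - (2 + e) * (e / 100)"
    unfolding \<tau>_def by (simp only: right_diff_distrib mult_ac)
  have "(2 + e) * (1 / 2 - e / 12) = 1 + e / 3 - e * e / 12" by (simp add: field_simps)
  then have "1 + e / 4 \<le> (2 + e) * (1 / 2 - e / 12)" using e2 by linarith
  then have "real M * (1 + e / 4) \<le> real M * ((2 + e) * (1 / 2 - e / 12))" by (rule mult_left_mono) simp
  moreover have "(2 + e) * (e / 100) \<le> 3 * (e / 100)" using e by (intro mult_right_mono) auto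
  ultimately have "real M * (1 + e / 4) - 3 * (e / 100) \<le> real M * (1 + e / 8)" using up eq by linarith
  then have "real M * e / 8 \<le> 3 * (e / 100)" by (simp add: distrib_left)
  moreover have "1 * e \<le> real M * e" using M e by (intro mult_right_mono) auto
  ultimately show False using e(1) by linarith
qed

text \<open>The notation of \<open>Sum_any\<close> makes \<open>\<Sum>n. f n\<close> ambiguous with \<open>suminf\<close>.\<close>
no_syntax
  "_Sum_any" :: "pttrn \<Rightarrow> 'a \<Rightarrow> 'a::comm_monoid_add"    (\<open>(\<open>indent=2 notation=\<open>binder \<Sum>\<close>\<close>\<Sum>_. _)\<close> [0, 10] 10)

section \<open>Series with rapidly growing denominators\<close>

text \<open>For s \<ge> 1, each doubling of the base at least halves the power with exponent -s;
  this gives the tails below a geometric majorant.\<close>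

lemma powr_doubling:
  fixes x :: real
  assumes "x > 0" "y \<ge> 2 ^ j * x" "s \<ge> 1"
  shows "y powr (- s) \<le> (1 / 2) ^ j * x powr (- s)"
proof -
  have "(2 ^ j * x) powr s \<le> y powr s" using assms by (intro powr_mono2) auto
  moreover have "2 ^ j * x powr s \<le> (2 ^ j * x) powr s"
  proof -
    have "(2::real) ^ j = (2 ^ j) powr 1" by simp
    also have "\<dots> \<le> (2 ^ j) powr s" using assms(3) by (intro powr_mono) auto
    finally show ?thesis using assms(1) by (simp add: powr_mult mult_right_mono)
  qed
  ultimately have "2 ^ j * x powr s \<le> y powr s" by linarith
  moreover have "2 ^ j * x powr s > 0" using assms(1) by simp
  ultimately have "1 / y powr s \<le> 1 / (2 ^ j * x powr s)" by (intro frac_le) auto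
  then show ?thesis by (simp add: powr_minus_divide power_one_over field_simps)
qed

text \<open>Summability is part of the conclusion because \<open>suminf\<close> is a total function,
  and its value alone would not show that \<theta> is a convergent sum.\<close>

theorem theorem7:
  fixes a b :: "nat \<Rightarrow> nat" and \<theta> :: real
  assumes a_pos: "\<And>n. n \<ge> 1 \<Longrightarrow> a n > 0"
    and b_pos: "\<And>n. n \<ge> 1 \<Longrightarrow> b n > 0"
    and b_less: "\<And>n. n \<ge> 1 \<Longrightarrow> b n < b (n + 1)"
    and b_dvd: "\<And>n. n \<ge> 1 \<Longrightarrow> b n dvd b (n + 1)"
    and growth: "\<exists>\<epsilon>::real. \<epsilon> > 0 \<and>
      (\<forall>\<^sub>F n in sequentially.
        real (a (n + 1)) * real (b n) powr (2 + \<epsilon>) / real (b (n + 1)) < 1 / 2)"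
    and theta: "\<theta> = (\<Sum>n. real (a (n + 1)) / real (b (n + 1)))"
  shows "summable (\<lambda>n. real (a (n + 1)) / real (b (n + 1))) \<and> \<not> algebraic \<theta>"
proof -
  obtain \<epsilon> N0 where \<epsilon>: "\<epsilon> > 0"
    and gr: "\<And>n. n \<ge> N0 \<Longrightarrow> real (a (n + 1)) * real (b n) powr (2 + \<epsilon>) / real (b (n + 1)) < 1 / 2"
    using growth by (auto simp: eventually_sequentially)
  define N where "N = max N0 1"
  define s where "s = 2 + \<epsilon>"
  \<comment> \<open>The shift matters: \<open>S n\<close> below then ends with the term of
    denominator \<open>b n\<close>, while the first omitted term \<open>t n\<close> is the one that
    the growth condition compares with \<open>b n\<close>.\<close>
  define t where "t n = real (a (n + 1)) / real (b (n + 1))" for n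
  have t_pos: "t n > 0" for n using a_pos[of "n + 1"] b_pos[of "n + 1"] by (simp add: t_def)
  have t_less: "t n < (1 / 2) * real (b n) powr (- s)" if "n \<ge> N" for n
  proof -
    have "t n * real (b n) powr s < 1 / 2" using gr[of n] that by (simp add: t_def s_def N_def)
    moreover have "real (b n) powr s > 0" using b_pos[of n] that by (simp add: N_def)
    ultimately show ?thesis by (simp add: powr_minus_divide field_simps)
  qed
  have b_dvd_le: "b k dvd b n" if "1 \<le> k" "k \<le> n" for k n
    using that(2)
  proof (induction n rule: dec_induct)
    case (step n)
    then have "b n dvd b (Suc n)" using b_dvd[of n] that(1) by simp
    with step.IH show ?case by (rule dvd_trans)
  qed simp
  \<comment> \<open>Consecutive quotients are integers greater than 1, hence at least 2.\<close>
  have b_double: "2 ^ j * b n \<le> b (n + j)" if "n \<ge> 1" for n j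
  proof (induction j)
    case (Suc j)
    have "b (n + j) dvd b (n + j + 1)" using that by (intro b_dvd) simp
    then obtain c where c: "b (n + j + 1) = b (n + j) * c" by (rule dvdE)
    have "b (n + j) < b (n + j) * c" using b_less[of "n + j"] that c by simp
    then have "c \<noteq> 0" "c \<noteq> 1" by (auto intro!: notI)
    then have "2 \<le> c" by simp
    then have "b (n + j) * 2 \<le> b (n + j) * c" by (rule mult_left_mono) simp
    then have "2 * b (n + j) \<le> b (Suc (n + j))" using c by (simp only: mult.commute Suc_eq_plus1)
    moreover have "2 * (2 ^ j * b n) \<le> 2 * b (n + j)" using Suc by (intro mult_left_mono) auto
    ultimately show ?case unfolding power_Suc mult.assoc add_Suc_right by linarith
  qed simp
  have tail: "t (n + j) \<le> (1 / 2) ^ j * ((1 / 2) * real (b n) powr (- s))" if "n \<ge> N" for n j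
  proof -
    have n1: "n \<ge> 1" using that by (simp add: N_def)
    have "real (2 ^ j * b n) \<le> real (b (n + j))" using b_double[OF n1] by (rule of_nat_mono)
    then have "real (b (n + j)) powr (- s) \<le> (1 / 2) ^ j * real (b n) powr (- s)"
      using b_pos[OF n1] \<epsilon> by (intro powr_doubling) (auto simp: s_def)
    with t_less[of "n + j"] that show ?thesis by simp
  qed
  \<comment> \<open>The 1 / 2 of the growth condition exactly cancels the sum 2 of the geometric
    series, so no constant is left in front of the power of \<open>b n\<close>.\<close>
  have geo: "(\<lambda>j. (1 / 2) ^ j * ((1 / 2) * c)) sums c" for c :: real
    using sums_mult2[OF geometric_sums[of "1 / 2 :: real"], of "(1 / 2) * c"] by simp
  have sum_tail: "summable (\<lambda>j. t (j + n))" if "n \<ge> N" for n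
  proof (rule summable_comparison_test[OF _ sums_summable[OF geo[of "real (b n) powr (- s)"]]])
    show "\<exists>M. \<forall>j\<ge>M. norm (t (j + n)) \<le> (1 / 2) ^ j * ((1 / 2) * real (b n) powr (- s))"
      using tail[OF that] t_pos by (intro exI[of _ 0]) (simp add: less_imp_le add.commute)
  qed
  have summ: "summable t" using sum_tail[OF order_refl] by (simp only: summable_iff_shift)
  have \<theta>: "\<theta> = suminf t" unfolding theta t_def ..
  define S where "S n = (\<Sum>k<n. t k)" for n
  have rem: "\<theta> - S n = (\<Sum>j. t (j + n))" for n
    using suminf_minus_initial_segment[OF summ, of n] by (simp add: \<theta> S_def)
  have rem_pos: "0 < \<theta> - S n" for n
  proof -
    have "summable (\<lambda>j. t (j + n))" using summ by (simp only: summable_iff_shift)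
    then show ?thesis unfolding rem using t_pos by (rule suminf_pos)
  qed
  have rem_less: "\<theta> - S n < real (b n) powr (- s)" if "n \<ge> N" for n
  proof -
    define g where "g j = (1 / 2) ^ j * ((1 / 2) * real (b n) powr (- s))" for j :: nat
    have g: "summable g" "suminf g = real (b n) powr (- s)"
      using geo[of "real (b n) powr (- s)"] unfolding g_def by (auto simp only: sums_iff)
    \<comment> \<open>Strictness comes from the term j = 0, where the growth condition is
      strict.\<close>
    have "0 < (\<Sum>j. g j - t (j + n))"
    proof (rule suminf_pos2[where i = 0])
      show "summable (\<lambda>j. g j - t (j + n))" using g(1) sum_tail[OF that] by (rule summable_diff)
      show "0 \<le> g j - t (j + n)" for j using tail[OF that, of j] by (simp add: g_def add.commute)
      show "0 < g 0 - t (0 + n)" using t_less[OF that] by (simp add: g_def)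
    qed
    also have "\<dots> = suminf g - (\<Sum>j. t (j + n))" using g(1) sum_tail[OF that] by (rule suminf_diff[symmetric])
    finally show ?thesis unfolding rem g(2) by simp
  qed
  have S_int: "\<exists>p. S n * real (b n) = of_int p" if "n \<ge> 1" for n
  proof -
    have "S n * real (b n) = (\<Sum>k<n. of_int (int (a (k + 1) * (b n div b (k + 1)))))"
      unfolding S_def sum_distrib_right
    proof (rule sum.cong[OF refl])
      fix k assume "k \<in> {..<n}"
      then have "b (k + 1) dvd b n" by (intro b_dvd_le) auto
      then obtain c where c: "b n = b (k + 1) * c" by (elim dvdE)
      then show "t k * real (b n) = of_int (int (a (k + 1) * (b n div b (k + 1))))"
        using b_pos[of "k + 1"] by (simp add: t_def)
    qed
    then show ?thesis by (intro exI) (simp only: of_int_sum[symmetric])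
  qed
  have "\<not> algebraic \<theta>"
  proof
    assume "algebraic \<theta>"
    from roth[OF this \<epsilon>] obtain Q0 where
      Q0: "\<And>p q. coprime p q \<Longrightarrow> q > Q0 \<Longrightarrow> of_int q powr (- s) \<le> \<bar>of_int p / of_int q - \<theta>\<bar>"
      unfolding s_def by blast
    \<comment> \<open>Every positive denominator up to \<open>Q0\<close> divides \<open>F\<close>,
      so the numbers \<open>F * S n\<close> are integers for all n \<ge> N. Their increments
      \<open>F * t n\<close> are then positive integers tending to 0.\<close>
    define F where "F = (fact (nat Q0) :: int)"
    have F: "F > 0" by (simp add: F_def)
    have FS: "of_int F * S n \<in> \<int>" if n: "n \<ge> N" for n
    proof -
      have n1: "n \<ge> 1" using n by (simp add: N_def)
      have bn: "b n > 0" using b_pos[OF n1] .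
      obtain P where P: "S n * real (b n) = of_int P" using S_int[OF n1] by blast
      have "S n = of_int P / of_int (int (b n))" using P bn by (simp add: field_simps)
      then have "S n \<in> \<rat>" by simp
      then obtain p q where pq: "q > 0" "coprime p q" "S n = of_int p / of_int q" by (rule Rats_cases')
      have "of_int (p * int (b n)) = (of_int (P * q) :: real)"
        using P pq(1) unfolding pq(3) by (simp add: field_simps)
      then have "p * int (b n) = P * q" by (simp only: of_int_eq_iff)
      then have "q dvd p * int (b n)" by simp
      then have "q dvd int (b n)" using pq(2) by (simp add: coprime_dvd_mult_right_iff coprime_commute)
      then have "q \<le> int (b n)" using bn by (intro zdvd_imp_le) auto
      \<comment> \<open>Roth's theorem needs lowest terms, but reducing the fraction only shrinks
        the denominator, so the quality of the approximation is kept.\<close>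
      then have "real (b n) powr (- s) \<le> of_int q powr (- s)"
        using pq(1) \<epsilon> by (intro powr_mono2') (auto simp: s_def)
      then have "\<bar>of_int p / of_int q - \<theta>\<bar> < of_int q powr (- s)"
        using rem_less[OF n] rem_pos[of n] unfolding pq(3) by linarith
      with Q0[OF pq(2)] have "q \<le> Q0" by (meson not_le)
      then have "nat q dvd fact (nat Q0)" using pq(1) by (intro dvd_fact) auto
      then have "int (nat q) dvd int (fact (nat Q0))" by (simp only: int_dvd_int_iff)
      then have "q dvd F" using pq(1) by (simp add: F_def)
      then obtain c where c: "F = q * c" by (elim dvdE)
      have "of_int F * S n = of_int (c * p)" using pq(1) unfolding pq(3) c by simp
      then show ?thesis by (simp only: Ints_of_int)
    qed
    have "t \<longlonglongrightarrow> 0" using summ by (rule summable_LIMSEQ_zero)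
    moreover have "0 < 1 / real_of_int F" using F by simp
    ultimately have "\<forall>\<^sub>F n in sequentially. t n < 1 / real_of_int F" by (rule order_tendstoD)
    then obtain N1 where N1: "\<And>n. n \<ge> N1 \<Longrightarrow> t n < 1 / real_of_int F" by (auto simp: eventually_sequentially)
    define n where "n = max N N1"
    have "of_int F * t n = of_int F * S (Suc n) - of_int F * S n" by (simp add: S_def algebra_simps)
    also have "\<dots> \<in> \<int>" using FS[of n] FS[of "Suc n"] by (intro Ints_diff) (auto simp: n_def)
    finally have "of_int F * t n \<in> \<int>" .
    moreover have "of_int F * t n \<noteq> 0" using F t_pos[of n] by simp
    ultimately have "1 \<le> \<bar>of_int F * t n\<bar>" by (rule Ints_nonzero_abs_ge1)
    moreover have "of_int F * t n > 0" using F t_pos[of n] by simp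
    moreover have "of_int F * t n < 1" using N1[of n] F by (simp add: n_def field_simps)
    ultimately show False by linarith
  qed
  with summ show ?thesis unfolding t_def by simp
qed

end
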